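(* Let $M^n$ be a smooth closed manifold, let $f\colon M^n\to M^n$ be an $A$-endomorphism, and let $\Lambda$ be a basic set of $f$. Then $\Lambda$ is an attractor of $f$ if and only if there exists $\varepsilon>0$ such that for every $x\in\Lambda$ and every $\bar x\in\hat x\cap\hat\Lambda$ one has $W^u_{x,\bar x,\varepsilon}\subset\Lambda$.
   Context: A $C^r$-endomorphism ($r\ge 1$) of a smooth closed manifold $M^n$ is a $C^r$-smooth surjective map $f\colon M^n\to M^n$ (not necessarily injective). A point $x$ is regular if $Df(x)\colon T_xM^n\to T_{f(x)}M^n$ has rank $n$, and singular otherwise. Orbits. $\hat M=\{\{x_i\}_{i\in\mathbb Z}\in\prod_{i\in\mathbb Z}M^n : f(x_i)=x_{i+1}\ \forall i\in\mathbb Z\}$. For $x\in M^n$, $\hat x=\{\{x_i\}\in\hat M : x_0=x\}$; $\bar x$ denotes an element $\{x_i\}_{i\in\mathbb Z}$ of $\hat x$. For an $f$-invariant set $\Lambda$ (i.e. $f(\Lambda)=\Lambda$), $\hat\Lambda=\{\{x_i\}\in\hat M : x_i\in\Lambda\ \forall i\}$. The shift is $\hat f(\{x_i\})=\{x_{i+1}\}$, with inverse $\hat f^{-1}(\{x_i\})=\{x_{i-1}\}$. Hyperbolicity. Fix a smooth Riemannian metric on $M^n$ with norm $\|\cdot\|$. A closed $f$-invariant set $\Lambda\subset M^n$ is hyperbolic if there are $C>0$, $0<\lambda<1$ such that for every $x\in\Lambda$ and every $\bar x=\{x_i\}\in\hat x\cap\hat\Lambda$ there is a continuous splitting $\bigcup_{i\in\mathbb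 Z}T_{x_i}M^n=\bigcup_{i\in\mathbb Z}E^s_{x_i,\hat f^i(\bar x)}\oplus E^u_{x_i,\hat f^i(\bar x)}$ with (1) $Df(E^s_{x_i,\hat f^i(\bar x)})=E^s_{x_{i+1},\hat f^{i+1}(\bar x)}$ and $Df(E^u_{x_i,\hat f^i(\bar x)})=E^u_{x_{i+1},\hat f^{i+1}(\bar x)}$; (2) $\|Df^k(v)\|\le C\lambda^k\|v\|$ for all $k\ge0$, $i\in\mathbb Z$, $v\in E^s_{x_i,\hat f^i(\bar x)}$; (3) $\|Df^k(v)\|\ge(1/C)\lambda^{-k}\|v\|$ for all $k\ge0$, $i\in\mathbb Z$, $v\in E^u_{x_i,\hat f^i(\bar x)}$. $A$-endomorphisms and basic sets. An endomorphism $f$ is an $A$-endomorphism (satisfies axiom $A$) if its nonwandering set $\Omega_f$ is hyperbolic and contains no singular points of $f$, and the periodic points of $f$ are dense in $\Omega_f$. By the known spectral decomposition theorem (Przytycki), $\Omega_f$ then decomposes uniquely into a finite union of closed $f$-invariant sets $\Lambda_1,\dots,\Lambda_l$, called basic sets, such that the restriction of $f$ to each is topologically transitive. Attractor. A basic set $\Lambda$ is an attractor if it has a closed neighborhood $U\supset\Lambda$ such that $f(U)\subset\operatorname{Int}U$ and $\bigcap_{n=0}^\infty f^n(U)=\Lambda$. Local unstable manifold. Let $\rho$ be the distance on $M^n$ induced by the Riemannian metric. For $x\in\Lambda$, $\bar x=\{x_i\}\in\hat x\cap\hat\Lambda$ and $\varepsilon>0$, $W^u_{x,\bar x,\varepsilon}=\{y\in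 M^n : \exists\,\bar y=\{y_i\}\in\hat y \text{ with } \rho(x_k,y_k)<\varepsilon \text{ for } k=0,-1,-2,\dots\}$. *)

theory Defs
  imports "HOL-Analysis.Analysis" "HOL-Library.Extended_Nat"
begin

section \<open>Maps of class C^r between open subsets of Euclidean spaces\<close>

text \<open>The predicates below are meant for open \<open>S\<close>. The order \<open>r = \<infinity>\<close> is smoothness.\<close>

fun Ck_on :: "nat \<Rightarrow> ('a::euclidean_space \<Rightarrow> 'b::real_normed_vector) \<Rightarrow> 'a set \<Rightarrow> bool" where
  "Ck_on 0 h S \<longleftrightarrow> continuous_on S h"
| "Ck_on (Suc k) h S \<longleftrightarrow>
     (\<forall>p\<in>S. h differentiable (at p)) \<and>
     (\<forall>v. Ck_on k (\<lambda>p. frechet_derivative h (at p) v) S)"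

definition Cr_on :: "enat \<Rightarrow> ('a::euclidean_space \<Rightarrow> 'b::real_normed_vector) \<Rightarrow> 'a set \<Rightarrow> bool" where
  "Cr_on r h S \<longleftrightarrow> (\<forall>k::nat. enat k \<le> r \<longrightarrow> Ck_on k h S)"


section \<open>Smooth closed manifolds\<close>

text \<open>
  The underlying topological space is a type \<open>'m\<close>; the model space is a Euclidean space \<open>'e\<close>,
  so the dimension is \<open>DIM('e)\<close>. A chart is a pair of its domain and its coordinate map; values
  of the coordinate map outside of the domain are irrelevant.
\<close>

type_synonym ('m, 'e) chart = "'m set \<times> ('m \<Rightarrow> 'e)"

definition cdom :: "('m, 'e) chart \<Rightarrow> 'm set" where
  "cdom c = fst c"

definition coord :: "('m, 'e) chart \<Rightarrow> 'm \<Rightarrow> 'e" where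
  "coord c = snd c"

definition param :: "('m, 'e) chart \<Rightarrow> 'e \<Rightarrow> 'm" where
  "param c = inv_into (cdom c) (coord c)"

definition is_chart :: "('m::topological_space, 'e::euclidean_space) chart \<Rightarrow> bool" where
  "is_chart c \<longleftrightarrow> open (cdom c) \<and> open (coord c ` cdom c) \<and>
     homeomorphism (cdom c) (coord c ` cdom c) (coord c) (param c)"

definition smooth_atlas :: "('m::topological_space, 'e::euclidean_space) chart set \<Rightarrow> bool" where
  "smooth_atlas A \<longleftrightarrow>
     (\<forall>c\<in>A. is_chart c) \<and> (\<Union>c\<in>A. cdom c) = UNIV \<and>
     (\<forall>c\<in>A. \<forall>d\<in>A. Cr_on \<infinity> (coord d \<circ> param c) (coord c ` (cdom c \<inter> cdom d)))"

definition smooth_closed_manifold ::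
  "('m::{t2_space,second_countable_topology}, 'e::euclidean_space) chart set \<Rightarrow> bool" where
  "smooth_closed_manifold A \<longleftrightarrow> smooth_atlas A \<and> compact (UNIV :: 'm set)"

definition Cr_map ::
  "('m::topological_space, 'e::euclidean_space) chart set \<Rightarrow> enat \<Rightarrow> ('m \<Rightarrow> 'm) \<Rightarrow> bool" where
  "Cr_map A r f \<longleftrightarrow> continuous_on UNIV f \<and>
     (\<forall>c\<in>A. \<forall>d\<in>A. Cr_on r (coord d \<circ> f \<circ> param c) (coord c ` (cdom c \<inter> f -` cdom d)))"


section \<open>Tangent spaces, Riemannian metrics and distance\<close>

text \<open>
  The tangent space at \<open>x\<close> is modelled as \<open>'e\<close>, a vector being represented by its coordinates in
  a fixed chart \<open>chart_at A x\<close> around \<open>x\<close>. Different choices of the charts give canonically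
  isomorphic tangent spaces. As \<open>chart_at A x\<close> need not depend continuously on \<open>x\<close>, continuity or
  smoothness of objects on the tangent bundle is always expressed in a common chart \<open>c\<close>, where
  \<open>tangent_vec A c x u\<close> is the vector tangent at \<open>x\<close> with coordinates \<open>u\<close> in \<open>c\<close>.
\<close>

definition chart_at :: "('m, 'e) chart set \<Rightarrow> 'm \<Rightarrow> ('m, 'e) chart" where
  "chart_at A x = (SOME c. c \<in> A \<and> x \<in> cdom c)"

definition tangent_vec ::
  "('m, 'e::euclidean_space) chart set \<Rightarrow> ('m, 'e) chart \<Rightarrow> 'm \<Rightarrow> 'e \<Rightarrow> 'e" where
  "tangent_vec A c x = frechet_derivative (coord (chart_at A x) \<circ> param c) (at (coord c x))"

definition tangent_map ::
  "('m, 'e::euclidean_space) chart set \<Rightarrow> ('m \<Rightarrow> 'm) \<Rightarrow> 'm \<Rightarrow> 'e \<Rightarrow> 'e" where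
  "tangent_map A f x =
     frechet_derivative (coord (chart_at A (f x)) \<circ> f \<circ> param (chart_at A x))
       (at (coord (chart_at A x) x))"

definition regular_point ::
  "('m, 'e::euclidean_space) chart set \<Rightarrow> ('m \<Rightarrow> 'm) \<Rightarrow> 'm \<Rightarrow> bool" where
  "regular_point A f x \<longleftrightarrow> dim (range (tangent_map A f x)) = DIM('e)"

definition riemannian_metric ::
  "('m, 'e::euclidean_space) chart set \<Rightarrow> ('m \<Rightarrow> 'e \<Rightarrow> 'e \<Rightarrow> real) \<Rightarrow> bool" where
  "riemannian_metric A g \<longleftrightarrow>
     (\<forall>x. bilinear (g x) \<and> (\<forall>u v. g x u v = g x v u) \<and> (\<forall>u. u \<noteq> 0 \<longrightarrow> 0 < g x u u)) \<and>
     (\<forall>c\<in>A. \<forall>u v. Cr_on \<infinity>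
        (\<lambda>p. g (param c p) (tangent_vec A c (param c p) u) (tangent_vec A c (param c p) v))
        (coord c ` cdom c))"

definition tnorm :: "('m \<Rightarrow> 'e \<Rightarrow> 'e \<Rightarrow> real) \<Rightarrow> 'm \<Rightarrow> 'e \<Rightarrow> real" where
  "tnorm g x v = sqrt (g x v v)"

definition C1_curve_on ::
  "('m, 'e::euclidean_space) chart set \<Rightarrow> real \<Rightarrow> real \<Rightarrow> (real \<Rightarrow> 'm) \<Rightarrow> bool" where
  "C1_curve_on A a b \<gamma> \<longleftrightarrow>
     (\<forall>c\<in>A. \<exists>D. continuous_on ({a..b} \<inter> \<gamma> -` cdom c) D \<and>
        (\<forall>t \<in> {a..b} \<inter> \<gamma> -` cdom c.
           ((coord c \<circ> \<gamma>) has_vector_derivative D t) (at t within {a..b})))"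

definition piecewise_C1_curve ::
  "('m::topological_space, 'e::euclidean_space) chart set \<Rightarrow> (real \<Rightarrow> 'm) \<Rightarrow> bool" where
  "piecewise_C1_curve A \<gamma> \<longleftrightarrow> continuous_on {0..1} \<gamma> \<and>
     (\<exists>S. finite S \<and> {0, 1} \<subseteq> S \<and> S \<subseteq> {0..1} \<and>
        (\<forall>a\<in>S. \<forall>b\<in>S. a < b \<and> {a<..<b} \<inter> S = {} \<longrightarrow> C1_curve_on A a b \<gamma>))"

definition velocity ::
  "('m, 'e::euclidean_space) chart set \<Rightarrow> (real \<Rightarrow> 'm) \<Rightarrow> real \<Rightarrow> 'e" where
  "velocity A \<gamma> t = vector_derivative (coord (chart_at A (\<gamma> t)) \<circ> \<gamma>) (at t)"

text \<open>The finitely many break points, where \<open>velocity\<close> is unspecified, do not affect the integral.\<close>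

definition curve_length ::
  "('m, 'e::euclidean_space) chart set \<Rightarrow> ('m \<Rightarrow> 'e \<Rightarrow> 'e \<Rightarrow> real) \<Rightarrow> (real \<Rightarrow> 'm) \<Rightarrow> ennreal" where
  "curve_length A g \<gamma> =
     (\<integral>\<^sup>+ t \<in> {0..1}. ennreal (tnorm g (\<gamma> t) (velocity A \<gamma> t)) \<partial>lborel)"

text \<open>
  Connectedness is not assumed; points of different components have distance \<open>\<infinity>\<close>, as an infimum
  over the empty set.
\<close>

definition riemannian_dist ::
  "('m::topological_space, 'e::euclidean_space) chart set \<Rightarrow> ('m \<Rightarrow> 'e \<Rightarrow> 'e \<Rightarrow> real) \<Rightarrow>
     'm \<Rightarrow> 'm \<Rightarrow> ennreal" where
  "riemannian_dist A g x y =
     (INF \<gamma> \<in> {\<gamma>. piecewise_C1_curve A \<gamma> \<and> \<gamma> 0 = x \<and> \<gamma> 1 = y}. curve_length A g \<gamma>)"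


section \<open>Full orbits\<close>

definition full_orbits :: "('m \<Rightarrow> 'm) \<Rightarrow> (int \<Rightarrow> 'm) set" where
  "full_orbits f = {xs. \<forall>i. f (xs i) = xs (i + 1)}"

definition orbits_of :: "('m \<Rightarrow> 'm) \<Rightarrow> 'm \<Rightarrow> (int \<Rightarrow> 'm) set" where
  "orbits_of f x = {xs \<in> full_orbits f. xs 0 = x}"

definition orbits_in :: "('m \<Rightarrow> 'm) \<Rightarrow> 'm set \<Rightarrow> (int \<Rightarrow> 'm) set" where
  "orbits_in f L = {xs \<in> full_orbits f. \<forall>i. xs i \<in> L}"

text \<open>The \<open>i\<close>-th iterate of the shift, for an arbitrary integer \<open>i\<close>.\<close>

definition shift_pow :: "int \<Rightarrow> (int \<Rightarrow> 'm) \<Rightarrow> (int \<Rightarrow> 'm)" where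
  "shift_pow i xs = (\<lambda>j. xs (j + i))"


section \<open>Hyperbolic sets\<close>

text \<open>
  \<open>Es\<close> and \<open>Eu\<close> assign to an orbit \<open>z\<close> subspaces of the tangent space at \<open>z 0\<close>. The splitting is
  continuous if the projection onto \<open>Es z\<close> along \<open>Eu z\<close>, written in charts, depends continuously
  on \<open>z\<close>, where orbits carry the product topology.
\<close>

definition continuous_splitting ::
  "('m::topological_space, 'e::euclidean_space) chart set \<Rightarrow> (int \<Rightarrow> 'm) set \<Rightarrow>
     ((int \<Rightarrow> 'm) \<Rightarrow> 'e set) \<Rightarrow> ((int \<Rightarrow> 'm) \<Rightarrow> 'e set) \<Rightarrow> bool" where
  "continuous_splitting A Z Es Eu \<longleftrightarrow>
     (\<forall>z\<in>Z. subspace (Es z) \<and> subspace (Eu z) \<and> Es z \<inter> Eu z = {0} \<and>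
        (\<forall>w. \<exists>a\<in>Es z. \<exists>b\<in>Eu z. w = a + b)) \<and>
     (\<forall>c\<in>A. \<forall>u. continuous_on {z\<in>Z. z 0 \<in> cdom c}
        (\<lambda>z. THE s. tangent_vec A c (z 0) s \<in> Es z \<and> tangent_vec A c (z 0) (u - s) \<in> Eu z))"

definition hyperbolic ::
  "('m::topological_space, 'e::euclidean_space) chart set \<Rightarrow> ('m \<Rightarrow> 'e \<Rightarrow> 'e \<Rightarrow> real) \<Rightarrow>
     ('m \<Rightarrow> 'm) \<Rightarrow> 'm set \<Rightarrow> bool" where
  "hyperbolic A g f L \<longleftrightarrow> closed L \<and> f ` L = L \<and>
     (\<exists>C>0. \<exists>\<mu>. 0 < \<mu> \<and> \<mu> < 1 \<and>
       (\<forall>x\<in>L. \<forall>xs \<in> orbits_of f x \<inter> orbits_in f L. \<exists>Es Eu.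
          continuous_splitting A (range (\<lambda>i. shift_pow i xs)) Es Eu \<and>
          (\<forall>i. tangent_map A f (xs i) ` Es (shift_pow i xs) = Es (shift_pow (i + 1) xs) \<and>
               tangent_map A f (xs i) ` Eu (shift_pow i xs) = Eu (shift_pow (i + 1) xs)) \<and>
          (\<forall>k::nat. \<forall>i. \<forall>v \<in> Es (shift_pow i xs).
             tnorm g (xs (i + int k)) (tangent_map A (f ^^ k) (xs i) v)
               \<le> C * \<mu> ^ k * tnorm g (xs i) v) \<and>
          (\<forall>k::nat. \<forall>i. \<forall>v \<in> Eu (shift_pow i xs).
             tnorm g (xs (i + int k)) (tangent_map A (f ^^ k) (xs i) v)
               \<ge> (1 / C) * inverse \<mu> ^ k * tnorm g (xs i) v)))"


section \<open>Axiom A endomorphisms, basic sets, attractors\<close>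

definition endomorphism ::
  "('m::topological_space, 'e::euclidean_space) chart set \<Rightarrow> enat \<Rightarrow> ('m \<Rightarrow> 'm) \<Rightarrow> bool" where
  "endomorphism A r f \<longleftrightarrow> Cr_map A r f \<and> surj f"

definition nonwandering :: "('m::topological_space \<Rightarrow> 'm) \<Rightarrow> 'm set" where
  "nonwandering f =
     {x. \<forall>U. open U \<and> x \<in> U \<longrightarrow> (\<exists>n\<ge>1. (f ^^ n) ` U \<inter> U \<noteq> {})}"

definition periodic_points :: "('m \<Rightarrow> 'm) \<Rightarrow> 'm set" where
  "periodic_points f = {x. \<exists>p\<ge>1. (f ^^ p) x = x}"

definition A_endomorphism ::
  "('m::topological_space, 'e::euclidean_space) chart set \<Rightarrow> ('m \<Rightarrow> 'e \<Rightarrow> 'e \<Rightarrow> real) \<Rightarrow>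
     enat \<Rightarrow> ('m \<Rightarrow> 'm) \<Rightarrow> bool" where
  "A_endomorphism A g r f \<longleftrightarrow> endomorphism A r f \<and>
     hyperbolic A g f (nonwandering f) \<and>
     (\<forall>x \<in> nonwandering f. regular_point A f x) \<and>
     nonwandering f \<subseteq> closure (periodic_points f)"

definition transitive_on :: "('m::topological_space \<Rightarrow> 'm) \<Rightarrow> 'm set \<Rightarrow> bool" where
  "transitive_on f L \<longleftrightarrow>
     (\<forall>U V. open U \<and> open V \<and> U \<inter> L \<noteq> {} \<and> V \<inter> L \<noteq> {} \<longrightarrow>
        (\<exists>n. (f ^^ n) ` (U \<inter> L) \<inter> V \<noteq> {}))"

text \<open>
  Nonemptiness and disjointness of the pieces are what makes the decomposition unique.
\<close>

definition spectral_decomposition ::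
  "('m::topological_space \<Rightarrow> 'm) \<Rightarrow> 'm set set \<Rightarrow> bool" where
  "spectral_decomposition f B \<longleftrightarrow> finite B \<and> pairwise disjnt B \<and> \<Union>B = nonwandering f \<and>
     (\<forall>L\<in>B. L \<noteq> {} \<and> closed L \<and> f ` L = L \<and> transitive_on f L)"

definition basic_set :: "('m::topological_space \<Rightarrow> 'm) \<Rightarrow> 'm set \<Rightarrow> bool" where
  "basic_set f L \<longleftrightarrow> (\<exists>B. spectral_decomposition f B \<and> L \<in> B)"

definition attractor :: "('m::topological_space \<Rightarrow> 'm) \<Rightarrow> 'm set \<Rightarrow> bool" where
  "attractor f L \<longleftrightarrow>
     (\<exists>U. closed U \<and> L \<subseteq> interior U \<and> f ` U \<subseteq> interior U \<and> (\<Inter>n. (f ^^ n) ` U) = L)"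

definition local_unstable ::
  "('m::topological_space, 'e::euclidean_space) chart set \<Rightarrow> ('m \<Rightarrow> 'e \<Rightarrow> 'e \<Rightarrow> real) \<Rightarrow>
     ('m \<Rightarrow> 'm) \<Rightarrow> (int \<Rightarrow> 'm) \<Rightarrow> real \<Rightarrow> 'm set" where
  "local_unstable A g f xs \<epsilon> =
     {y. \<exists>ys \<in> orbits_of f y. \<forall>k\<le>0. riemannian_dist A g (xs k) (ys k) < ennreal \<epsilon>}"

end

theory Submission
  imports Defs
begin

text \<open>
  If \<open>\<Lambda>\<close> attracts the neighbourhood \<open>U\<close>, choose \<open>\<epsilon>\<close> so small that every point at distance less than
  \<open>\<epsilon>\<close> from \<open>\<Lambda>\<close> lies in \<open>U\<close>. A backward orbit that stays \<open>\<epsilon>\<close>-close to \<open>\<Lambda>\<close> stays in \<open>U\<close>, so its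
  starting point lies in \<open>f\<^sup>n(U)\<close> for all \<open>n\<close>, that is, in \<open>\<Lambda>\<close>. This is
  \<open>attractor_contains_local_unstable\<close>.

  For the converse, suppose that the local unstable sets of size \<open>\<epsilon>\<close> lie in \<open>\<Lambda>\<close>. The claim is that a
  backward orbit contained in a small neighbourhood \<open>V\<close> of \<open>\<Lambda>\<close> starts in \<open>\<Lambda>\<close>
  (\<open>backward_orbit_near_basic_set\<close>). Given this, compactness shows that orbit segments of some
  fixed length in \<open>V\<close> end very close to \<open>\<Lambda>\<close>, and a neighbourhood \<open>U\<close> with \<open>f(U) \<subseteq> int U\<close> can be
  written down with an Urysohn function (\<open>attractor_if_backward_isolated\<close>).

  To prove the claim, a long piece of the backward orbit is closed up to a periodic pseudo-orbit by
  an orbit segment in \<open>\<Lambda>\<close>, which exists by transitivity. The pseudo-orbit is shadowed by a true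
  periodic orbit, which is nonwandering and close to \<open>\<Lambda>\<close>, hence in \<open>\<Lambda>\<close>. When the piece gets longer,
  the periodic orbits accumulate on a full orbit in \<open>\<Lambda>\<close> that shadows the whole past of the given
  orbit. So the given orbit lies in a local unstable set, which is contained in \<open>\<Lambda>\<close>.

  Periodic shadowing (\<open>periodic_shadowing\<close>) avoids stable manifolds, and also the choice of a
  past for the points of a pseudo-orbit, on which the unstable directions depend. It rests on one
  estimate, \<open>hyperbolic_expansivity_estimate\<close>: if two sequences follow the same pseudo-orbit near
  \<open>\<Lambda>\<close>, then their distance is bounded by a constant times the difference of their defects from being
  orbits. Otherwise the rescaled differences of two such sequences would converge to a nonzero
  bounded orbit of tangent vectors over a full orbit in \<open>\<Lambda>\<close>, which hyperbolicity excludes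
  (\<open>hyperbolic_bounded_tangent_orbit_zero\<close>). The estimate says that the equations of a periodic
  orbit, perturbed by a constant in each step, have at most one solution near the pseudo-orbit. By
  invariance of domain the perturbations for which there is a solution form an open set, by the
  estimate a closed one; the pseudo-orbit itself solves the equations perturbed by its jumps. Hence
  the unperturbed equations have a solution (\<open>cyclic_chain_solvable\<close>).
\<close>

section \<open>Strict differentiability\<close>

lemma Cr_on_differentiable:
  assumes "Cr_on r h S" "1 \<le> r" "p \<in> S"
  shows "h differentiable (at p)"
proof -
  have "Ck_on 1 h S" using assms unfolding Cr_on_def by (auto simp: one_enat_def)
  then show ?thesis using assms by (simp add: One_nat_def del: One_nat_def[symmetric])
qed

lemma Cr_on_continuous_derivative:
  assumes "Cr_on r h S" "1 \<le> r"
  shows "continuous_on S (\<lambda>p. frechet_derivative h (at p) v)"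
proof -
  have "Ck_on 1 h S" using assms unfolding Cr_on_def by (auto simp: one_enat_def)
  then show ?thesis by simp
qed

lemma Cr_on_continuous:
  assumes "Cr_on r h S"
  shows "continuous_on S h"
proof -
  have "Ck_on 0 h S" using assms unfolding Cr_on_def by (metis zero_enat_def zero_le)
  then show ?thesis by simp
qed

text \<open>
  A difference quotient of two nearby orbits is to be compared with the derivative at a third
  point, their common limit; differentiability at that point alone would not control it.
\<close>

lemma Cr_on_strictly_differentiable:
  fixes h :: "'a::euclidean_space \<Rightarrow> 'b::real_normed_vector"
  assumes h: "Cr_on r h S" "1 \<le> r" and S: "open S" "x \<in> S" and e: "e > 0"
  shows "\<exists>d>0. \<forall>p\<in>ball x d. \<forall>q\<in>ball x d.
    norm (h p - h q - frechet_derivative h (at x) (p - q)) \<le> e * norm (p - q)"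
proof -
  define D where "D p = frechet_derivative h (at p)" for p
  have der: "(h has_derivative D p) (at p)" if "p \<in> S" for p
    unfolding D_def using Cr_on_differentiable[OF h that] frechet_derivative_works by blast
  have lin: "linear (D p)" if "p \<in> S" for p
    using der[OF that] has_derivative_linear by blast
  define n where "n = real DIM('a)"
  have n: "n > 0" by (simp add: n_def)
  have cont: "isCont (\<lambda>p. D p b) x" for b
    using Cr_on_continuous_derivative[OF h, of b] S unfolding D_def
    by (simp add: continuous_on_eq_continuous_at)
  have "eventually (\<lambda>p. norm (D p b - D x b) < e / n) (nhds x)" for b
    using tendstoD[OF cont[of b, unfolded isCont_def], of "e / n"] e n
    by (simp add: eventually_nhds_conv_at dist_norm)
  then have "eventually (\<lambda>p. \<forall>b\<in>Basis. norm (D p b - D x b) < e / n) (nhds x)"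
    by (intro eventually_ball_finite) auto
  moreover have "eventually (\<lambda>p. p \<in> S) (nhds x)" using S by (simp add: eventually_nhds_in_open)
  ultimately have "eventually (\<lambda>p. (\<forall>b\<in>Basis. norm (D p b - D x b) < e / n) \<and> p \<in> S) (nhds x)"
    by eventually_elim auto
  then obtain d where d: "d > 0" and
    close: "\<And>p. dist p x < d \<Longrightarrow> (\<forall>b\<in>Basis. norm (D p b - D x b) < e / n) \<and> p \<in> S"
    unfolding eventually_nhds_metric by metis
  have bnd: "norm (D p v - D x v) \<le> e * norm v" if p: "p \<in> ball x d" for p v
  proof -
    have pS: "p \<in> S" and c: "\<And>b. b \<in> Basis \<Longrightarrow> norm (D p b - D x b) < e / n"
      using close[of p] p by (auto simp: dist_commute)
    interpret lp: linear "D p" using lin[OF pS] .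
    interpret lx: linear "D x" using lin[OF S(2)] .
    have "D p v - D x v = (\<Sum>b\<in>Basis. (v \<bullet> b) *\<^sub>R (D p b - D x b))"
      by (subst (1 2) euclidean_representation[of v, symmetric])
        (simp add: lp.sum lx.sum lp.scale lx.scale sum_subtractf scaleR_diff_right del: euclidean_representation)
    also have "norm \<dots> \<le> (\<Sum>b\<in>(Basis::'a set). norm v * (e / n))"
    proof (rule sum_norm_le)
      fix b :: 'a assume b: "b \<in> Basis"
      have "norm ((v \<bullet> b) *\<^sub>R (D p b - D x b)) = \<bar>v \<bullet> b\<bar> * norm (D p b - D x b)" by simp
      also have "\<dots> \<le> norm v * (e / n)"
        using Basis_le_norm[OF b, of v] c[OF b] by (intro mult_mono) auto
      finally show "norm ((v \<bullet> b) *\<^sub>R (D p b - D x b)) \<le> norm v * (e / n)" .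
    qed
    also have "\<dots> = e * norm v" using n by (simp add: n_def)
    finally show ?thesis .
  qed
  have "norm (h p - h q - D x (p - q)) \<le> e * norm (p - q)" if p: "p \<in> ball x d" and q: "q \<in> ball x d" for p q
  proof -
    interpret lx: linear "D x" using lin[OF S(2)] .
    have dx: "(D x has_derivative D x) (at y within T)" for y T
      by (simp add: linear_imp_has_derivative lin[OF S(2)])
    \<comment> \<open>The mean value inequality for \<open>h - D x\<close>, whose derivative is small near \<open>x\<close>.\<close>
    have "norm ((h p - D x p) - (h q - D x q)) \<le> e * norm (p - q)"
    proof (rule differentiable_bound[of "ball x d" "\<lambda>p. h p - D x p" "\<lambda>y v. D y v - D x v"])
      show "((\<lambda>p. h p - D x p) has_derivative (\<lambda>v. D y v - D x v)) (at y within ball x d)" if "y \<in> ball x d" for y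
      proof -
        have "y \<in> S" using close[of y] that by (auto simp: dist_commute)
        from der[OF this] show ?thesis
          by (intro has_derivative_diff dx) (rule has_derivative_at_withinI)
      qed
      show "onorm (\<lambda>v. D y v - D x v) \<le> e" if "y \<in> ball x d" for y
        by (rule onorm_le) (rule bnd[OF that])
    qed (use p q in auto)
    then show ?thesis by (simp add: lx.diff algebra_simps)
  qed
  then show ?thesis using d unfolding D_def by blast
qed

section \<open>Charts\<close>

definition cimg :: "('m, 'e) chart \<Rightarrow> 'e set" where
  "cimg c = coord c ` cdom c"

lemma is_chartD:
  assumes "is_chart c"
  shows "open (cdom c)" "open (cimg c)"
    "x \<in> cdom c \<Longrightarrow> coord c x \<in> cimg c" "p \<in> cimg c \<Longrightarrow> param c p \<in> cdom c"
    "x \<in> cdom c \<Longrightarrow> param c (coord c x) = x" "p \<in> cimg c \<Longrightarrow> coord c (param c p) = p"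
    "continuous_on (cdom c) (coord c)" "continuous_on (cimg c) (param c)"
  using assms unfolding is_chart_def cimg_def homeomorphism_def by auto

text \<open>
  Every derivative in charts is computed by this one chain rule: a map out of the manifold that is
  differentiable in the chart \<open>d\<close> may be composed with any map \<open>u\<close> into the manifold.
\<close>

lemma chart_chain_rule:
  assumes d: "is_chart d" and u: "(u \<longlongrightarrow> u t) (at t within S)" "t \<in> S" "u t \<in> cdom d"
    and U: "((coord d \<circ> u) has_derivative U) (at t within S)"
    and H: "((h \<circ> param d) has_derivative H) (at (coord d (u t)))"
  shows "((h \<circ> u) has_derivative (H \<circ> U)) (at t within S)"
proof -
  have "(((h \<circ> param d) \<circ> (coord d \<circ> u)) has_derivative (H \<circ> U)) (at t within S)"
    by (rule diff_chain_within[OF U]) (use H in \<open>auto intro: has_derivative_at_withinI\<close>)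
  moreover have "\<forall>\<^sub>F s in at t within S. ((h \<circ> param d) \<circ> (coord d \<circ> u)) s = (h \<circ> u) s"
    using topological_tendstoD[OF u(1) is_chartD(1)[OF d] u(3)]
    by eventually_elim (simp add: is_chartD(5)[OF d])
  ultimately show ?thesis
    by (rule has_derivative_transform_eventually) (use u is_chartD(5)[OF d] in auto)
qed

locale smooth_manifold =
  fixes A :: "('m::{t2_space,second_countable_topology}, 'e::euclidean_space) chart set"
  assumes closed_manifold: "smooth_closed_manifold A"
begin

lemma compact_M: "compact (UNIV :: 'm set)"
  using closed_manifold unfolding smooth_closed_manifold_def by auto

lemma chart: "c \<in> A \<Longrightarrow> is_chart c"
  using closed_manifold unfolding smooth_closed_manifold_def smooth_atlas_def by auto

lemmas open_cdom = is_chartD(1)[OF chart]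
  and open_cimg = is_chartD(2)[OF chart]
  and coord_in = is_chartD(3)[OF chart]
  and param_in = is_chartD(4)[OF chart]
  and param_coord = is_chartD(5)[OF chart]
  and coord_param = is_chartD(6)[OF chart]
  and continuous_coord = is_chartD(7)[OF chart]
  and continuous_param = is_chartD(8)[OF chart]

lemma ex_chart: "\<exists>c\<in>A. x \<in> cdom c"
  using closed_manifold unfolding smooth_closed_manifold_def smooth_atlas_def by auto

lemma chart_at: "chart_at A x \<in> A" "x \<in> cdom (chart_at A x)"
proof -
  have "\<exists>c. c \<in> A \<and> x \<in> cdom c" using ex_chart by blast
  from someI_ex[OF this] show "chart_at A x \<in> A" "x \<in> cdom (chart_at A x)"
    unfolding chart_at_def by auto
qed

lemma isCont_coord: "c \<in> A \<Longrightarrow> x \<in> cdom c \<Longrightarrow> isCont (coord c) x"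
  using continuous_coord open_cdom continuous_on_eq_continuous_at by blast

lemma isCont_param: "c \<in> A \<Longrightarrow> p \<in> cimg c \<Longrightarrow> isCont (param c) p"
  using continuous_param open_cimg continuous_on_eq_continuous_at by blast

lemma transition_Cr: "c \<in> A \<Longrightarrow> d \<in> A \<Longrightarrow> Cr_on \<infinity> (coord d \<circ> param c) (coord c ` (cdom c \<inter> cdom d))"
  using closed_manifold unfolding smooth_closed_manifold_def smooth_atlas_def by auto

lemma transition_has_derivative:
  assumes "c \<in> A" "d \<in> A" "x \<in> cdom c" "x \<in> cdom d"
  shows "((coord d \<circ> param c) has_derivative frechet_derivative (coord d \<circ> param c) (at (coord c x)))
    (at (coord c x))"
  using Cr_on_differentiable[OF transition_Cr[OF assms(1,2)], of "coord c x"] assms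
    frechet_derivative_works by auto

lemma tangent_vec_has_derivative:
  assumes "c \<in> A" "x \<in> cdom c"
  shows "((coord (chart_at A x) \<circ> param c) has_derivative tangent_vec A c x) (at (coord c x))"
  unfolding tangent_vec_def by (rule transition_has_derivative) (use assms chart_at in auto)

lemma linear_tangent_vec:
  assumes "c \<in> A" "x \<in> cdom c"
  shows "linear (tangent_vec A c x)"
  using tangent_vec_has_derivative[OF assms] has_derivative_linear by blast

lemma transition_derivative_inverse:
  assumes "c \<in> A" "d \<in> A" "x \<in> cdom c" "x \<in> cdom d"
    and H: "((coord d \<circ> param c) has_derivative H) (at (coord c x))"
    and G: "((coord c \<circ> param d) has_derivative G) (at (coord d x))"
  shows "G (H v) = v"
proof -
  have x: "param c (coord c x) = x" using assms param_coord by auto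
  have "((coord c \<circ> param c) has_derivative (G \<circ> H)) (at (coord c x) within UNIV)"
    by (rule chart_chain_rule[OF chart[OF assms(2)]])
      (use assms x isCont_param[OF assms(1) coord_in[OF assms(1,3)]] in \<open>auto simp: isCont_def\<close>)
  moreover have "((coord c \<circ> param c) has_derivative id) (at (coord c x))"
    by (rule has_derivative_transform_within_open[OF has_derivative_id open_cimg[OF assms(1)]])
      (use assms coord_in coord_param in auto)
  ultimately have "G \<circ> H = id" by (auto dest: has_derivative_unique)
  then show ?thesis by (metis comp_apply id_apply)
qed

text \<open>
  The two coordinate changes are inverse to each other, hence so are their derivatives.
\<close>

lemma tangent_vec_eq_0:
  assumes "c \<in> A" "x \<in> cdom c" "tangent_vec A c x v = 0"
  shows "v = 0"
proof -
  let ?G = "frechet_derivative (coord c \<circ> param (chart_at A x)) (at (coord (chart_at A x) x))"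
  have G: "((coord c \<circ> param (chart_at A x)) has_derivative ?G) (at (coord (chart_at A x) x))"
    by (rule transition_has_derivative) (use assms chart_at in auto)
  have "?G (tangent_vec A c x v) = v"
    by (rule transition_derivative_inverse[OF assms(1) chart_at(1) assms(2) chart_at(2)
          tangent_vec_has_derivative[OF assms(1,2)] G])
  moreover have "?G 0 = 0" using G has_derivative_linear linear_0 by blast
  ultimately show ?thesis using assms(3) by auto
qed

end

locale C1_self_map = smooth_manifold A
  for A :: "('m::{t2_space,second_countable_topology}, 'e::euclidean_space) chart set" +
  fixes f :: "'m \<Rightarrow> 'm" and r :: enat
  assumes Cr: "Cr_map A r f" and r: "1 \<le> r"
begin

lemma continuous_f: "continuous_on UNIV f"
  using Cr unfolding Cr_map_def by auto

lemma isCont_f: "isCont f x"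
  using continuous_f continuous_on_eq_continuous_at open_UNIV by blast

lemma continuous_iterate: "continuous_on UNIV (f ^^ k)"
  by (induction k) (auto intro: continuous_on_compose2[OF continuous_f])

lemma open_local_domain:
  assumes "c \<in> A" "d \<in> A"
  shows "open (coord c ` (cdom c \<inter> f -` cdom d))"
proof -
  have "coord c ` (cdom c \<inter> f -` cdom d) = cimg c \<inter> (f \<circ> param c) -` cdom d"
  proof (intro set_eqI iffI)
    fix p assume "p \<in> coord c ` (cdom c \<inter> f -` cdom d)"
    then show "p \<in> cimg c \<inter> (f \<circ> param c) -` cdom d"
      using coord_in[OF assms(1)] param_coord[OF assms(1)] by auto
  next
    fix p assume "p \<in> cimg c \<inter> (f \<circ> param c) -` cdom d"
    then have "p = coord c (param c p)" "param c p \<in> cdom c \<inter> f -` cdom d"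
      using coord_param[OF assms(1)] param_in[OF assms(1)] by auto
    then show "p \<in> coord c ` (cdom c \<inter> f -` cdom d)" by (rule image_eqI)
  qed
  moreover have "open \<dots>"
    by (intro continuous_open_preimage continuous_on_compose continuous_param open_cimg open_cdom
        assms continuous_on_subset[OF continuous_f]) auto
  ultimately show ?thesis by simp
qed

lemma local_rep_Cr:
  assumes "c \<in> A" "d \<in> A"
  shows "Cr_on r (coord d \<circ> f \<circ> param c) (coord c ` (cdom c \<inter> f -` cdom d))"
  using Cr assms unfolding Cr_map_def by auto

lemma local_rep_has_derivative:
  assumes "c \<in> A" "d \<in> A" "x \<in> cdom c" "f x \<in> cdom d"
  shows "((coord d \<circ> f \<circ> param c) has_derivative
    frechet_derivative (coord d \<circ> f \<circ> param c) (at (coord c x))) (at (coord c x))"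
  using Cr_on_differentiable[OF local_rep_Cr[OF assms(1,2)] r, of "coord c x"] assms
    frechet_derivative_works by auto

lemma tangent_map_has_derivative:
  "((coord (chart_at A (f x)) \<circ> f \<circ> param (chart_at A x)) has_derivative tangent_map A f x)
    (at (coord (chart_at A x) x))"
  unfolding tangent_map_def by (rule local_rep_has_derivative) (use chart_at in auto)

text \<open>
  Tangent vectors live in the charts \<open>chart_at A x\<close>, which may jump with \<open>x\<close>. Limits are therefore
  taken in fixed charts, and this identity carries the result back.
\<close>

lemma tangent_map_in_charts:
  assumes "c \<in> A" "d \<in> A" "x \<in> cdom c" "f x \<in> cdom d"
  shows "tangent_map A f x (tangent_vec A c x v) =
    tangent_vec A d (f x) (frechet_derivative (coord d \<circ> f \<circ> param c) (at (coord c x)) v)"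
proof -
  have x: "param c (coord c x) = x" using assms param_coord by auto
  have cp: "(param c \<longlongrightarrow> param c (coord c x)) (at (coord c x))"
    using isCont_param[OF assms(1) coord_in[OF assms(1,3)]] by (auto simp: isCont_def)
  have cfp: "((f \<circ> param c) \<longlongrightarrow> (f \<circ> param c) (coord c x)) (at (coord c x))"
    using cp x isCont_f[of x] isCont_tendsto_compose[of x f] by (auto simp: comp_def)
  have "(((coord (chart_at A (f x)) \<circ> f) \<circ> param c) has_derivative (tangent_map A f x \<circ> tangent_vec A c x))
      (at (coord c x))"
    by (rule chart_chain_rule[OF chart[OF chart_at(1)[of x]]])
      (use x cp chart_at tangent_map_has_derivative[of x] tangent_vec_has_derivative[OF assms(1,3)]
       in \<open>auto simp: comp_assoc\<close>)
  moreover have "((coord (chart_at A (f x)) \<circ> (f \<circ> param c)) has_derivative (tangent_vec A d (f x) \<circ>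
     frechet_derivative (coord d \<circ> f \<circ> param c) (at (coord c x)))) (at (coord c x))"
    by (rule chart_chain_rule[OF chart[OF assms(2)]])
      (use x cfp assms local_rep_has_derivative[OF assms] tangent_vec_has_derivative[OF assms(2,4)]
        in \<open>auto simp: comp_assoc\<close>)
  ultimately have "tangent_map A f x \<circ> tangent_vec A c x = tangent_vec A d (f x) \<circ>
     frechet_derivative (coord d \<circ> f \<circ> param c) (at (coord c x))"
    by (auto dest: has_derivative_unique simp: comp_assoc)
  then show ?thesis by (metis comp_apply)
qed

lemma tangent_map_iterate_has_derivative:
  "((coord (chart_at A ((f ^^ k) x)) \<circ> (f ^^ k) \<circ> param (chart_at A x)) has_derivative tangent_map A (f ^^ k) x)
    (at (coord (chart_at A x) x))"
  "tangent_map A (f ^^ Suc k) x = tangent_map A f ((f ^^ k) x) \<circ> tangent_map A (f ^^ k) x"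
proof -
  have step: "((coord (chart_at A ((f ^^ Suc k) x)) \<circ> (f ^^ Suc k) \<circ> param (chart_at A x)) has_derivative
      (tangent_map A f ((f ^^ k) x) \<circ> tangent_map A (f ^^ k) x)) (at (coord (chart_at A x) x))"
    if H: "((coord (chart_at A ((f ^^ k) x)) \<circ> (f ^^ k) \<circ> param (chart_at A x)) has_derivative
      tangent_map A (f ^^ k) x) (at (coord (chart_at A x) x))" for k
  proof -
    let ?c = "chart_at A x"
    have x: "param ?c (coord ?c x) = x" using chart_at param_coord by auto
    have "isCont (f ^^ k) x" using continuous_iterate continuous_on_eq_continuous_at open_UNIV by blast
    moreover have "(param ?c \<longlongrightarrow> param ?c (coord ?c x)) (at (coord ?c x))"
      using isCont_param[OF chart_at(1) coord_in[OF chart_at]] by (auto simp: isCont_def)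
    ultimately have cfp: "(((f ^^ k) \<circ> param ?c) \<longlongrightarrow> ((f ^^ k) \<circ> param ?c) (coord ?c x)) (at (coord ?c x))"
      using x isCont_tendsto_compose[of x "f ^^ k"] by (auto simp: comp_def)
    have "(((coord (chart_at A ((f ^^ Suc k) x)) \<circ> f) \<circ> ((f ^^ k) \<circ> param ?c)) has_derivative
      (tangent_map A f ((f ^^ k) x) \<circ> tangent_map A (f ^^ k) x)) (at (coord ?c x))"
      by (rule chart_chain_rule[OF chart[OF chart_at(1)[of "(f ^^ k) x"]]])
        (use cfp x chart_at H tangent_map_has_derivative[of "(f ^^ k) x"] in \<open>auto simp: comp_assoc\<close>)
    then show ?thesis by (simp add: comp_assoc)
  qed
  have all: "((coord (chart_at A ((f ^^ k) x)) \<circ> (f ^^ k) \<circ> param (chart_at A x)) has_derivative tangent_map A (f ^^ k) x)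
    (at (coord (chart_at A x) x))" for k
  proof (induction k)
    case 0
    have "((coord (chart_at A x) \<circ> param (chart_at A x)) has_derivative
        frechet_derivative (coord (chart_at A x) \<circ> param (chart_at A x)) (at (coord (chart_at A x) x)))
        (at (coord (chart_at A x) x))"
      by (rule transition_has_derivative) (use chart_at in auto)
    then show ?case by (simp add: tangent_map_def comp_def)
  next
    case (Suc k)
    have "frechet_derivative (coord (chart_at A ((f ^^ Suc k) x)) \<circ> (f ^^ Suc k) \<circ> param (chart_at A x))
        (at (coord (chart_at A x) x)) = tangent_map A f ((f ^^ k) x) \<circ> tangent_map A (f ^^ k) x"
      using frechet_derivative_at[OF step[OF Suc]] by simp
    then show ?case using step[OF Suc] unfolding tangent_map_def by metis
  qed
  show "((coord (chart_at A ((f ^^ k) x)) \<circ> (f ^^ k) \<circ> param (chart_at A x)) has_derivative tangent_map A (f ^^ k) x)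
    (at (coord (chart_at A x) x))" by (rule all)
  show "tangent_map A (f ^^ Suc k) x = tangent_map A f ((f ^^ k) x) \<circ> tangent_map A (f ^^ k) x"
    using frechet_derivative_at[OF step[OF all[of k]]] unfolding tangent_map_def by simp
qed

end

section \<open>The Riemannian metric and its distance\<close>

text \<open>
  The Henstock-Kurzweil integral comes from the fundamental theorem of calculus, the nonnegative
  integral from the definition of length. If the latter is finite, then \<open>h\<close> is Lebesgue integrable and
  both theories give the same integral.
\<close>

lemma norm_integral_le_nn_integral:
  fixes h :: "real \<Rightarrow> 'b::euclidean_space"
  assumes h: "h \<in> borel_measurable borel" and int: "(h has_integral I) UNIV"
  shows "ennreal (norm I) \<le> (\<integral>\<^sup>+ t. ennreal (norm (h t)) \<partial>lborel)"
proof (cases "(\<integral>\<^sup>+ t. ennreal (norm (h t)) \<partial>lborel) < \<infinity>")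
  case True
  then have h_int: "integrable lborel h" using h by (simp add: integrable_iff_bounded)
  have "I = integral\<^sup>L lborel h"
    using has_integral_integral_lborel[OF h_int] int has_integral_unique by blast
  then have "norm I \<le> integral\<^sup>L lborel (\<lambda>t. norm (h t))" by simp
  also have "ennreal (integral\<^sup>L lborel (\<lambda>t. norm (h t))) = (\<integral>\<^sup>+ t. ennreal (norm (h t)) \<partial>lborel)"
    using h_int by (simp add: nn_integral_eq_integral)
  finally show ?thesis by (simp add: ennreal_leI)
next
  case False
  then show ?thesis by (simp add: not_less top_unique)
qed

locale riemannian_manifold = smooth_manifold A
  for A :: "('m::{t2_space,second_countable_topology}, 'e::euclidean_space) chart set" +
  fixes g :: "'m \<Rightarrow> 'e \<Rightarrow> 'e \<Rightarrow> real"
  assumes metric: "riemannian_metric A g"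
begin

lemma bilinear_g: "bilinear (g x)" and g_sym: "g x u v = g x v u"
  and g_pos: "u \<noteq> 0 \<Longrightarrow> 0 < g x u u"
  using metric unfolding riemannian_metric_def by auto

lemma g_nonneg: "0 \<le> g x u u"
proof (cases "u = 0")
  case True
  then show ?thesis using bilinear_lzero[OF bilinear_g[of x], of u] by simp
next
  case False
  then show ?thesis using g_pos[of u x] by simp
qed

lemma tnorm_nonneg: "0 \<le> tnorm g x u"
  by (simp add: tnorm_def g_nonneg)

lemma tnorm_pos: "u \<noteq> 0 \<Longrightarrow> 0 < tnorm g x u"
  by (simp add: tnorm_def g_pos)

lemma tnorm_scale: "tnorm g x (c *\<^sub>R u) = \<bar>c\<bar> * tnorm g x u"
proof -
  have "g x (c *\<^sub>R u) (c *\<^sub>R u) = c\<^sup>2 * g x u u"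
    by (simp add: bilinear_lmul[OF bilinear_g] bilinear_rmul[OF bilinear_g] power2_eq_square)
  then show ?thesis by (simp add: tnorm_def real_sqrt_mult)
qed

lemma g_Cauchy_Schwarz: "g x u v \<le> tnorm g x u * tnorm g x v"
proof (cases "u = 0 \<or> v = 0")
  case True
  then show ?thesis
    using bilinear_lzero[OF bilinear_g[of x]] bilinear_rzero[OF bilinear_g[of x]] by (auto simp: tnorm_def)
next
  case False
  let ?a = "tnorm g x u" and ?b = "tnorm g x v"
  have ab: "?a > 0" "?b > 0" using False tnorm_pos by auto
  have sq: "g x u u = ?a\<^sup>2" "g x v v = ?b\<^sup>2" by (auto simp: tnorm_def g_nonneg)
  let ?w = "?b *\<^sub>R u - ?a *\<^sub>R v"
  have "0 \<le> g x ?w ?w" by (rule g_nonneg)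
  also have "g x ?w ?w = ?b\<^sup>2 * g x u u + ?a\<^sup>2 * g x v v - 2 * ?a * ?b * g x u v"
    by (simp add: bilinear_lsub[OF bilinear_g] bilinear_rsub[OF bilinear_g] bilinear_lmul[OF bilinear_g]
        bilinear_rmul[OF bilinear_g] power2_eq_square g_sym[of x v u] algebra_simps)
  also have "\<dots> = 2 * (?a * ?b) * (?a * ?b - g x u v)"
    unfolding sq by (simp add: power2_eq_square algebra_simps)
  finally have "0 \<le> 2 * (?a * ?b) * (?a * ?b - g x u v)" .
  moreover have "2 * (?a * ?b) > 0" using ab by simp
  ultimately show ?thesis by (simp add: zero_le_mult_iff)
qed

lemma tnorm_triangle: "tnorm g x (u + v) \<le> tnorm g x u + tnorm g x v"
proof -
  have sq: "g x w w = (tnorm g x w)\<^sup>2" for w by (auto simp: tnorm_def g_nonneg)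
  have "(tnorm g x (u + v))\<^sup>2 = g x u u + g x v v + 2 * g x u v"
    by (simp add: sq[symmetric] bilinear_ladd[OF bilinear_g] bilinear_radd[OF bilinear_g] g_sym[of x v u])
  also have "\<dots> \<le> (tnorm g x u + tnorm g x v)\<^sup>2"
    using g_Cauchy_Schwarz[of x u v] by (simp add: sq power2_sum)
  finally show ?thesis by (rule power2_le_imp_le) (simp add: tnorm_nonneg)
qed

text \<open>
  The norm in the chart is a continuous positive function on \<open>K\<close> times the unit sphere, hence
  bounded above and away from \<open>0\<close> there.
\<close>

lemma tnorm_in_chart_bounds:
  assumes c: "c \<in> A" and K: "compact K" "K \<subseteq> cimg c"
  shows "\<exists>m>0. \<exists>M>0. \<forall>p\<in>K. \<forall>u.
    m * norm u \<le> tnorm g (param c p) (tangent_vec A c (param c p) u) \<and>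
    tnorm g (param c p) (tangent_vec A c (param c p) u) \<le> M * norm u"
proof (cases "K = {}")
  case True
  then show ?thesis by (auto intro: exI[of _ 1])
next
  case False
  define G where "G p u v = g (param c p) (tangent_vec A c (param c p) u) (tangent_vec A c (param c p) v)" for p u v
  have lin: "linear (tangent_vec A c (param c p))" if "p \<in> K" for p
    using linear_tangent_vec[OF c param_in[OF c]] that K by auto
  have cG: "continuous_on K (\<lambda>p. G p u v)" for u v
    using metric c Cr_on_continuous K(2) continuous_on_subset
    unfolding riemannian_metric_def G_def cimg_def by blast
  have expand: "G p u u = (\<Sum>a\<in>Basis. \<Sum>b\<in>Basis. (u \<bullet> a) * (u \<bullet> b) * G p a b)" if "p \<in> K" for p u
  proof -
    interpret T: linear "tangent_vec A c (param c p)" using lin[OF that] .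
    have "tangent_vec A c (param c p) u = (\<Sum>a\<in>Basis. (u \<bullet> a) *\<^sub>R tangent_vec A c (param c p) a)"
      by (subst (1) euclidean_representation[of u, symmetric]) (simp only: T.sum T.scale)
    then have "G p u u = g (param c p) (\<Sum>a\<in>Basis. (u \<bullet> a) *\<^sub>R tangent_vec A c (param c p) a)
       (\<Sum>a\<in>Basis. (u \<bullet> a) *\<^sub>R tangent_vec A c (param c p) a)" unfolding G_def by simp
    also have "\<dots> = (\<Sum>(a,b)\<in>Basis \<times> Basis. g (param c p) ((u \<bullet> a) *\<^sub>R tangent_vec A c (param c p) a)
      ((u \<bullet> b) *\<^sub>R tangent_vec A c (param c p) b))"
      by (rule bilinear_sum[OF bilinear_g])
    finally show ?thesis
      by (simp add: G_def bilinear_lmul[OF bilinear_g] bilinear_rmul[OF bilinear_g]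
          sum.cartesian_product mult.assoc mult.left_commute)
  qed
  let ?X = "K \<times> sphere (0::'e) 1"
  have cGX: "continuous_on ?X (\<lambda>x. G (fst x) (snd x) (snd x))"
  proof -
    have "continuous_on ?X (\<lambda>x. \<Sum>a\<in>Basis. \<Sum>b\<in>Basis. (snd x \<bullet> a) * (snd x \<bullet> b) * G (fst x) a b)"
      by (intro continuous_intros continuous_on_compose2[OF cG]) auto
    then show ?thesis
      by (rule continuous_on_eq) (auto simp: expand)
  qed
  have cX: "compact ?X" using K by (intro compact_Times) auto
  obtain b :: 'e where b: "b \<in> Basis" by fastforce
  have "?X \<noteq> {}" using False b by (auto simp: dist_norm)
  obtain xm where xm: "xm \<in> ?X" "\<And>x. x \<in> ?X \<Longrightarrow> G (fst xm) (snd xm) (snd xm) \<le> G (fst x) (snd x) (snd x)"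
    using continuous_attains_inf[OF cX \<open>?X \<noteq> {}\<close> cGX] by blast
  obtain xM where xM: "xM \<in> ?X" "\<And>x. x \<in> ?X \<Longrightarrow> G (fst x) (snd x) (snd x) \<le> G (fst xM) (snd xM) (snd xM)"
    using continuous_attains_sup[OF cX \<open>?X \<noteq> {}\<close> cGX] by blast
  have pos: "G (fst x) (snd x) (snd x) > 0" if "x \<in> ?X" for x
  proof -
    have "fst x \<in> cimg c" "snd x \<noteq> 0" using that K by (auto simp: mem_Times_iff)
    then have "tangent_vec A c (param c (fst x)) (snd x) \<noteq> 0"
      using tangent_vec_eq_0[OF c param_in[OF c]] by blast
    then show ?thesis unfolding G_def by (rule g_pos)
  qed
  define m where "m = sqrt (G (fst xm) (snd xm) (snd xm))"
  define M where "M = sqrt (G (fst xM) (snd xM) (snd xM))"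
  have "m * norm u \<le> tnorm g (param c p) (tangent_vec A c (param c p) u) \<and>
    tnorm g (param c p) (tangent_vec A c (param c p) u) \<le> M * norm u" if p: "p \<in> K" for p u
  proof (cases "u = 0")
    case True
    then show ?thesis using linear_0[OF lin[OF p]] bilinear_lzero[OF bilinear_g] by (simp add: tnorm_def)
  next
    case False
    let ?u = "(1 / norm u) *\<^sub>R u"
    have x: "(p, ?u) \<in> ?X" using False p by auto
    have "tnorm g (param c p) (tangent_vec A c (param c p) u) =
        norm u * tnorm g (param c p) (tangent_vec A c (param c p) ?u)"
      using False by (simp add: linear_cmul[OF lin[OF p]] tnorm_scale)
    also have "tnorm g (param c p) (tangent_vec A c (param c p) ?u) = sqrt (G p ?u ?u)"
      by (simp add: tnorm_def G_def)
    finally have eq: "tnorm g (param c p) (tangent_vec A c (param c p) u) = norm u * sqrt (G p ?u ?u)" .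
    have "m \<le> sqrt (G p ?u ?u)" "sqrt (G p ?u ?u) \<le> M"
      using xm(2)[OF x] xM(2)[OF x] by (auto simp: m_def M_def)
    then have "m * norm u \<le> sqrt (G p ?u ?u) * norm u" "sqrt (G p ?u ?u) * norm u \<le> M * norm u"
      by (auto intro: mult_right_mono)
    then show ?thesis unfolding eq by (simp add: mult.commute)
  qed
  moreover have "m > 0" "M > 0" using pos[OF xm(1)] pos[OF xM(1)] by (auto simp: m_def M_def)
  ultimately show ?thesis by blast
qed

lemma velocity_in_chart:
  assumes c: "c \<in> A" "\<gamma> t \<in> cdom c" and cont: "isCont \<gamma> t"
    and D: "((coord c \<circ> \<gamma>) has_vector_derivative D) (at t)"
  shows "velocity A \<gamma> t = tangent_vec A c (\<gamma> t) D"
proof -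
  have "((coord (chart_at A (\<gamma> t)) \<circ> \<gamma>) has_derivative (tangent_vec A c (\<gamma> t) \<circ> (\<lambda>x. x *\<^sub>R D))) (at t)"
    by (rule chart_chain_rule[OF chart[OF c(1)]])
      (use c cont D tangent_vec_has_derivative[OF c] in \<open>auto simp: isCont_def has_vector_derivative_def\<close>)
  moreover have "tangent_vec A c (\<gamma> t) \<circ> (\<lambda>x. x *\<^sub>R D) = (\<lambda>x. x *\<^sub>R tangent_vec A c (\<gamma> t) D)"
    using linear_cmul[OF linear_tangent_vec[OF c]] by auto
  ultimately show ?thesis
    unfolding velocity_def by (simp add: has_vector_derivative_def vector_derivative_at)
qed

text \<open>
  The straight segment in the chart is a competitor in the infimum, and its speed is bounded
  by \<open>M\<close> times its Euclidean speed.
\<close>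

lemma riemannian_dist_le_chart:
  assumes c: "c \<in> A" and seg: "closed_segment p q \<subseteq> K" "K \<subseteq> cimg c"
    and M: "\<And>z u. z \<in> K \<Longrightarrow> tnorm g (param c z) (tangent_vec A c (param c z) u) \<le> M * norm u"
  shows "riemannian_dist A g (param c p) (param c q) \<le> ennreal (M * norm (q - p))"
proof -
  define \<sigma> where "\<sigma> t = p + t *\<^sub>R (q - p)" for t :: real
  define \<gamma> where "\<gamma> t = param c (\<sigma> t)" for t :: real
  have sK: "\<sigma> t \<in> K" if "t \<in> {0..1}" for t
  proof -
    have "\<sigma> t = (1 - t) *\<^sub>R p + t *\<^sub>R q" by (simp add: \<sigma>_def algebra_simps)
    then have "\<sigma> t \<in> closed_segment p q" using that by (auto simp: closed_segment_def)
    then show ?thesis using seg by blast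
  qed
  have s_img: "\<sigma> t \<in> cimg c" if "t \<in> {0..1}" for t using sK[OF that] seg by blast
  have cs: "isCont \<sigma> t" for t unfolding \<sigma>_def by (intro continuous_intros)
  have s_der: "(\<sigma> has_vector_derivative (q - p)) F" for F
    unfolding \<sigma>_def has_vector_derivative_def by (auto intro!: derivative_eq_intros)
  have cg: "isCont \<gamma> t" if "t \<in> {0..1}" for t
    unfolding \<gamma>_def using isCont_o2[OF cs isCont_param[OF c s_img[OF that]]] .
  have cg_in: "\<gamma> t \<in> cdom c" if "t \<in> {0..1}" for t
    using s_img[OF that] param_in[OF c] by (simp add: \<gamma>_def)
  have coord_\<gamma>: "coord c (\<gamma> t) = \<sigma> t" if "t \<in> {0..1}" for t
    using s_img[OF that] coord_param[OF c] by (simp add: \<gamma>_def)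
  have der: "((coord c \<circ> \<gamma>) has_vector_derivative (q - p)) (at t)" if t: "t \<in> {0..1}" for t
  proof -
    have "open (\<sigma> -` cimg c)"
      using cs open_cimg[OF c] by (meson continuous_at_imp_continuous_on continuous_open_vimage)
    then show ?thesis
      by (rule has_vector_derivative_transform_within_open[OF s_der])
        (use s_img[OF t] coord_param[OF c] in \<open>auto simp: \<gamma>_def\<close>)
  qed
  have len: "curve_length A g \<gamma> \<le> ennreal (M * norm (q - p))"
  proof -
    have "curve_length A g \<gamma> \<le> (\<integral>\<^sup>+ t \<in> {0..1::real}. ennreal (M * norm (q - p)) \<partial>lborel)"
      unfolding curve_length_def
    proof (rule nn_integral_mono)
      fix t :: real
      show "ennreal (tnorm g (\<gamma> t) (velocity A \<gamma> t)) * indicator {0..1} t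
        \<le> ennreal (M * norm (q - p)) * indicator {0..1} t"
      proof (cases "t \<in> {0..1}")
        case True
        have "velocity A \<gamma> t = tangent_vec A c (\<gamma> t) (q - p)"
          by (rule velocity_in_chart[OF c cg_in[OF True] cg[OF True] der[OF True]])
        then show ?thesis using M[OF sK[OF True], of "q - p"] True by (simp add: \<gamma>_def ennreal_leI)
      qed simp
    qed
    also have "\<dots> = ennreal (M * norm (q - p))" by (simp add: nn_integral_cmult)
    finally show ?thesis .
  qed
  \<comment> \<open>The definition asks for the derivative in every chart \<open>d\<close> that the segment meets, not only in \<open>c\<close>.\<close>
  have "C1_curve_on A 0 1 \<gamma>"
    unfolding C1_curve_on_def
  proof
    fix d assume d: "d \<in> A"
    define D where "D t = frechet_derivative (coord d \<circ> param c) (at (\<sigma> t)) (q - p)" for t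
    let ?T = "{0..1} \<inter> \<gamma> -` cdom d"
    have sT: "\<sigma> t \<in> coord c ` (cdom c \<inter> cdom d)" if "t \<in> ?T" for t
      by (rule image_eqI[of _ _ "\<gamma> t"]) (use that coord_\<gamma>[of t] cg_in[of t] in auto)
    have "continuous_on ?T D"
      unfolding D_def
      by (rule continuous_on_compose2[OF Cr_on_continuous_derivative[OF transition_Cr[OF c d]]])
        (use sT cs in \<open>auto intro: continuous_at_imp_continuous_on\<close>)
    moreover have "((coord d \<circ> \<gamma>) has_vector_derivative D t) (at t within {0..1})" if t: "t \<in> ?T" for t
    proof -
      let ?F = "frechet_derivative (coord d \<circ> param c) (at (\<sigma> t))"
      have t01: "t \<in> {0..1}" using t by auto
      have F: "((coord d \<circ> param c) has_derivative ?F) (at (coord c (\<gamma> t)))"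
        using transition_has_derivative[OF c d cg_in[OF t01]] t coord_\<gamma>[OF t01] by auto
      have "((coord d \<circ> \<gamma>) has_derivative (?F \<circ> (\<lambda>x. x *\<^sub>R (q - p)))) (at t within {0..1})"
        by (rule chart_chain_rule[OF chart[OF c]])
          (use t01 cg_in[OF t01] cg[OF t01] der[OF t01] F in
            \<open>auto simp: has_vector_derivative_def isCont_def intro: has_derivative_at_withinI tendsto_within_subset\<close>)
      moreover have "?F \<circ> (\<lambda>x. x *\<^sub>R (q - p)) = (\<lambda>x. x *\<^sub>R D t)"
        using linear_cmul[OF has_derivative_linear[OF F]] by (auto simp: D_def)
      ultimately show ?thesis by (simp add: has_vector_derivative_def)
    qed
    ultimately show "\<exists>D. continuous_on ?T D \<and>
        (\<forall>t\<in>?T. ((coord d \<circ> \<gamma>) has_vector_derivative D t) (at t within {0..1}))" by blast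
  qed
  moreover have "continuous_on {0..1} \<gamma>" using cg by (simp add: continuous_at_imp_continuous_on)
  ultimately have "piecewise_C1_curve A \<gamma>"
    unfolding piecewise_C1_curve_def by (intro conjI exI[of _ "{0,1}"]) auto
  moreover have "\<gamma> 0 = param c p" "\<gamma> 1 = param c q" by (auto simp: \<gamma>_def \<sigma>_def)
  ultimately have "riemannian_dist A g (param c p) (param c q) \<le> curve_length A g \<gamma>"
    unfolding riemannian_dist_def by (intro INF_lower) auto
  then show ?thesis using len by simp
qed

text \<open>
  The interval around \<open>t\<close> runs between the two neighbouring break points. In this form the break points
  are only an exceptional finite set, as in the fundamental theorem of calculus.
\<close>

lemma piecewise_C1_local:
  assumes "piecewise_C1_curve A \<gamma>"
  shows "\<exists>S. finite S \<and> (\<forall>t\<in>{0<..<1} - S. \<exists>a b. a < t \<and> t < b \<and> {a<..<b} \<subseteq> {0<..<1} \<and> C1_curve_on A a b \<gamma>)"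
proof -
  obtain S where S: "finite S" "{0, 1} \<subseteq> S" "S \<subseteq> {0..1}"
    and C1: "\<forall>a\<in>S. \<forall>b\<in>S. a < b \<and> {a<..<b} \<inter> S = {} \<longrightarrow> C1_curve_on A a b \<gamma>"
    using assms unfolding piecewise_C1_curve_def by (elim conjE exE) (rule that)
  have "\<exists>a b. a < t \<and> t < b \<and> {a<..<b} \<subseteq> {0<..<1} \<and> C1_curve_on A a b \<gamma>" if t: "t \<in> {0<..<1} - S" for t
  proof -
    let ?L = "{s\<in>S. s < t}" and ?R = "{s\<in>S. t < s}"
    have L: "finite ?L" "?L \<noteq> {}" and R: "finite ?R" "?R \<noteq> {}" using S t by auto
    have a: "Max ?L \<in> ?L" and b: "Min ?R \<in> ?R" using Max_in[OF L] Min_in[OF R] by auto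
    have "{Max ?L<..<Min ?R} \<inter> S = {}"
    proof -
      have False if s: "s \<in> S" "Max ?L < s" "s < Min ?R" for s
      proof -
        consider "s < t" | "s = t" | "t < s" by linarith
        then show False
        proof cases
          case 1
          then have "s \<in> ?L" using s by auto
          then show False using Max_ge[OF L(1)] s by fastforce
        next
          case 3
          then have "s \<in> ?R" using s by auto
          then show False using Min_le[OF R(1)] s by fastforce
        qed (use s t in auto)
      qed
      then show ?thesis by auto
    qed
    then have "C1_curve_on A (Max ?L) (Min ?R) \<gamma>" using C1 a b by auto
    moreover have "{Max ?L<..<Min ?R} \<subseteq> {0<..<1}" using a b S(3) by force
    ultimately show ?thesis using a b by blast
  qed
  then show ?thesis using S(1) by blast
qed

text \<open>
  A curve that leaves the coordinate ball has to travel from \<open>p\<close> to the boundary sphere before its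
  first exit time \<open>\<tau>\<close>. Up to then the metric dominates \<open>m\<close> times the Euclidean one.
\<close>

lemma curve_length_ge_exit:
  assumes c: "c \<in> A" and R: "0 < R" "cball a R \<subseteq> cimg c" and m: "0 < m"
    "\<And>z u. z \<in> cball a R \<Longrightarrow> m * norm u \<le> tnorm g (param c z) (tangent_vec A c (param c z) u)"
    and \<gamma>: "piecewise_C1_curve A \<gamma>" and start: "\<gamma> 0 = param c p" "p \<in> ball a R"
    and exit: "\<gamma> 1 \<notin> param c ` ball a R"
  shows "ennreal (m * (R - norm (p - a))) \<le> curve_length A g \<gamma>"
proof -
  let ?B = "param c ` ball a R"
  have cont: "continuous_on {0..1} \<gamma>" using \<gamma> unfolding piecewise_C1_curve_def by auto
  have ball_img: "z \<in> cimg c" if "z \<in> ball a R" for z using that R(2) by (auto intro: less_imp_le)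
  have B_eq: "?B = cdom c \<inter> coord c -` ball a R"
  proof (intro set_eqI iffI)
    fix x assume "x \<in> ?B"
    then show "x \<in> cdom c \<inter> coord c -` ball a R"
      using ball_img coord_param[OF c] param_in[OF c] by auto
  next
    fix x assume "x \<in> cdom c \<inter> coord c -` ball a R"
    then show "x \<in> ?B" using param_coord[OF c, of x] by (metis IntE image_eqI vimageE)
  qed
  have openB: "open ?B"
    unfolding B_eq by (intro continuous_open_preimage continuous_coord c open_cdom open_ball)
  define E where "E = {0..1} \<inter> \<gamma> -` (- ?B)"
  have "closed E"
    unfolding E_def by (intro continuous_closed_preimage cont) (use openB in auto)
  moreover have "1 \<in> E" using exit by (auto simp: E_def)
  moreover have bddE: "bdd_below E" by (auto simp: E_def bdd_below_def)
  ultimately have Inf_E: "Inf E \<in> E" using closed_contains_Inf[of E] by blast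
  define \<tau> where "\<tau> = Inf E"
  have \<tau>E: "\<tau> \<in> {0..1}" "\<gamma> \<tau> \<notin> ?B" using Inf_E unfolding \<tau>_def E_def by auto
  have before: "\<gamma> t \<in> ?B" if "0 \<le> t" "t < \<tau>" for t
  proof (rule ccontr)
    assume "\<gamma> t \<notin> ?B"
    then have "t \<in> E" using that \<tau>E by (auto simp: E_def)
    then show False using cInf_lower[OF _ bddE] that unfolding \<tau>_def by fastforce
  qed
  have "\<tau> \<noteq> 0" using \<tau>E(2) start by auto
  then have \<tau>0: "0 < \<tau>" using \<tau>E by auto
  have closedC: "closed (param c ` cball a R)"
    by (intro compact_imp_closed compact_continuous_image continuous_on_subset[OF continuous_param[OF c] R(2)]
        compact_cball)
  \<comment> \<open>The point of exit still lies in the chart, because the image of the closed ball is compact.\<close>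
  have "\<gamma> \<tau> \<in> param c ` cball a R"
  proof (rule Lim_in_closed_set[OF closedC])
    have "continuous (at \<tau> within {0..\<tau>}) \<gamma>"
      using cont \<tau>E(1) by (meson atLeastAtMost_iff atLeastatMost_subset_iff continuous_on_eq_continuous_within
          continuous_within_subset order_refl)
    then have "(\<gamma> \<longlongrightarrow> \<gamma> \<tau>) (at \<tau> within {0..<\<tau>})"
      unfolding continuous_within by (rule tendsto_within_subset) auto
    then show "(\<gamma> \<longlongrightarrow> \<gamma> \<tau>) (at \<tau> within {0..<\<tau>})" .
    show "\<forall>\<^sub>F t in at \<tau> within {0..<\<tau>}. \<gamma> t \<in> param c ` cball a R"
    proof -
      have "\<gamma> t \<in> param c ` cball a R" if "t \<in> {0..<\<tau>}" for t
        using before[of t] that ball_subset_cball[of a R] by auto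
      then show ?thesis by (auto simp: eventually_at_filter)
    qed
    show "at \<tau> within {0..<\<tau>} \<noteq> bot"
      using \<tau>0 by (simp add: trivial_limit_within islimpt_in_closure[symmetric])
  qed
  then obtain v where v: "v \<in> cball a R" "\<gamma> \<tau> = param c v" by auto
  have "v \<notin> ball a R" using v(2) \<tau>E(2) by auto
  then have vR: "norm (v - a) = R" using v(1) by (auto simp: dist_norm norm_minus_commute)
  define \<sigma> where "\<sigma> = coord c \<circ> \<gamma>"
  have \<gamma>in: "\<gamma> t \<in> cdom c" if "t \<in> {0..\<tau>}" for t
    using before[of t] v R(2) that param_in[OF c] unfolding B_eq by (cases "t = \<tau>") auto
  have \<sigma>in: "\<sigma> t \<in> cball a R" if "t \<in> {0..<\<tau>}" for t
    using before[of t] that unfolding B_eq by (auto simp: \<sigma>_def)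
  have \<sigma>0: "\<sigma> 0 = p" and \<sigma>\<tau>: "\<sigma> \<tau> = v"
    using start v R(2) ball_img coord_param[OF c] by (auto simp: \<sigma>_def)
  have c\<sigma>: "continuous_on {0..\<tau>} \<sigma>"
    unfolding \<sigma>_def using \<gamma>in \<tau>E(1)
    by (intro continuous_on_compose continuous_on_subset[OF cont] continuous_on_subset[OF continuous_coord[OF c]]) auto
  obtain S where S: "finite S" "\<And>t. t \<in> {0<..<1} - S \<Longrightarrow>
      \<exists>a b. a < t \<and> t < b \<and> {a<..<b} \<subseteq> {0<..<1} \<and> C1_curve_on A a b \<gamma>"
    using piecewise_C1_local[OF \<gamma>] by blast
  define D where "D t = vector_derivative \<sigma> (at t)" for t
  let ?O = "{0<..<\<tau>} - S"
  have openO: "open ?O" using S(1) by (simp add: open_Diff finite_imp_closed)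
  have local: "(\<sigma> has_vector_derivative D t) (at t) \<and> isCont D t" if t: "t \<in> ?O" for t
  proof -
    have "t \<in> {0<..<1} - S" using t \<tau>E(1) by auto
    then obtain a' b' where ab: "a' < t" "t < b'" "{a'<..<b'} \<subseteq> {0<..<1}" "C1_curve_on A a' b' \<gamma>"
      using S(2) by blast
    then obtain D' where D': "continuous_on ({a'..b'} \<inter> \<gamma> -` cdom c) D'"
      "\<And>s. s \<in> {a'..b'} \<inter> \<gamma> -` cdom c \<Longrightarrow> (\<sigma> has_vector_derivative D' s) (at s within {a'..b'})"
      using c unfolding C1_curve_on_def \<sigma>_def by blast
    let ?N = "{a'<..<b'} \<inter> {0<..<\<tau>}"
    have NO: "open ?N" "t \<in> ?N" using ab t by auto
    have sd: "(\<sigma> has_vector_derivative D' s) (at s)" if "s \<in> ?N" for s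
    proof -
      have "(\<sigma> has_vector_derivative D' s) (at s within {a'..b'})" using D'(2)[of s] \<gamma>in[of s] that by auto
      moreover have "at s within {a'..b'} = at s" by (rule at_within_interior) (use that in auto)
      ultimately show ?thesis by simp
    qed
    have D_eq: "D s = D' s" if "s \<in> ?N" for s
      using sd[OF that] unfolding D_def by (rule vector_derivative_at)
    have "continuous_on ?N D'"
      by (rule continuous_on_subset[OF D'(1)]) (use \<gamma>in in auto)
    then have "continuous_on ?N D" by (rule continuous_on_eq) (simp add: D_eq)
    then have "isCont D t" using NO by (simp add: continuous_on_eq_continuous_at)
    then show ?thesis using sd[OF NO(2)] D_eq[OF NO(2)] by simp
  qed
  have speed: "m * norm (D t) \<le> tnorm g (\<gamma> t) (velocity A \<gamma> t)" if t: "t \<in> ?O" for t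
  proof -
    have t': "t \<in> {0..<\<tau>}" "t \<in> {0..\<tau>}" using t by auto
    have "t \<in> interior {0..1}" using t \<tau>E(1) by auto
    then have "isCont \<gamma> t" using cont continuous_on_interior by blast
    then have "velocity A \<gamma> t = tangent_vec A c (\<gamma> t) (D t)"
      using velocity_in_chart[of c \<gamma> t, OF c \<gamma>in[OF t'(2)]] local[OF t] unfolding \<sigma>_def by blast
    moreover have "\<gamma> t = param c (\<sigma> t)" using param_coord[OF c \<gamma>in[OF t'(2)]] by (simp add: \<sigma>_def)
    ultimately show ?thesis using m(2)[OF \<sigma>in[OF t'(1)]] by simp
  qed
  \<comment> \<open>Cutting \<open>D\<close> off at the finitely many break points makes it Borel measurable.\<close>
  define h where "h t = indicator ?O t *\<^sub>R D t" for t
  have h_meas: "h \<in> borel_measurable borel"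
    unfolding h_def using local openO
    by (intro borel_measurable_continuous_on_indicator continuous_at_imp_continuous_on) auto
  have "(D has_integral (\<sigma> \<tau> - \<sigma> 0)) {0..\<tau>}"
    by (rule fundamental_theorem_of_calculus_interior_strong[OF S(1)]) (use \<tau>0 local c\<sigma> in auto)
  then have "(h has_integral (\<sigma> \<tau> - \<sigma> 0)) {0..\<tau>}"
    by (rule has_integral_spike_finite[of "S \<union> {0, \<tau>}", rotated 2]) (use S(1) in \<open>auto simp: h_def\<close>)
  then have "(h has_integral (\<sigma> \<tau> - \<sigma> 0)) UNIV"
    by (rule has_integral_on_superset) (auto simp: h_def)
  from norm_integral_le_nn_integral[OF h_meas this]
  have le: "ennreal (norm (v - p)) \<le> (\<integral>\<^sup>+ t. ennreal (norm (h t)) \<partial>lborel)" by (simp add: \<sigma>0 \<sigma>\<tau>)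
  have "R - norm (p - a) \<le> norm (v - p)"
    using norm_triangle_ineq[of "v - p" "p - a"] vR by simp
  then have "ennreal (m * (R - norm (p - a))) \<le> ennreal m * ennreal (norm (v - p))"
    using m(1) by (simp add: ennreal_mult[symmetric] ennreal_leI)
  also have "\<dots> \<le> ennreal m * (\<integral>\<^sup>+ t. ennreal (norm (h t)) \<partial>lborel)"
    by (rule mult_left_mono[OF le]) simp
  also have "\<dots> = (\<integral>\<^sup>+ t. ennreal m * ennreal (norm (h t)) \<partial>lborel)"
    using h_meas by (simp add: nn_integral_cmult)
  also have "\<dots> \<le> curve_length A g \<gamma>"
    unfolding curve_length_def
  proof (rule nn_integral_mono)
    fix t :: real
    show "ennreal m * ennreal (norm (h t)) \<le> ennreal (tnorm g (\<gamma> t) (velocity A \<gamma> t)) * indicator {0..1} t"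
    proof (cases "t \<in> ?O")
      case True
      then have "t \<in> {0..1}" using \<tau>E(1) by auto
      then show ?thesis using speed[OF True] True m(1) by (simp add: h_def ennreal_mult[symmetric] ennreal_leI)
    next
      case False
      then show ?thesis by (simp only: h_def) simp
    qed
  qed
  finally show ?thesis .
qed

text \<open>
  A curve that starts in the half-sized coordinate ball \<open>W\<close> and is shorter than \<open>m R / 2\<close> cannot leave the
  coordinate ball of radius \<open>R\<close>, which is contained in \<open>V\<close>.
\<close>

lemma riemannian_dist_controls_topology:
  assumes V: "open V" "x \<in> V"
  shows "\<exists>W \<epsilon>. open W \<and> x \<in> W \<and> 0 < \<epsilon> \<and>
    (\<forall>w\<in>W. \<forall>y. riemannian_dist A g w y < ennreal \<epsilon> \<longrightarrow> y \<in> V)"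
proof -
  obtain c where c: "c \<in> A" "x \<in> cdom c" using ex_chart by blast
  let ?a = "coord c x"
  have "open (cimg c \<inter> param c -` V)"
    by (intro continuous_open_preimage continuous_param open_cimg c V)
  moreover have "?a \<in> cimg c \<inter> param c -` V" using c V coord_in param_coord by auto
  ultimately obtain R where R: "0 < R" "cball ?a R \<subseteq> cimg c \<inter> param c -` V"
    using open_contains_cball by blast
  then have Rc: "cball ?a R \<subseteq> cimg c" by auto
  obtain m where m: "m > 0" "\<And>z u. z \<in> cball ?a R \<Longrightarrow> m * norm u \<le> tnorm g (param c z) (tangent_vec A c (param c z) u)"
    using tnorm_in_chart_bounds[OF c(1) compact_cball Rc] by blast
  define W where "W = cdom c \<inter> coord c -` ball ?a (R / 2)"
  have "open W" unfolding W_def by (intro continuous_open_preimage continuous_coord open_cdom c open_ball)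
  moreover have "x \<in> W" using c R by (auto simp: W_def)
  moreover have "y \<in> V" if w: "w \<in> W" and d: "riemannian_dist A g w y < ennreal (m * R / 2)" for w y
  proof -
    obtain \<gamma> where \<gamma>: "piecewise_C1_curve A \<gamma>" "\<gamma> 0 = w" "\<gamma> 1 = y" "curve_length A g \<gamma> < ennreal (m * R / 2)"
      using d unfolding riemannian_dist_def by (auto simp: Inf_less_iff)
    let ?p = "coord c w"
    have wp: "w = param c ?p" using w param_coord[OF c(1)] by (auto simp: W_def)
    have p2: "norm (?p - ?a) < R / 2" using w by (auto simp: W_def dist_norm norm_minus_commute)
    have "y \<in> param c ` ball ?a R"
    proof (rule ccontr)
      assume "y \<notin> param c ` ball ?a R"
      then have "ennreal (m * (R - norm (?p - ?a))) \<le> curve_length A g \<gamma>"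
        using curve_length_ge_exit[OF c(1) R(1) Rc m \<gamma>(1), of ?p] \<gamma>(2,3) wp p2 R(1)
        by (auto simp: dist_norm norm_minus_commute)
      moreover have "m * R / 2 \<le> m * (R - norm (?p - ?a))" using m(1) p2 by (simp add: field_simps)
      ultimately show False using \<gamma>(4) by (meson ennreal_leI leD order_trans)
    qed
    then show ?thesis using R(2) ball_subset_cball by blast
  qed
  moreover have "0 < m * R / 2" using m R by simp
  ultimately show ?thesis by blast
qed

lemma riemannian_dist_nbhd:
  assumes L: "compact L" "L \<subseteq> V" "open V"
  shows "\<exists>\<epsilon>>0. \<forall>x\<in>L. \<forall>y. riemannian_dist A g x y < ennreal \<epsilon> \<longrightarrow> y \<in> V"
proof -
  have "\<forall>x\<in>L. \<exists>W \<epsilon>. open W \<and> x \<in> W \<and> 0 < \<epsilon> \<and>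
    (\<forall>w\<in>W. \<forall>y. riemannian_dist A g w y < ennreal \<epsilon> \<longrightarrow> y \<in> V)"
    using riemannian_dist_controls_topology[OF L(3)] L(2) by blast
  then obtain W e where W: "\<And>x. x \<in> L \<Longrightarrow> open (W x)" "\<And>x. x \<in> L \<Longrightarrow> x \<in> W x" "\<And>x. x \<in> L \<Longrightarrow> 0 < (e x :: real)"
    "\<And>x w y. x \<in> L \<Longrightarrow> w \<in> W x \<Longrightarrow> riemannian_dist A g w y < ennreal (e x) \<Longrightarrow> y \<in> V"
    by metis
  obtain T where T: "T \<subseteq> L" "finite T" "L \<subseteq> (\<Union>x\<in>T. W x)"
    using compactE_image[OF L(1), of L W] W by blast
  define \<epsilon> where "\<epsilon> = Min (insert 1 (e ` T))"
  have "\<epsilon> > 0" using T W(3) by (auto simp: \<epsilon>_def)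
  moreover have "y \<in> V" if x: "x \<in> L" "riemannian_dist A g x y < ennreal \<epsilon>" for x y
  proof -
    obtain t where t: "t \<in> T" "x \<in> W t" using T(3) x by blast
    have "\<epsilon> \<le> e t" using t T(2) by (auto simp: \<epsilon>_def)
    then have "riemannian_dist A g x y < ennreal (e t)" using x(2) by (meson ennreal_leI less_le_trans)
    then show ?thesis using W(4) t T(1) by blast
  qed
  ultimately show ?thesis by blast
qed

end

section \<open>Bounded orbits of tangent vectors\<close>

lemma full_orbit_iterate:
  assumes "z \<in> full_orbits f"
  shows "(f ^^ k) (z i) = z (i + int k)"
proof (induction k)
  case (Suc k)
  then have "(f ^^ Suc k) (z i) = f (z (i + int k))" by simp
  also have "\<dots> = z (i + int k + 1)" using assms unfolding full_orbits_def by blast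
  finally show ?case by (simp add: algebra_simps)
qed simp

locale riemannian_self_map = riemannian_manifold A g + C1_self_map A f r
  for A :: "('m::{t2_space,second_countable_topology}, 'e::euclidean_space) chart set"
    and g :: "'m \<Rightarrow> 'e \<Rightarrow> 'e \<Rightarrow> real" and f :: "'m \<Rightarrow> 'm" and r :: enat
begin

lemma tangent_map_iterate_0: "tangent_map A (f ^^ 0) x v = v"
proof -
  let ?c = "chart_at A x"
  have "((coord ?c \<circ> param ?c) has_derivative id) (at (coord ?c x))"
    by (rule has_derivative_transform_within_open[OF has_derivative_id open_cimg[OF chart_at(1)]])
      (use coord_in[OF chart_at] coord_param[OF chart_at(1)] in auto)
  moreover have "((coord ?c \<circ> param ?c) has_derivative tangent_map A (f ^^ 0) x) (at (coord ?c x))"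
    using tangent_map_iterate_has_derivative(1)[of 0 x] by (simp add: comp_def)
  ultimately have "tangent_map A (f ^^ 0) x = id" by (rule has_derivative_unique[symmetric])
  then show ?thesis by simp
qed

lemma linear_tangent_map_iterate: "linear (tangent_map A (f ^^ k) x)"
  by (rule has_derivative_linear[OF tangent_map_iterate_has_derivative(1)])

text \<open>
  The unstable component of a bounded orbit of tangent vectors would grow exponentially in the
  future. Hence such an orbit is stable at all times, and then it decays exponentially from
  arbitrarily far in the past.
\<close>

lemma hyperbolic_bounded_tangent_orbit_zero:
  assumes hyp: "hyperbolic A g f L" and z: "z \<in> orbits_in f L"
    and w: "\<And>i. w (i + 1) = tangent_map A f (z i) (w i)"
    and bdd: "\<And>i. tnorm g (z i) (w i) \<le> B"
  shows "w i = 0"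
proof -
  have zf: "z \<in> full_orbits f" and zL: "\<And>i. z i \<in> L" using z unfolding orbits_in_def by auto
  obtain C \<mu> where C: "C > 0" and \<mu>: "0 < \<mu>" "\<mu> < 1"
    and split: "\<forall>x\<in>L. \<forall>xs \<in> orbits_of f x \<inter> orbits_in f L. \<exists>Es Eu.
          continuous_splitting A (range (\<lambda>i. shift_pow i xs)) Es Eu \<and>
          (\<forall>i. tangent_map A f (xs i) ` Es (shift_pow i xs) = Es (shift_pow (i + 1) xs) \<and>
               tangent_map A f (xs i) ` Eu (shift_pow i xs) = Eu (shift_pow (i + 1) xs)) \<and>
          (\<forall>k::nat. \<forall>i. \<forall>v \<in> Es (shift_pow i xs).
             tnorm g (xs (i + int k)) (tangent_map A (f ^^ k) (xs i) v)
               \<le> C * \<mu> ^ k * tnorm g (xs i) v) \<and>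
          (\<forall>k::nat. \<forall>i. \<forall>v \<in> Eu (shift_pow i xs).
             tnorm g (xs (i + int k)) (tangent_map A (f ^^ k) (xs i) v)
               \<ge> (1 / C) * inverse \<mu> ^ k * tnorm g (xs i) v)"
    using hyp unfolding hyperbolic_def by (elim conjE exE) (rule that)
  have zo: "z \<in> orbits_of f (z 0) \<inter> orbits_in f L" using zf z unfolding orbits_of_def by auto
  obtain Es Eu where cs: "continuous_splitting A (range (\<lambda>i. shift_pow i z)) Es Eu"
    and Es: "\<forall>k::nat. \<forall>i. \<forall>v \<in> Es (shift_pow i z).
             tnorm g (z (i + int k)) (tangent_map A (f ^^ k) (z i) v) \<le> C * \<mu> ^ k * tnorm g (z i) v"
    and Eu: "\<forall>k::nat. \<forall>i. \<forall>v \<in> Eu (shift_pow i z).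
             tnorm g (z (i + int k)) (tangent_map A (f ^^ k) (z i) v) \<ge> (1 / C) * inverse \<mu> ^ k * tnorm g (z i) v"
    using bspec[OF bspec[OF split zL[of 0]] zo] by (elim exE conjE) (rule that)
  have dec: "\<exists>a\<in>Es (shift_pow i z). \<exists>b\<in>Eu (shift_pow i z). v = a + b" for i v
    using cs unfolding continuous_splitting_def by blast
  have wk: "w (i + int k) = tangent_map A (f ^^ k) (z i) (w i)" for i k
  proof (induction k)
    case 0
    show ?case unfolding tangent_map_iterate_0 by simp
  next
    case (Suc k)
    have "w (i + int (Suc k)) = w ((i + int k) + 1)" by (simp add: algebra_simps)
    also have "\<dots> = tangent_map A f ((f ^^ k) (z i)) (w (i + int k))"
      using w full_orbit_iterate[OF zf] by simp
    finally show ?case unfolding tangent_map_iterate_has_derivative(2) comp_apply Suc .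
  qed
  have stable: "w i \<in> Es (shift_pow i z)" for i
  proof -
    obtain a b where a: "a \<in> Es (shift_pow i z)" and b: "b \<in> Eu (shift_pow i z)" and ab: "w i = a + b"
      using dec by blast
    define c where "c = C * (B + C * tnorm g (z i) a)"
    have le: "inverse \<mu> ^ k * tnorm g (z i) b \<le> c" for k :: nat
    proof -
      let ?T = "tangent_map A (f ^^ k) (z i)" and ?n = "tnorm g (z (i + int k))"
      have "?T b = ?T (w i) + (-1) *\<^sub>R ?T a"
        unfolding ab by (simp add: linear_add[OF linear_tangent_map_iterate])
      then have "?n (?T b) \<le> ?n (?T (w i)) + ?n (?T a)"
        using tnorm_triangle[of _ "?T (w i)" "(-1) *\<^sub>R ?T a"] tnorm_scale[of _ "-1" "?T a"] by simp
      also have "?n (?T (w i)) \<le> B" using bdd[of "i + int k"] wk by simp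
      also have "?n (?T a) \<le> C * \<mu> ^ k * tnorm g (z i) a" using Es a by blast
      also have "\<dots> \<le> C * 1 * tnorm g (z i) a"
        using C \<mu> tnorm_nonneg by (intro mult_right_mono mult_left_mono power_le_one) auto
      finally have "?n (?T b) \<le> B + C * tnorm g (z i) a" by simp
      moreover have "(1 / C) * inverse \<mu> ^ k * tnorm g (z i) b \<le> ?n (?T b)" using Eu b by blast
      ultimately have "(1 / C) * (inverse \<mu> ^ k * tnorm g (z i) b) \<le> B + C * tnorm g (z i) a"
        by (simp add: mult.assoc)
      from mult_left_mono[OF this, of C] show ?thesis using C by (simp add: c_def)
    qed
    have "b = 0"
    proof (rule ccontr)
      assume "b \<noteq> 0"
      then have pos: "tnorm g (z i) b > 0" by (rule tnorm_pos)
      have "1 < inverse \<mu>" using \<mu> by (simp add: one_less_inverse)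
      then obtain k where "c / tnorm g (z i) b < inverse \<mu> ^ k" using real_arch_pow by blast
      then show False using le[of k] pos by (simp add: field_simps)
    qed
    then show ?thesis using a ab by simp
  qed
  have "tnorm g (z i) (w i) \<le> C * B * \<mu> ^ k" for k :: nat
  proof -
    have "tnorm g (z (i - int k + int k)) (tangent_map A (f ^^ k) (z (i - int k)) (w (i - int k)))
        \<le> C * \<mu> ^ k * tnorm g (z (i - int k)) (w (i - int k))"
      using Es stable by blast
    also have "\<dots> \<le> C * \<mu> ^ k * B" using bdd C \<mu> by (intro mult_left_mono) auto
    finally show ?thesis using wk[of "i - int k" k] by (simp add: algebra_simps)
  qed
  moreover have "(\<lambda>k. C * B * \<mu> ^ k) \<longlonglongrightarrow> C * B * 0"
    using \<mu> by (intro tendsto_intros LIMSEQ_power_zero) auto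
  ultimately have "tnorm g (z i) (w i) \<le> 0" by (intro LIMSEQ_le_const) auto
  then show ?thesis using tnorm_pos[of "w i" "z i"] by linarith
qed

end

section \<open>Compactness\<close>

text \<open>
  Tychonoff's theorem for a countable product of first countable spaces, in terms of sequences.
  It extracts limits of sequences of orbits.
\<close>

lemma seq_compact_product:
  fixes x :: "nat \<Rightarrow> 'i::countable \<Rightarrow> 'b::first_countable_topology"
  assumes S: "\<And>i. compact (S i)" and x: "\<And>n i. x n i \<in> S i"
  shows "\<exists>l \<sigma>. strict_mono \<sigma> \<and> (\<forall>i. l i \<in> S i \<and> (\<lambda>n. x (\<sigma> n) i) \<longlonglongrightarrow> l i)"
proof -
  have "compactin (product_topology (\<lambda>i. euclidean) UNIV) (PiE UNIV S)"
    using S by (simp add: compactin_PiE)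
  then have "compact (PiE UNIV S)" by (simp add: euclidean_product_topology)
  then have "seq_compact (PiE UNIV S)" by (rule compact_imp_seq_compact)
  moreover have "\<forall>n. x n \<in> PiE UNIV S" using x by auto
  ultimately obtain l \<sigma> where l: "l \<in> PiE UNIV S" "strict_mono \<sigma>" "(x \<circ> \<sigma>) \<longlonglongrightarrow> l"
    by (rule seq_compactE)
  have "(\<lambda>n. x (\<sigma> n) i) \<longlonglongrightarrow> l i" for i
  proof -
    from continuous_on_tendsto_compose[OF continuous_on_product_coordinates[of i] l(3)]
    show ?thesis by (simp add: comp_def)
  qed
  moreover have "l i \<in> S i" for i using l(1) by (rule PiE_mem) simp
  ultimately show ?thesis using l(2) by blast
qed

text \<open>
  With these neighbourhoods, statements that hold uniformly near \<open>L\<close> can be proved by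
  contradiction along sequences that converge to points of \<open>L\<close>.
\<close>

lemma closed_countable_neighbourhoods:
  fixes L :: "'a::{t2_space,second_countable_topology} set"
  assumes L: "closed L" "compact L"
  shows "\<exists>V. (\<forall>n::nat. open (V n) \<and> L \<subseteq> V n) \<and> decseq V \<and>
    (\<forall>x l. (\<forall>n. x n \<in> V n) \<and> x \<longlonglongrightarrow> l \<longrightarrow> l \<in> L)"
proof -
  obtain B :: "'a set set" where B: "countable B" "topological_basis B" using ex_countable_basis by blast
  \<comment> \<open>The empty set is added only to make \<open>G\<close> nonempty, so that it can be enumerated.\<close>
  define G where "G = insert {} {b\<in>B. closure b \<inter> L = {}}"
  have G: "countable G" "G \<noteq> {}" using B by (auto simp: G_def)
  define b where "b = from_nat_into G"
  have b: "closure (b n) \<inter> L = {}" for n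
    using from_nat_into[OF G(2), of n] by (auto simp: b_def G_def)
  have b_surj: "\<exists>n. b n = u" if "u \<in> G" for u
    using from_nat_into_surj[OF G(1) that] by (auto simp: b_def)
  define V where "V n = (\<Inter>k<n. - closure (b k))" for n
  have "open (V n)" for n unfolding V_def by (intro open_INT) auto
  moreover have "L \<subseteq> V n" for n using b by (auto simp: V_def)
  moreover have "decseq V" by (auto simp: V_def decseq_def)
  moreover have "l \<in> L" if x: "\<forall>n. x n \<in> V n" "x \<longlonglongrightarrow> l" for x l
  proof (rule ccontr)
    assume l: "l \<notin> L"
    have H: "Hausdorff_space (euclidean :: 'a topology)"
      unfolding Hausdorff_space_def disjnt_def using separation_t2 by auto
    have cl: "compactin euclidean {l}" "compactin euclidean L" "disjnt {l} L" using l L(2) by auto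
    obtain U W where UW: "openin euclidean U" "openin euclidean W" "{l} \<subseteq> U" "L \<subseteq> W" "disjnt U W"
      by (rule Hausdorff_space_compact_separation[OF H cl]) (rule that)
    then have oU: "open U" "open W" "l \<in> U" "U \<inter> W = {}" by (auto simp: disjnt_def)
    obtain u where u: "u \<in> B" "l \<in> u" "u \<subseteq> U" using topological_basisE[OF B(2) oU(1,3)] by blast
    have "closure u \<subseteq> - W" using u(3) oU by (intro closure_minimal) auto
    then have "u \<in> G" using u(1) UW(4) by (auto simp: G_def)
    then obtain n where n: "b n = u" using b_surj by blast
    have "open u" using u(1) B(2) topological_basis_open by blast
    then have "eventually (\<lambda>m. x m \<in> u) sequentially" using x(2) u(2) topological_tendstoD by blast
    moreover have "eventually (\<lambda>m. n < m) sequentially" by (rule eventually_gt_at_top)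
    ultimately have "eventually (\<lambda>m. False) sequentially"
    proof eventually_elim
      case (elim m)
      have "x m \<notin> closure (b n)" using x(1)[rule_format, of m] elim(2) unfolding V_def by auto
      then show False using elim(1) n closure_subset by blast
    qed
    then show False by simp
  qed
  ultimately show ?thesis by blast
qed

section \<open>Finite atlases\<close>

context smooth_manifold
begin

text \<open>
  The number \<open>\<rho>\<close> is a Lebesgue number: it is a margin around each point within one of the charts,
  which makes coordinates of points near a given one meaningful.
\<close>

lemma finite_atlas_exists:
  "\<exists>(cc :: nat \<Rightarrow> ('m, 'e) chart) J K \<rho>. 0 < \<rho> \<and>
    (\<forall>j<J. cc j \<in> A \<and> compact (K j) \<and> K j \<subseteq> cimg (cc j)) \<and>
    (\<forall>x. \<exists>j<J. x \<in> cdom (cc j) \<and> cball (coord (cc j) x) \<rho> \<subseteq> K j)"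
proof -
  have "\<exists>c s. c \<in> A \<and> x \<in> cdom c \<and> 0 < s \<and> cball (coord c x) (2 * s) \<subseteq> cimg c" for x
  proof -
    obtain c where c: "c \<in> A" "x \<in> cdom c" using ex_chart by blast
    obtain e where "0 < e" "cball (coord c x) e \<subseteq> cimg c"
      using open_contains_cball_eq[OF open_cimg[OF c(1)]] coord_in[OF c] by blast
    then show ?thesis using c by (intro exI[of _ c] exI[of _ "e / 2"]) auto
  qed
  then obtain c s where c: "\<And>x. c x \<in> A" "\<And>x. x \<in> cdom (c x)" and s: "\<And>x. 0 < (s x :: real)"
    "\<And>x. cball (coord (c x) x) (2 * s x) \<subseteq> cimg (c x)"
    by metis
  define W where "W x = cdom (c x) \<inter> coord (c x) -` ball (coord (c x) x) (s x)" for x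
  have oW: "open (W x)" for x
    unfolding W_def by (intro continuous_open_preimage continuous_coord open_cdom c open_ball)
  have xW: "x \<in> W x" for x using c s by (auto simp: W_def)
  obtain T where "T \<subseteq> UNIV" and T: "finite T" "UNIV \<subseteq> (\<Union>x\<in>T. W x)"
    by (rule compactE_image[OF compact_M, of UNIV W]) (use oW xW in blast)+
  obtain a where a: "bij_betw a {..<card T} T"
    using ex_bij_betw_nat_finite[OF T(1)] atLeast0LessThan by metis
  \<comment> \<open>The value \<open>1\<close> only covers the case of an empty manifold.\<close>
  define \<rho> where "\<rho> = Min (insert 1 (s ` T))"
  have \<rho>: "\<rho> > 0" "\<And>x. x \<in> T \<Longrightarrow> \<rho> \<le> s x" using T(1) s by (auto simp: \<rho>_def)
  define K where "K j = cball (coord (c (a j)) (a j)) (2 * s (a j))" for j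
  have cover: "\<exists>j<card T. x \<in> cdom ((c \<circ> a) j) \<and> cball (coord ((c \<circ> a) j) x) \<rho> \<subseteq> K j" for x
  proof -
    obtain y where y: "y \<in> T" "x \<in> W y" using T(2) by blast
    have "y \<in> a ` {..<card T}" using y(1) bij_betw_imp_surj_on[OF a] by simp
    then obtain j where j: "j < card T" "a j = y" by auto
    have "cball (coord (c y) x) \<rho> \<subseteq> cball (coord (c y) y) (2 * s y)"
    proof
      fix p assume "p \<in> cball (coord (c y) x) \<rho>"
      then have "dist (coord (c y) x) p \<le> s y" using \<rho>(2)[OF y(1)] by auto
      moreover have "dist (coord (c y) y) (coord (c y) x) < s y" using y by (auto simp: W_def)
      ultimately show "p \<in> cball (coord (c y) y) (2 * s y)"
        using dist_triangle[of "coord (c y) y" p "coord (c y) x"] by auto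
    qed
    then show ?thesis using j y by (intro exI[of _ j]) (auto simp: W_def K_def)
  qed
  show ?thesis
    by (intro exI[of _ "c \<circ> a"] exI[of _ "card T"] exI[of _ K] exI[of _ \<rho>])
      (use \<rho>(1) cover c s in \<open>auto simp: K_def\<close>)
qed

end

section \<open>Expansivity of pseudo-orbits near a hyperbolic set\<close>

text \<open>
  Used to normalise a bounded sequence at an index where it is largest up to a factor: the supremum
  itself need not be attained.
\<close>

lemma ex_almost_maximal:
  fixes d :: "'i \<Rightarrow> real"
  assumes "bdd_above (range d)" "d i > 0"
  shows "\<exists>m. 0 < d m \<and> (\<forall>i. d i \<le> 2 * d m)"
proof -
  let ?S = "SUP i. d i"
  have le: "d i \<le> ?S" for i using assms(1) by (simp add: cSUP_upper)
  then have "?S > 0" using assms(2) by (meson less_le_trans)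
  then have "?S / 2 < ?S" by simp
  then obtain m where m: "?S / 2 < d m" using less_cSUP_iff[of UNIV d "?S / 2"] assms(1) by blast
  have "d i \<le> 2 * d m" for i using le[of i] m by simp
  moreover have "0 < d m" using m \<open>?S > 0\<close> by simp
  ultimately show ?thesis by blast
qed

locale finite_atlas_map = riemannian_self_map A g f r
  for A :: "('m::{t2_space,second_countable_topology}, 'e::euclidean_space) chart set"
    and g :: "'m \<Rightarrow> 'e \<Rightarrow> 'e \<Rightarrow> real" and f :: "'m \<Rightarrow> 'm" and r :: enat +
  fixes cc :: "nat \<Rightarrow> ('m, 'e) chart" and J :: nat and K :: "nat \<Rightarrow> 'e set" and \<rho> :: real
  assumes \<rho>: "0 < \<rho>"
    and cc: "\<And>j. j < J \<Longrightarrow> cc j \<in> A"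
    and K: "\<And>j. j < J \<Longrightarrow> compact (K j)" "\<And>j. j < J \<Longrightarrow> K j \<subseteq> cimg (cc j)"
    and cover: "\<And>x. \<exists>j<J. x \<in> cdom (cc j) \<and> cball (coord (cc j) x) \<rho> \<subseteq> K j"
begin

abbreviation pt :: "nat \<Rightarrow> 'e \<Rightarrow> 'm" where "pt j \<equiv> param (cc j)"
abbreviation co :: "nat \<Rightarrow> 'm \<Rightarrow> 'e" where "co j \<equiv> coord (cc j)"
definition loc :: "nat \<Rightarrow> nat \<Rightarrow> 'e \<Rightarrow> 'e" where "loc j k = co k \<circ> f \<circ> pt j"

text \<open>
  Points of a pseudo-orbit are given by a chart and coordinates with the margin \<open>\<rho>\<close>. The chart is part
  of the data, since in general no choice of charts depends continuously on the point.
\<close>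

definition admissible :: "nat \<Rightarrow> 'e \<Rightarrow> bool" where
  "admissible j X \<longleftrightarrow> j < J \<and> cball X \<rho> \<subseteq> K j"

definition pseudo_step :: "real \<Rightarrow> nat \<Rightarrow> 'e \<Rightarrow> nat \<Rightarrow> 'e \<Rightarrow> bool" where
  "pseudo_step \<eta> j X k Y \<longleftrightarrow> admissible j X \<and> admissible k Y \<and>
     f (pt j X) \<in> cdom (cc k) \<and> norm (loc j k X - Y) \<le> \<eta>"

lemma admissibleD:
  assumes "admissible j X"
  shows "j < J" "norm (v - X) \<le> \<rho> \<Longrightarrow> v \<in> K j" "X \<in> K j"
  using assms \<rho> by (auto simp: admissible_def dist_norm norm_minus_commute)

lemma pt_in: "j < J \<Longrightarrow> p \<in> K j \<Longrightarrow> pt j p \<in> cdom (cc j)"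
  by (rule param_in[OF cc]) (use K(2) in blast)+

lemma co_pt: "j < J \<Longrightarrow> p \<in> K j \<Longrightarrow> co j (pt j p) = p"
  by (rule coord_param[OF cc]) (use K(2) in blast)+

lemma isCont_pt: "j < J \<Longrightarrow> p \<in> K j \<Longrightarrow> isCont (pt j) p"
  by (rule isCont_param[OF cc]) (use K(2) in blast)+

lemma ex_admissible: "\<exists>j X. admissible j X \<and> pt j X = x"
proof -
  obtain j where "j < J" "x \<in> cdom (cc j)" "cball (co j x) \<rho> \<subseteq> K j" using cover by blast
  then show ?thesis using param_coord[OF cc] by (intro exI[of _ j] exI[of _ "co j x"]) (auto simp: admissible_def)
qed

definition KK :: "'e set" where "KK = (\<Union>j<J. K j)"

lemma compact_KK: "compact KK"
  unfolding KK_def using K(1) by auto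

lemma isCont_loc:
  assumes "j < J" "k < J" "p \<in> K j" "f (pt j p) \<in> cdom (cc k)"
  shows "isCont (loc j k) p"
  unfolding loc_def comp_assoc comp_def
  by (rule isCont_o2[OF isCont_o2[OF isCont_pt[OF assms(1,3)] isCont_f] isCont_coord[OF cc[OF assms(2)] assms(4)]])

text \<open>
  Compact cores are used here: the limits of the coordinates remain in the charts, and therefore the
  vanishing jumps can be read off in the manifold.
\<close>

lemma pseudo_step_limit:
  assumes jk: "j < J" "k < J" and X: "X \<longlonglongrightarrow> x" and Y: "Y \<longlonglongrightarrow> y" and \<eta>: "\<eta> \<longlonglongrightarrow> 0"
    and step: "\<forall>\<^sub>F n in sequentially. pseudo_step (\<eta> n) j (X n) k (Y n)"
  shows "x \<in> K j" "y \<in> K k" "f (pt j x) = pt k y"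
proof -
  have XK: "\<forall>\<^sub>F n in sequentially. X n \<in> K j"
    using step by eventually_elim (auto simp: pseudo_step_def admissibleD)
  have YK: "\<forall>\<^sub>F n in sequentially. Y n \<in> K k"
    using step by eventually_elim (auto simp: pseudo_step_def admissibleD)
  show x: "x \<in> K j" using Lim_in_closed_set[OF compact_imp_closed[OF K(1)[OF jk(1)]] XK _ X] by simp
  show y: "y \<in> K k" using Lim_in_closed_set[OF compact_imp_closed[OF K(1)[OF jk(2)]] YK _ Y] by simp
  have "(\<lambda>n. loc j k (X n) - Y n) \<longlonglongrightarrow> 0"
    by (rule Lim_null_comparison[OF _ \<eta>]) (use step in \<open>auto simp: pseudo_step_def elim: eventually_mono\<close>)
  from tendsto_add[OF this Y] have l: "(\<lambda>n. loc j k (X n)) \<longlonglongrightarrow> y" by simp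
  have "(\<lambda>n. pt k (loc j k (X n))) \<longlonglongrightarrow> pt k y"
    by (rule isCont_tendsto_compose[OF isCont_pt[OF jk(2) y] l])
  moreover have "\<forall>\<^sub>F n in sequentially. pt k (loc j k (X n)) = f (pt j (X n))"
    using step by eventually_elim (auto simp: pseudo_step_def loc_def param_coord[OF cc[OF jk(2)]])
  ultimately have "(\<lambda>n. f (pt j (X n))) \<longlonglongrightarrow> pt k y"
    by (rule Lim_transform_eventually)
  moreover have "(\<lambda>n. f (pt j (X n))) \<longlonglongrightarrow> f (pt j x)"
    by (intro isCont_tendsto_compose[OF isCont_f] isCont_tendsto_compose[OF isCont_pt[OF jk(1) x]] X)
  ultimately show "f (pt j x) = pt k y" using LIMSEQ_unique by blast
qed

text \<open>
  A compactness argument: one size \<open>\<eta>\<close> of balls works for all steps of all pseudo-orbits near \<open>L\<close>.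
\<close>

lemma pseudo_step_uniform_domain:
  assumes L: "closed L" and V0: "open V0" "L \<subseteq> V0"
  shows "\<exists>V \<eta>. open V \<and> L \<subseteq> V \<and> 0 < \<eta> \<and> (\<forall>j X k Y v. pseudo_step \<eta> j X k Y \<and> pt j X \<in> V \<and> norm (v - X) \<le> \<eta>
     \<longrightarrow> f (pt j v) \<in> cdom (cc k) \<and> pt j v \<in> V0)"
proof (rule ccontr)
  assume contra: "\<not> ?thesis"
  have "compact L" using compact_M L by (metis closed_Int_compact inf_top.right_neutral)
  then obtain V where V: "\<And>n::nat. open (V n)" "\<And>n. L \<subseteq> V n" "decseq V"
    and Vlim: "\<And>x l. (\<And>n. x n \<in> V n) \<Longrightarrow> x \<longlonglongrightarrow> l \<Longrightarrow> l \<in> L"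
    using closed_countable_neighbourhoods[OF L] by metis
  have "\<exists>j X k Y v. pseudo_step (1 / Suc n) j X k Y \<and> pt j X \<in> V n \<and> norm (v - X) \<le> 1 / Suc n
     \<and> \<not> (f (pt j v) \<in> cdom (cc k) \<and> pt j v \<in> V0)" for n
  proof -
    have "0 < 1 / real (Suc n)" by simp
    then show ?thesis using contra V(1)[of n] V(2)[of n] by meson
  qed
  then obtain j X k Y v where step: "\<And>n. pseudo_step (1 / Suc n) (j n) (X n) (k n) (Y n)"
    and XV: "\<And>n. pt (j n) (X n) \<in> V n" and vX: "\<And>n. norm (v n - X n) \<le> 1 / Suc n"
    and bad: "\<And>n. \<not> (f (pt (j n) (v n)) \<in> cdom (cc (k n)) \<and> pt (j n) (v n) \<in> V0)"
    by metis
  define S where "S = {..<J} \<times> {..<J} \<times> KK \<times> KK"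
  have cS: "compact S" unfolding S_def by (intro compact_Times compact_KK finite_imp_compact) auto
  have inS: "(j n, k n, X n, Y n) \<in> S" for n
    using step[of n] admissibleD by (force simp: S_def KK_def pseudo_step_def)
  obtain l \<sigma> where l: "l \<in> S" "strict_mono \<sigma>" and lim: "((\<lambda>n. (j n, k n, X n, Y n)) \<circ> \<sigma>) \<longlonglongrightarrow> l"
    by (rule seq_compactE[OF compact_imp_seq_compact[OF cS] allI[OF inS]]) (rule that)
  obtain j0 k0 x y where l_eq: "l = (j0, k0, x, y)" by (cases l)
  have jk: "j0 < J" "k0 < J" using l(1) by (auto simp: l_eq S_def)
  have lims: "(\<lambda>n. j (\<sigma> n)) \<longlonglongrightarrow> j0" "(\<lambda>n. k (\<sigma> n)) \<longlonglongrightarrow> k0" "(\<lambda>n. X (\<sigma> n)) \<longlonglongrightarrow> x" "(\<lambda>n. Y (\<sigma> n)) \<longlonglongrightarrow> y"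
    using tendsto_fst[OF lim] tendsto_fst[OF tendsto_snd[OF lim]] tendsto_fst[OF tendsto_snd[OF tendsto_snd[OF lim]]]
      tendsto_snd[OF tendsto_snd[OF tendsto_snd[OF lim]]] by (auto simp: l_eq comp_def)
  have evj: "\<forall>\<^sub>F n in sequentially. j (\<sigma> n) = j0" and evk: "\<forall>\<^sub>F n in sequentially. k (\<sigma> n) = k0"
    using lims(1,2) by (auto simp: tendsto_discrete)
  have inv0: "(\<lambda>n. 1 / real (Suc (\<sigma> n))) \<longlonglongrightarrow> 0"
    using LIMSEQ_subseq_LIMSEQ[OF LIMSEQ_Suc[OF lim_1_over_n] l(2)] by (simp add: comp_def)
  have ev_step: "\<forall>\<^sub>F n in sequentially. pseudo_step (1 / Suc (\<sigma> n)) j0 (X (\<sigma> n)) k0 (Y (\<sigma> n))"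
    using evj evk by eventually_elim (use step in metis)
  note xy = pseudo_step_limit[OF jk lims(3,4) inv0 ev_step]
  have ptX: "(\<lambda>n. pt j0 (X (\<sigma> n))) \<longlonglongrightarrow> pt j0 x"
    by (rule isCont_tendsto_compose[OF isCont_pt[OF jk(1) xy(1)] lims(3)])
  have "(\<lambda>n. pt (j (\<sigma> n)) (X (\<sigma> n))) \<longlonglongrightarrow> pt j0 x"
    by (rule Lim_transform_eventually[OF ptX]) (use evj in \<open>eventually_elim, simp\<close>)
  moreover have "pt (j (\<sigma> n)) (X (\<sigma> n)) \<in> V n" for n
    using XV[of "\<sigma> n"] decseqD[OF V(3) seq_suble[OF l(2), of n]] by auto
  ultimately have xL: "pt j0 x \<in> L" by (rule Vlim[rotated])
  have "(\<lambda>n. v (\<sigma> n) - X (\<sigma> n)) \<longlonglongrightarrow> 0"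
    by (rule Lim_null_comparison[OF _ inv0]) (use vX in auto)
  from tendsto_add[OF this lims(3)] have v: "(\<lambda>n. v (\<sigma> n)) \<longlonglongrightarrow> x" by simp
  have ptv: "(\<lambda>n. pt j0 (v (\<sigma> n))) \<longlonglongrightarrow> pt j0 x"
    by (rule isCont_tendsto_compose[OF isCont_pt[OF jk(1) xy(1)] v])
  have "\<forall>\<^sub>F n in sequentially. pt j0 (v (\<sigma> n)) \<in> V0"
    by (rule topological_tendstoD[OF ptv V0(1)]) (use xL V0(2) in auto)
  moreover have "\<forall>\<^sub>F n in sequentially. f (pt j0 (v (\<sigma> n))) \<in> cdom (cc k0)"
    by (rule topological_tendstoD[OF isCont_tendsto_compose[OF isCont_f ptv] open_cdom[OF cc[OF jk(2)]]])
      (use xy pt_in jk in auto)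
  ultimately have "\<forall>\<^sub>F n in sequentially. False"
    using evj evk by eventually_elim (use bad in metis)
  then show False by simp
qed

definition pseudo_orbit :: "'m set \<Rightarrow> real \<Rightarrow> (int \<Rightarrow> nat) \<Rightarrow> (int \<Rightarrow> 'e) \<Rightarrow> bool" where
  "pseudo_orbit V \<eta> j X \<longleftrightarrow> (\<forall>i. pt (j i) (X i) \<in> V \<and> pseudo_step \<eta> (j i) (X i) (j (i + 1)) (X (i + 1)))"

definition defect :: "(int \<Rightarrow> nat) \<Rightarrow> (int \<Rightarrow> 'e) \<Rightarrow> int \<Rightarrow> 'e" where
  "defect j p i = p (i + 1) - loc (j i) (j (i + 1)) (p i)"

text \<open>
  This is where the assumption that \<open>f\<close> is of class \<open>C\<^sup>1\<close> enters the dynamics.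
\<close>

lemma loc_strictly_differentiable:
  assumes "j < J" "k < J" "x \<in> K j" "f (pt j x) \<in> cdom (cc k)" "0 < e"
  shows "\<exists>d>0. \<forall>p\<in>ball x d. \<forall>q\<in>ball x d.
    norm (loc j k p - loc j k q - frechet_derivative (loc j k) (at x) (p - q)) \<le> e * norm (p - q)"
  unfolding loc_def
proof (rule Cr_on_strictly_differentiable[OF local_rep_Cr[OF cc[OF assms(1)] cc[OF assms(2)]] r
      open_local_domain[OF cc[OF assms(1)] cc[OF assms(2)]] _ assms(5)])
  show "x \<in> co j ` (cdom (cc j) \<inter> f -` cdom (cc k))"
    using assms(4) pt_in[OF assms(1,3)] co_pt[OF assms(1,3)] by (intro image_eqI[of _ _ "pt j x"]) auto
qed

lemma tnorm_uniform_bound: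
  "\<exists>M>0. \<forall>k p u. k < J \<longrightarrow> p \<in> K k \<longrightarrow> tnorm g (pt k p) (tangent_vec A (cc k) (pt k p) u) \<le> M * norm u"
proof -
  have "\<exists>M>0. \<forall>p\<in>K k. \<forall>u. tnorm g (pt k p) (tangent_vec A (cc k) (pt k p) u) \<le> M * norm u" if "k < J" for k
    using tnorm_in_chart_bounds[OF cc[OF that] K(1)[OF that] K(2)[OF that]] by blast
  then obtain M where M: "\<And>k. k < J \<Longrightarrow> M k > 0"
    "\<And>k p u. k < J \<Longrightarrow> p \<in> K k \<Longrightarrow> tnorm g (pt k p) (tangent_vec A (cc k) (pt k p) u) \<le> M k * norm u"
    by metis
  have sum_nonneg: "0 \<le> (\<Sum>k<J. M k)" using M(1) by (intro sum_nonneg) (auto intro: less_imp_le)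
  have "tnorm g (pt k p) (tangent_vec A (cc k) (pt k p) u) \<le> ((\<Sum>k<J. M k) + 1) * norm u"
    if k: "k < J" "p \<in> K k" for k p u
  proof -
    have "M k \<le> (\<Sum>k<J. M k)" using M(1) k by (intro member_le_sum) (auto intro: less_imp_le)
    then have "M k * norm u \<le> ((\<Sum>k<J. M k) + 1) * norm u" by (intro mult_right_mono) auto
    then show ?thesis using M(2)[OF k, of u] by linarith
  qed
  moreover have "0 < (\<Sum>k<J. M k) + 1" using sum_nonneg by linarith
  ultimately show ?thesis by blast
qed

text \<open>
  The bounded tangent orbits that arise as limits are written in the charts of the finite atlas,
  where the Euclidean norm and the Riemannian one are uniformly equivalent.
\<close>

lemma bounded_tangent_orbit_in_charts_zero:
  fixes j :: "int \<Rightarrow> nat"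
  assumes hyp: "hyperbolic A g f \<Omega>" and j: "\<And>i. j i < J" and x: "\<And>i. x i \<in> K (j i)"
    and orbit: "\<And>i. f (pt (j i) (x i)) = pt (j (i + 1)) (x (i + 1))" "\<And>i. pt (j i) (x i) \<in> \<Omega>"
    and D: "\<And>i. D (i + 1) = frechet_derivative (loc (j i) (j (i + 1))) (at (x i)) (D i)"
    and bdd: "\<And>i. norm (D i) \<le> b"
  shows "D i = 0"
proof -
  define z where "z i = pt (j i) (x i)" for i
  define w where "w i = tangent_vec A (cc (j i)) (z i) (D i)" for i
  have z_in: "z i \<in> cdom (cc (j i))" for i unfolding z_def by (rule pt_in[OF j x])
  have fz: "f (z i) = z (i + 1)" for i using orbit(1) by (simp add: z_def)
  have co_z: "co (j i) (z i) = x i" for i unfolding z_def by (rule co_pt[OF j x])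
  have z: "z \<in> orbits_in f \<Omega>" using fz orbit(2) by (auto simp: orbits_in_def full_orbits_def z_def)
  have w_step: "w (i + 1) = tangent_map A f (z i) (w i)" for i
  proof -
    have "f (z i) \<in> cdom (cc (j (i + 1)))" using fz z_in by simp
    from tangent_map_in_charts[OF cc[OF j] cc[OF j] z_in this, of "D i"]
    show ?thesis by (simp add: w_def fz co_z D loc_def)
  qed
  obtain M where M: "M > 0"
    "\<And>k p u. k < J \<Longrightarrow> p \<in> K k \<Longrightarrow> tnorm g (pt k p) (tangent_vec A (cc k) (pt k p) u) \<le> M * norm u"
    using tnorm_uniform_bound by blast
  have "tnorm g (z i) (w i) \<le> M * b" for i
  proof -
    have "tnorm g (z i) (w i) \<le> M * norm (D i)" unfolding w_def z_def by (rule M(2)[OF j x])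
    also have "\<dots> \<le> M * b" using M(1) bdd by (intro mult_left_mono) auto
    finally show ?thesis .
  qed
  from hyperbolic_bounded_tangent_orbit_zero[OF hyp z w_step this]
  have "w i = 0" for i .
  then show ?thesis using tangent_vec_eq_0[OF cc[OF j] z_in] unfolding w_def by blast
qed

lemma pseudo_orbit_shift:
  assumes "pseudo_orbit V \<eta> j X"
  shows "pseudo_orbit V \<eta> (\<lambda>i. j (i + m)) (\<lambda>i. X (i + m))"
proof -
  have eq: "i + 1 + m = (i + m) + 1" for i :: int by simp
  show ?thesis using assms unfolding pseudo_orbit_def eq by blast
qed

text \<open>
  The source of all uniformity in the shadowing argument. If no constant works, there are
  sequences \<open>p\<close>, \<open>q\<close> along pseudo-orbits that converge to \<open>L\<close> with jumps tending to \<open>0\<close>, whose defects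
  differ by much less than \<open>p\<close> and \<open>q\<close> do. After shifting the index, \<open>p - q\<close> is almost largest at the
  index \<open>0\<close>. Divided by its norm there, it converges along a subsequence, and since the difference
  of the defects becomes negligible and \<open>f\<close> is strictly differentiable, the limit is an orbit of the
  derivative. It is bounded and has norm \<open>1\<close> at the index \<open>0\<close>, contradicting hyperbolicity.
\<close>

lemma hyperbolic_expansivity_estimate:
  assumes hyp: "hyperbolic A g f \<Omega>" and L: "closed L" "L \<subseteq> \<Omega>"
  shows "\<exists>V \<eta> C. open V \<and> L \<subseteq> V \<and> 0 < \<eta> \<and> 0 < C \<and> (\<forall>j X p q \<beta>.
    pseudo_orbit V \<eta> j X \<and> (\<forall>i. norm (p i - X i) \<le> \<eta> \<and> norm (q i - X i) \<le> \<eta> \<and>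
      norm (defect j p i - defect j q i) \<le> \<beta>) \<longrightarrow> (\<forall>i. norm (p i - q i) \<le> C * \<beta>))"
proof (rule ccontr)
  assume contra: "\<not> ?thesis"
  have "compact L" using compact_M L by (metis closed_Int_compact inf_top.right_neutral)
  then obtain V where V: "\<And>n::nat. open (V n)" "\<And>n. L \<subseteq> V n" "decseq V"
    and Vlim: "\<And>x l. (\<And>n. x n \<in> V n) \<Longrightarrow> x \<longlonglongrightarrow> l \<Longrightarrow> l \<in> L"
    using closed_countable_neighbourhoods[OF L(1)] by metis
  define \<eta> where "\<eta> n = 1 / real (Suc n)" for n
  have \<eta>: "\<eta> n > 0" for n by (simp add: \<eta>_def)
  have "\<exists>j X p q. pseudo_orbit (V n) (\<eta> n) j X \<and> p 0 \<noteq> q 0 \<and> (\<forall>i. norm (p i - X i) \<le> \<eta> n \<and> norm (q i - X i) \<le> \<eta> n \<and>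
      norm (defect j p i - defect j q i) \<le> 2 * \<eta> n * norm (p 0 - q 0) \<and> norm (p i - q i) \<le> 2 * norm (p 0 - q 0))" for n
  proof -
    have "0 < real (Suc n)" by simp
    then obtain j X p q \<beta> i where jX: "pseudo_orbit (V n) (\<eta> n) j X"
      and pq: "\<And>i. norm (p i - X i) \<le> \<eta> n \<and> norm (q i - X i) \<le> \<eta> n \<and> norm (defect j p i - defect j q i) \<le> \<beta>"
      and big: "\<not> norm (p i - q i) \<le> real (Suc n) * \<beta>"
      using contra V(1)[of n] V(2)[of n] \<eta>[of n] by meson
    have \<beta>: "0 \<le> \<beta>" using pq[of 0] norm_ge_zero order_trans by blast
    have pos: "norm (p i - q i) > 0" using big \<beta> by (smt (verit) mult_nonneg_nonneg of_nat_0_le_iff)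
    have "norm (p i - q i) \<le> 2 * \<eta> n" for i
      using norm_triangle_ineq4[of "p i - X i" "q i - X i"] pq[of i] by simp
    then have "bdd_above (range (\<lambda>i. norm (p i - q i)))" by (auto simp: bdd_above_def)
    from ex_almost_maximal[OF this pos] obtain m where m: "0 < norm (p m - q m)"
      "\<And>i. norm (p i - q i) \<le> 2 * norm (p m - q m)" by auto
    have "real (Suc n) * \<beta> \<le> 2 * norm (p m - q m)" using big m(2)[of i] by linarith
    then have \<beta>_le: "\<beta> \<le> 2 * \<eta> n * norm (p m - q m)" by (simp add: \<eta>_def field_simps)
    have eq: "i + 1 + m = (i + m) + 1" for i :: int by simp
    have def_shift: "defect (\<lambda>i. j (i + m)) (\<lambda>i. s (i + m)) i = defect j s (i + m)" for s i
      unfolding defect_def eq by simp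
    show ?thesis
    proof (intro exI conjI allI)
      show "pseudo_orbit (V n) (\<eta> n) (\<lambda>i. j (i + m)) (\<lambda>i. X (i + m))" by (rule pseudo_orbit_shift[OF jX])
      show "(\<lambda>i. p (i + m)) 0 \<noteq> (\<lambda>i. q (i + m)) 0" using m(1) by auto
      fix i
      show "norm (defect (\<lambda>i. j (i + m)) (\<lambda>i. p (i + m)) i - defect (\<lambda>i. j (i + m)) (\<lambda>i. q (i + m)) i)
        \<le> 2 * \<eta> n * norm ((\<lambda>i. p (i + m)) 0 - (\<lambda>i. q (i + m)) 0)"
        unfolding def_shift using pq[of "i + m"] \<beta>_le by simp
    qed (use pq m(2) in auto)
  qed
  then obtain j X p q where jX: "\<And>n. pseudo_orbit (V n) (\<eta> n) (j n) (X n)"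
    and ne: "\<And>n. p n (0::int) \<noteq> q n 0"
    and pX: "\<And>n i. norm (p n i - X n i) \<le> \<eta> n" and qX: "\<And>n i. norm (q n i - X n i) \<le> \<eta> n"
    and dpq: "\<And>n i. norm (defect (j n) (p n) i - defect (j n) (q n) i) \<le> 2 * \<eta> n * norm (p n 0 - q n 0)"
    and pq: "\<And>n i. norm (p n i - q n i) \<le> 2 * norm (p n 0 - q n 0)"
    by metis
  define s where "s n = norm (p n 0 - q n 0)" for n
  have s: "s n > 0" for n using ne by (simp add: s_def)
  \<comment> \<open>The rescaled difference, which becomes the tangent orbit in the limit.\<close>
  define D where "D n i = (1 / s n) *\<^sub>R (p n i - q n i)" for n i
  have D2: "norm (D n i) \<le> 2" for n i using pq[of n i] s[of n] by (simp add: D_def s_def[symmetric] pos_divide_le_eq)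
  have step: "pseudo_step (\<eta> n) (j n i) (X n i) (j n (i + 1)) (X n (i + 1))"
    and XV: "pt (j n i) (X n i) \<in> V n" for n i using jX unfolding pseudo_orbit_def by auto
  have jJ: "j n i < J" "X n i \<in> K (j n i)" for n i
    using step[of n i] admissibleD unfolding pseudo_step_def by blast+
  have "compact ({..<J} \<times> KK \<times> cball (0::'e) 2)"
    by (intro compact_Times compact_KK finite_imp_compact compact_cball) auto
  moreover have "(j n i, X n i, D n i) \<in> {..<J} \<times> KK \<times> cball 0 2" for n i
    using jJ[of n i] D2[of n i] by (auto simp: KK_def)
  ultimately obtain l \<sigma> where \<sigma>: "strict_mono \<sigma>" and
    "\<forall>i. l i \<in> {..<J} \<times> KK \<times> cball 0 2 \<and> (\<lambda>n. (j (\<sigma> n) i, X (\<sigma> n) i, D (\<sigma> n) i)) \<longlonglongrightarrow> l i"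
    using seq_compact_product[of "\<lambda>_. {..<J} \<times> KK \<times> cball 0 2" "\<lambda>n i. (j n i, X n i, D n i)"] by blast
  then have l_in: "l i \<in> {..<J} \<times> KK \<times> cball 0 2"
    and lim: "(\<lambda>n. (j (\<sigma> n) i, X (\<sigma> n) i, D (\<sigma> n) i)) \<longlonglongrightarrow> l i" for i by auto
  define jl xl Dl where "jl i = fst (l i)" and "xl i = fst (snd (l i))" and "Dl i = snd (snd (l i))" for i
  have jl: "jl i < J" and Dl2: "norm (Dl i) \<le> 2" for i
    using l_in[of i] by (auto simp: jl_def Dl_def)
  have limX: "(\<lambda>n. X (\<sigma> n) i) \<longlonglongrightarrow> xl i" and limD: "(\<lambda>n. D (\<sigma> n) i) \<longlonglongrightarrow> Dl i" for i
    using tendsto_fst[OF tendsto_snd[OF lim[of i]]] tendsto_snd[OF tendsto_snd[OF lim[of i]]]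
    by (auto simp: xl_def Dl_def)
  have evj: "\<forall>\<^sub>F n in sequentially. j (\<sigma> n) i = jl i" for i
    using tendsto_fst[OF lim[of i]] by (simp add: tendsto_discrete jl_def)
  have \<eta>0: "(\<lambda>n. \<eta> (\<sigma> n)) \<longlonglongrightarrow> 0"
    using LIMSEQ_subseq_LIMSEQ[OF LIMSEQ_Suc[OF lim_1_over_n] \<sigma>] by (simp add: comp_def \<eta>_def)
  have ev_step: "\<forall>\<^sub>F n in sequentially. pseudo_step (\<eta> (\<sigma> n)) (jl i) (X (\<sigma> n) i) (jl (i + 1)) (X (\<sigma> n) (i + 1))" for i
    using evj[of i] evj[of "i + 1"] by eventually_elim (use step in metis)
  note limit = pseudo_step_limit[OF jl jl limX limX \<eta>0 ev_step]
  have in_L: "pt (jl i) (xl i) \<in> L" for i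
  proof (rule Vlim)
    show "pt (j (\<sigma> n) i) (X (\<sigma> n) i) \<in> V n" for n
      using XV[of "\<sigma> n"] decseqD[OF V(3) seq_suble[OF \<sigma>, of n]] by auto
    have "(\<lambda>n. pt (jl i) (X (\<sigma> n) i)) \<longlonglongrightarrow> pt (jl i) (xl i)"
      by (rule isCont_tendsto_compose[OF isCont_pt[OF jl limit(1)] limX])
    then show "(\<lambda>n. pt (j (\<sigma> n) i) (X (\<sigma> n) i)) \<longlonglongrightarrow> pt (jl i) (xl i)"
      by (rule Lim_transform_eventually) (use evj[of i] in \<open>eventually_elim, simp\<close>)
  qed
  have near: "\<forall>\<^sub>F n in sequentially. u (\<sigma> n) i \<in> ball (xl i) d"
    if u: "\<And>n i. norm (u n i - X n i) \<le> \<eta> n" and "0 < d" for u i d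
  proof -
    have "(\<lambda>n. u (\<sigma> n) i - X (\<sigma> n) i) \<longlonglongrightarrow> 0"
      by (rule Lim_null_comparison[OF _ \<eta>0]) (use u in auto)
    from tendsto_add[OF this limX[of i]] have "(\<lambda>n. u (\<sigma> n) i) \<longlonglongrightarrow> xl i" by simp
    from tendstoD[OF this \<open>0 < d\<close>] show ?thesis by (simp add: dist_commute)
  qed
  have Dl_step: "Dl (i + 1) = frechet_derivative (loc (jl i) (jl (i + 1))) (at (xl i)) (Dl i)" for i
  proof -
    let ?h = "loc (jl i) (jl (i + 1))"
    let ?T = "frechet_derivative ?h (at (xl i))"
    have dom: "f (pt (jl i) (xl i)) \<in> cdom (cc (jl (i + 1)))"
      using limit(3)[of i] pt_in[OF jl limit(2)[of i]] by simp
    have T: "(?h has_derivative ?T) (at (xl i))"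
      using local_rep_has_derivative[OF cc[OF jl] cc[OF jl] pt_in[OF jl limit(1)[of i]] dom]
      by (simp add: loc_def co_pt[OF jl limit(1)])
    interpret T: linear ?T using has_derivative_linear[OF T] .
    have small: "norm (Dl (i + 1) - ?T (Dl i)) \<le> e" if e: "0 < e" for e
    proof (rule tendsto_upperbound)
      have "(\<lambda>n. ?T (D (\<sigma> n) i)) \<longlonglongrightarrow> ?T (Dl i)"
        by (rule bounded_linear.tendsto[OF has_derivative_bounded_linear[OF T] limD])
      then show "(\<lambda>n. norm (D (\<sigma> n) (i + 1) - ?T (D (\<sigma> n) i))) \<longlonglongrightarrow> norm (Dl (i + 1) - ?T (Dl i))"
        by (intro tendsto_intros limD)
      obtain d where d: "0 < d" "\<And>p q. p \<in> ball (xl i) d \<Longrightarrow> q \<in> ball (xl i) d \<Longrightarrow>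
          norm (?h p - ?h q - ?T (p - q)) \<le> e / 4 * norm (p - q)"
        using loc_strictly_differentiable[OF jl jl limit(1)[of i] dom, of "e / 4"] e by auto
      have "\<forall>\<^sub>F n in sequentially. \<eta> (\<sigma> n) < e / 4"
        using tendstoD[OF \<eta>0, of "e / 4"] e \<eta> by (simp add: abs_of_pos)
      with near[of p d i, OF pX d(1)] near[of q d i, OF qX d(1)] evj[of i] evj[of "i + 1"]
      show "\<forall>\<^sub>F n in sequentially. norm (D (\<sigma> n) (i + 1) - ?T (D (\<sigma> n) i)) \<le> e"
      proof eventually_elim
        case (elim n)
        let ?n = "\<sigma> n"
        let ?a = "defect (j ?n) (p ?n) i - defect (j ?n) (q ?n) i"
        let ?b = "?h (p ?n i) - ?h (q ?n i) - ?T (p ?n i - q ?n i)"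
        have "norm ?b \<le> e / 4 * norm (p ?n i - q ?n i)" by (rule d(2)[OF elim(1,2)])
        also have "\<dots> \<le> e / 4 * (2 * s ?n)" using e pq[of ?n i] by (intro mult_left_mono) (auto simp: s_def)
        finally have b: "norm ?b \<le> e / 2 * s ?n" by simp
        have "norm ?a \<le> 2 * \<eta> ?n * s ?n" using dpq[of ?n i] by (simp add: s_def)
        also have "\<dots> \<le> 2 * (e / 4) * s ?n" using elim(5) s[of ?n] by (intro mult_right_mono mult_left_mono) auto
        finally have a: "norm ?a \<le> e / 2 * s ?n" by simp
        have split: "p ?n (i + 1) - q ?n (i + 1) - ?T (p ?n i - q ?n i) = ?a + ?b"
          using elim(3,4) by (simp add: defect_def algebra_simps)
        have "norm (p ?n (i + 1) - q ?n (i + 1) - ?T (p ?n i - q ?n i)) \<le> e * s ?n"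
          unfolding split using norm_triangle_ineq[of ?a ?b] a b by linarith
        moreover have D_eq: "D ?n (i + 1) - ?T (D ?n i) = (1 / s ?n) *\<^sub>R (p ?n (i + 1) - q ?n (i + 1) - ?T (p ?n i - q ?n i))"
          unfolding D_def T.scale by (simp only: scaleR_diff_right)
        ultimately show ?case unfolding D_eq using s[of ?n] by (simp add: pos_divide_le_eq)
      qed
    qed simp
    have "norm (Dl (i + 1) - ?T (Dl i)) \<le> 0" by (rule field_le_epsilon) (use small in simp)
    then show ?thesis by simp
  qed
  have "Dl 0 = 0"
    by (rule bounded_tangent_orbit_in_charts_zero[where j = jl and x = xl and D = Dl, OF hyp jl limit(1) limit(3) _ Dl_step Dl2])
      (use in_L L(2) in blast)
  moreover have "norm (D n 0) = 1" for n using s[of n] by (simp add: D_def s_def)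
  then have "norm (Dl 0) = 1" using tendsto_norm[OF limD[of 0]] by (simp add: LIMSEQ_const_iff)
  ultimately show False by simp
qed

end

section \<open>Closing up a cyclic chain of maps\<close>

text \<open>
  The forcing interpolates: if \<open>d\<close> are the jumps of a pseudo-orbit, then the chain follows that pseudo-orbit
  for the parameter \<open>s = 0\<close>, and it is an orbit of the maps \<open>h\<close> for \<open>s = 1\<close>. The argument \<open>z\<close> is the pair of
  the parameter and the starting point.
\<close>

primrec forced_chain :: "(nat \<Rightarrow> 'e \<Rightarrow> 'e) \<Rightarrow> (nat \<Rightarrow> 'e) \<Rightarrow> nat \<Rightarrow> real \<times> 'e::real_vector \<Rightarrow> 'e" where
  "forced_chain h d 0 z = snd z"
| "forced_chain h d (Suc i) z = h i (forced_chain h d i z) + (1 - fst z) *\<^sub>R d i"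

text \<open>
  A continuity method. Let \<open>d\<^bsub>i\<^esub>\<close> be the jumps of the cyclic pseudo-orbit \<open>X\<close>. For \<open>s = 0\<close> the chain forced
  by \<open>(1 - s) d\<^bsub>i\<^esub>\<close> closes up, namely with \<open>X\<close>; a solution is wanted for \<open>s = 1\<close>. Solutions correspond to
  points \<open>(s, u)\<close> with \<open>\<Phi>(s, u) = (s, 0)\<close>, where \<open>\<Phi>\<close> records \<open>s\<close> and the failure of the chain to close up.
  The estimate makes \<open>\<Phi>\<close> injective, so its image is open by invariance of domain, which needs just one
  copy of the space \<open>'e\<close> whatever the length \<open>N\<close> is. The estimate also keeps the solutions a fixed
  distance away from the boundary of the \<open>\<eta>\<close>-balls, so the set of good \<open>s\<close> is closed.
\<close>

lemma cyclic_chain_solvable: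
  fixes h :: "nat \<Rightarrow> 'e::euclidean_space \<Rightarrow> 'e" and X :: "nat \<Rightarrow> 'e"
  assumes N: "0 < N" and \<eta>: "0 < \<eta>" "C * \<delta> < \<eta>"
    and cont: "\<And>i v. i < N \<Longrightarrow> norm (v - X i) \<le> \<eta> \<Longrightarrow> isCont (h i) v"
    and small: "\<And>i. i < N \<Longrightarrow> norm (X (Suc i mod N) - h i (X i)) \<le> \<delta>"
    and estimate: "\<And>p q \<beta>. (\<And>i. i < N \<Longrightarrow> norm (p i - X i) \<le> \<eta> \<and> norm (q i - X i) \<le> \<eta> \<and>
        norm ((p (Suc i mod N) - h i (p i)) - (q (Suc i mod N) - h i (q i))) \<le> \<beta>) \<Longrightarrow>
        (\<And>i. i < N \<Longrightarrow> norm (p i - q i) \<le> C * \<beta>)"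
  shows "\<exists>v. \<forall>i<N. norm (v i - X i) \<le> \<eta> \<and> v (Suc i mod N) = h i (v i)"
proof -
  define d where "d i = X (Suc i mod N) - h i (X i)" for i
  define R where "R = forced_chain h d"
  have R0: "R 0 z = snd z" and RS: "R (Suc i) z = h i (R i z) + (1 - fst z) *\<^sub>R d i" for i z
    by (auto simp: R_def)
  define Dom where "Dom n = {z. \<forall>i<n. R i z \<in> ball (X i) \<eta>}" for n
  have Dom: "open (Dom n) \<and> continuous_on (Dom n) (R n)" if "n \<le> N" for n
    using that
  proof (induction n)
    case 0
    have "R 0 = snd" using R0 by auto
    then show ?case by (auto simp: Dom_def intro!: continuous_intros)
  next
    case (Suc n)
    have Dom_Suc: "Dom (Suc n) = Dom n \<inter> R n -` ball (X n) \<eta>"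
      by (auto simp: Dom_def less_Suc_eq)
    have h: "continuous_on (ball (X n) \<eta>) (h n)"
      using cont[of n] Suc.prems
      by (intro continuous_at_imp_continuous_on) (auto simp: dist_norm norm_minus_commute)
    have Rn: "continuous_on (Dom (Suc n)) (R n)"
      by (rule continuous_on_subset[of "Dom n"]) (use Suc in \<open>auto simp: Dom_Suc\<close>)
    have "continuous_on (Dom (Suc n)) (\<lambda>z. h n (R n z))"
      by (rule continuous_on_compose2[OF h Rn]) (auto simp: Dom_Suc)
    then have "continuous_on (Dom (Suc n)) (\<lambda>z. h n (R n z) + (1 - fst z) *\<^sub>R d n)"
      by (intro continuous_intros)
    moreover have "R (Suc n) = (\<lambda>z. h n (R n z) + (1 - fst z) *\<^sub>R d n)" using RS by auto
    moreover have "open (Dom (Suc n))"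
      unfolding Dom_Suc using Suc by (intro continuous_open_preimage) auto
    ultimately show ?case by simp
  qed
  define \<Phi> where "\<Phi> z = (fst z, R N z - snd z)" for z
  have defect: "(if Suc i = N then snd z else R (Suc i) z) - h i (R i z) =
      (if Suc i = N then snd z - R N z else 0) + (1 - fst z) *\<^sub>R d i" if "i < N" for i z
    using RS[of i z] by auto
  have Suc_mod: "R (Suc i mod N) z = (if Suc i = N then snd z else R (Suc i) z)" if "i < N" for i z
    using that R0 by auto
  have close: "norm (R i z - X i) \<le> \<eta>" if "z \<in> Dom N" "i < N" for z i
    using that by (auto simp: Dom_def dist_norm norm_minus_commute intro: less_imp_le)
  have "inj_on \<Phi> (Dom N)"
  proof (rule inj_onI)
    fix z z' assume z: "z \<in> Dom N" "z' \<in> Dom N" "\<Phi> z = \<Phi> z'"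
    have "norm (R i z - R i z') \<le> C * 0" if "i < N" for i
    proof (rule estimate[OF _ that])
      fix i assume "i < N"
      moreover have "fst z = fst z'" "snd z - R N z = snd z' - R N z'"
        using z(3) by (auto simp: \<Phi>_def algebra_simps)
      ultimately show "norm (R i z - X i) \<le> \<eta> \<and> norm (R i z' - X i) \<le> \<eta> \<and>
        norm ((R (Suc i mod N) z - h i (R i z)) - (R (Suc i mod N) z' - h i (R i z'))) \<le> 0"
        using close z(1,2) Suc_mod[of i] defect[of i] by simp
    qed
    from this[OF N] show "z = z'" using z(3) by (simp add: R0 \<Phi>_def prod_eq_iff)
  qed
  moreover have "continuous_on (Dom N) \<Phi>"
    unfolding \<Phi>_def using Dom[of N] by (intro continuous_intros) auto
  ultimately have open_image: "open (\<Phi> ` Dom N)"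
    using Dom[of N] by (intro invariance_of_domain_gen) auto
  define T where "T = {s \<in> {0..1}. (s, 0) \<in> \<Phi> ` Dom N}"
  have "open ((\<lambda>s::real. (s, 0::'e)) -` (\<Phi> ` Dom N))"
    by (intro open_vimage open_image continuous_intros)
  moreover have "T = {0..1} \<inter> (\<lambda>s::real. (s, 0::'e)) -` (\<Phi> ` Dom N)" by (auto simp: T_def)
  ultimately have "openin (top_of_set {0..1}) T" by (metis openin_open_Int)
  moreover have "closed T"
    unfolding closed_sequential_limits
  proof (intro allI impI, elim conjE)
    fix x s assume xT: "\<forall>n. x n \<in> T" and xs: "x \<longlonglongrightarrow> s"
    have x01: "x n \<in> {0..1}" and x_im: "(x n, 0) \<in> \<Phi> ` Dom N" for n
      using xT by (simp_all add: T_def)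
    have "\<exists>z. z \<in> Dom N \<and> \<Phi> z = (x n, 0)" for n
      using x_im[of n] by (rule imageE) metis
    then obtain z where z: "\<And>n. z n \<in> Dom N" "\<And>n. \<Phi> (z n) = (x n, 0)" by metis
    have fz: "fst (z n) = x n" and sz: "R N (z n) = snd (z n)" for n
      using z(2)[of n] by (auto simp: \<Phi>_def)
    \<comment> \<open>A closed chain for the parameter \<open>s\<close> differs from \<open>X\<close> in its defects by \<open>s d\<close> only.\<close>
    have near: "norm (R i (z n) - X i) \<le> C * \<delta>" if "i < N" for i n
    proof (rule estimate[OF _ that])
      fix i assume i: "i < N"
      have "(R (Suc i mod N) (z n) - h i (R i (z n))) - (X (Suc i mod N) - h i (X i)) = - (x n *\<^sub>R d i)"
        unfolding Suc_mod[OF i] defect[OF i] by (simp add: sz fz d_def[symmetric] algebra_simps)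
      moreover have "norm (- (x n *\<^sub>R d i)) \<le> 1 * \<delta>"
        using x01[of n] small[OF i] unfolding norm_minus_cancel norm_scaleR d_def[symmetric]
        by (intro mult_mono) auto
      moreover have "0 \<le> \<eta>" using close[OF z(1) N] norm_ge_zero order_trans by blast
      ultimately show "norm (R i (z n) - X i) \<le> \<eta> \<and> norm (X i - X i) \<le> \<eta> \<and>
        norm ((R (Suc i mod N) (z n) - h i (R i (z n))) - (X (Suc i mod N) - h i (X i))) \<le> \<delta>"
        using close[OF z(1) i] by simp
    qed
    have in_ball: "snd (z n) \<in> cball (X 0) (C * \<delta>)" for n
      using near[OF N, of n] by (simp add: R0 dist_norm norm_minus_commute)
    obtain u \<sigma> where "u \<in> cball (X 0) (C * \<delta>)" and \<sigma>: "strict_mono \<sigma>" and "((\<lambda>n. snd (z n)) \<circ> \<sigma>) \<longlonglongrightarrow> u"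
      by (rule seq_compactE[OF compact_imp_seq_compact[OF compact_cball] allI[OF in_ball]]) (rule that)
    then have u: "(\<lambda>n. snd (z (\<sigma> n))) \<longlonglongrightarrow> u" by (simp add: comp_def)
    have xs': "(\<lambda>n. x (\<sigma> n)) \<longlonglongrightarrow> s" using LIMSEQ_subseq_LIMSEQ[OF xs \<sigma>] by (simp add: comp_def)
    have lim: "(\<lambda>n. R i (z (\<sigma> n))) \<longlonglongrightarrow> R i (s, u)" if "i \<le> N" for i
      using that
    proof (induction i)
      case 0
      then show ?case using u by (simp add: R0)
    next
      case (Suc i)
      then have l: "(\<lambda>n. R i (z (\<sigma> n))) \<longlonglongrightarrow> R i (s, u)" and i: "i < N" by auto
      have "norm (R i (s, u) - X i) \<le> C * \<delta>"
        by (rule Lim_norm_ubound[OF _ tendsto_diff[OF l tendsto_const]]) (use near i in auto)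
      then have "isCont (h i) (R i (s, u))" using cont[OF i] \<eta> by auto
      then show ?case
        unfolding RS fz fst_conv by (intro tendsto_intros isCont_tendsto_compose[of _ "h i"] l xs')
    qed
    have "norm (R i (s, u) - X i) \<le> C * \<delta>" if "i < N" for i
      by (rule Lim_norm_ubound[OF _ tendsto_diff[OF lim tendsto_const]]) (use near that in auto)
    then have "(s, u) \<in> Dom N" using \<eta>(2) by (fastforce simp: Dom_def dist_norm norm_minus_commute)
    moreover have "R N (s, u) = u"
      using LIMSEQ_unique[OF lim[of N]] u by (simp add: sz)
    then have "\<Phi> (s, u) = (s, 0)" by (simp add: \<Phi>_def)
    moreover have "s \<in> {0..1}" by (rule closed_sequentially[OF closed_atLeastAtMost _ xs]) (use x01 in auto)
    ultimately show "s \<in> T" unfolding T_def by (auto simp: image_iff intro!: bexI[of _ "(s, u)"])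
  qed
  then have "closedin (top_of_set {0..1}) T" by (intro closed_subset) (auto simp: T_def)
  moreover have "0 \<in> T"
  proof -
    have Ri: "i < N \<longrightarrow> R i (0, X 0) = X i" for i
    proof (induction i)
      case (Suc i)
      then show ?case by (auto simp: RS d_def)
    qed (simp add: R0)
    have "R (Suc (N - 1)) (0, X 0) = X (Suc (N - 1) mod N)"
      using Ri[of "N - 1"] N by (simp only: RS) (simp add: d_def)
    then have "\<Phi> (0, X 0) = (0, 0)" using N by (simp add: \<Phi>_def)
    moreover have "(0, X 0) \<in> Dom N" using Ri \<eta> by (auto simp: Dom_def)
    ultimately show ?thesis unfolding T_def by (auto simp: image_iff intro!: bexI[of _ "(0, X 0)"])
  qed
  ultimately have "T = {0..1}"
    using connected_clopen[of "{0..1::real}"] connected_Icc[of 0 "1::real"] by blast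
  then have "1 \<in> T" by simp
  then obtain z where z: "z \<in> Dom N" "\<Phi> z = (1, 0)" unfolding T_def by (metis (lifting) imageE mem_Collect_eq)
  have "fst z = 1" "R N z = snd z" using z(2) by (auto simp: \<Phi>_def)
  then have "norm (R i z - X i) \<le> \<eta> \<and> R (Suc i mod N) z = h i (R i z)" if "i < N" for i
    using close[OF z(1) that] Suc_mod[OF that, of z] defect[OF that, of z] by auto
  then show ?thesis by (intro exI[of _ "\<lambda>i. R i z"]) auto
qed

section \<open>Periodic shadowing\<close>

context finite_atlas_map
begin

definition cyclic_pseudo_orbit :: "'m set \<Rightarrow> real \<Rightarrow> nat \<Rightarrow> (nat \<Rightarrow> nat) \<Rightarrow> (nat \<Rightarrow> 'e) \<Rightarrow> bool" where
  "cyclic_pseudo_orbit V \<delta> N j X \<longleftrightarrow> (\<forall>i<N. pt (j i) (X i) \<in> V \<and>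
     pseudo_step \<delta> (j i) (X i) (j (Suc i mod N)) (X (Suc i mod N)))"

text \<open>
  The expansivity estimate supplies the uniqueness required in \<open>cyclic_chain_solvable\<close>. Taking the radius \<open>\<eta>\<close> and the
  jumps \<open>\<delta>\<close> small in comparison makes all coordinate expressions defined and continuous.
\<close>

lemma periodic_shadowing:
  assumes hyp: "hyperbolic A g f \<Omega>" and L: "closed L" "L \<subseteq> \<Omega>"
    and V0: "open V0" "L \<subseteq> V0" and \<epsilon>: "0 < \<epsilon>"
  shows "\<exists>V \<delta>. open V \<and> L \<subseteq> V \<and> 0 < \<delta> \<and> (\<forall>j X N. 0 < N \<and> cyclic_pseudo_orbit V \<delta> N j X \<longrightarrow>
    (\<exists>v. \<forall>i<N. norm (v i - X i) \<le> \<epsilon> \<and> pt (j i) (v i) \<in> V0 \<and>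
      f (pt (j i) (v i)) = pt (j (Suc i mod N)) (v (Suc i mod N))))"
proof -
  obtain V1 \<eta>1 C where V1: "open V1" "L \<subseteq> V1" "0 < \<eta>1" "0 < C"
    and expansive: "\<And>j X p q \<beta> i. pseudo_orbit V1 \<eta>1 j X \<Longrightarrow> (\<And>i. norm (p i - X i) \<le> \<eta>1 \<and>
      norm (q i - X i) \<le> \<eta>1 \<and> norm (defect j p i - defect j q i) \<le> \<beta>) \<Longrightarrow> norm (p i - q i) \<le> C * \<beta>"
    using hyperbolic_expansivity_estimate[OF hyp L] by metis
  obtain V2 \<eta>2 where V2: "open V2" "L \<subseteq> V2" "0 < \<eta>2"
    and dom: "\<And>j X k Y v. pseudo_step \<eta>2 j X k Y \<Longrightarrow> pt j X \<in> V2 \<Longrightarrow> norm (v - X) \<le> \<eta>2 \<Longrightarrow>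
      f (pt j v) \<in> cdom (cc k) \<and> pt j v \<in> V0"
    using pseudo_step_uniform_domain[OF L(1) V0] by metis
  define \<eta> where "\<eta> = min (min \<eta>1 \<eta>2) (min \<epsilon> \<rho>)"
  have \<eta>: "0 < \<eta>" "\<eta> \<le> \<eta>1" "\<eta> \<le> \<eta>2" "\<eta> \<le> \<epsilon>" "\<eta> \<le> \<rho>" using V1 V2 \<epsilon> \<rho> by (auto simp: \<eta>_def)
  define \<delta> where "\<delta> = min \<eta> (\<eta> / (2 * C))"
  have \<delta>: "0 < \<delta>" "\<delta> \<le> \<eta>" using \<eta> V1 by (auto simp: \<delta>_def)
  have "C * \<delta> \<le> C * (\<eta> / (2 * C))" using V1(4) by (intro mult_left_mono) (auto simp: \<delta>_def)
  also have "\<dots> < \<eta>" using V1(4) \<eta>(1) by (simp add: field_simps)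
  finally have C\<delta>: "C * \<delta> < \<eta>" .
  have mono: "pseudo_step e j X k Y" if "pseudo_step \<delta> j X k Y" "\<delta> \<le> e" for e j X k Y
    using that unfolding pseudo_step_def by auto
  have "\<exists>v. \<forall>i<N. norm (v i - X i) \<le> \<epsilon> \<and> pt (j i) (v i) \<in> V0 \<and>
      f (pt (j i) (v i)) = pt (j (Suc i mod N)) (v (Suc i mod N))"
    if N: "0 < N" and orbit: "cyclic_pseudo_orbit (V1 \<inter> V2) \<delta> N j X" for j X N
  proof -
    let ?s = "\<lambda>i. Suc i mod N"
    have sN: "?s i < N" for i using N by simp
    have V: "pt (j i) (X i) \<in> V1" "pt (j i) (X i) \<in> V2"
      and step: "pseudo_step \<delta> (j i) (X i) (j (?s i)) (X (?s i))" if "i < N" for i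
      using orbit that unfolding cyclic_pseudo_orbit_def by auto
    have jJ: "j i < J" if "i < N" for i using step[OF that] admissibleD unfolding pseudo_step_def by blast
    have vK: "v \<in> K (j i)" if "i < N" "norm (v - X i) \<le> \<eta>" for i v
      using step[OF that(1)] admissibleD(2)[of "j i" "X i" v] that(2) \<eta>(5) unfolding pseudo_step_def by auto
    have v_dom: "f (pt (j i) v) \<in> cdom (cc (j (?s i)))" "pt (j i) v \<in> V0" if "i < N" "norm (v - X i) \<le> \<eta>" for i v
      using dom[OF mono[OF step[OF that(1)]] V(2)[OF that(1)], of v] that(2) \<eta>(3) \<delta>(2) by auto
    define h where "h i = loc (j i) (j (?s i))" for i
    \<comment> \<open>The expansivity estimate concerns bi-infinite sequences; it is applied to periodic extensions.\<close>
    define per :: "int \<Rightarrow> nat" where "per i = nat (i mod int N)" for i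
    have per_lt: "per i < N" for i using N by (simp add: per_def nat_less_iff)
    have per_Suc: "per (i + 1) = ?s (per i)" for i
    proof -
      have "int (per (i + 1)) = (i + 1) mod int N" using N by (simp add: per_def)
      also have "\<dots> = (i mod int N + 1) mod int N" by (simp add: mod_add_left_eq)
      also have "\<dots> = int (?s (per i))" using N by (simp add: per_def zmod_int add.commute)
      finally show ?thesis by simp
    qed
    have per_id: "per (int i) = i" if "i < N" for i using that by (simp add: per_def)
    have per_orbit: "pseudo_orbit V1 \<eta>1 (\<lambda>i. j (per i)) (\<lambda>i. X (per i))"
      unfolding pseudo_orbit_def per_Suc
      using V(1)[OF per_lt] mono[OF step[OF per_lt]] \<delta>(2) \<eta>(2) by auto
    have "\<exists>v. \<forall>i<N. norm (v i - X i) \<le> \<eta> \<and> v (?s i) = h i (v i)"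
    proof (rule cyclic_chain_solvable[OF N \<eta>(1) C\<delta>])
      show "isCont (h i) v" if "i < N" "norm (v - X i) \<le> \<eta>" for i v
        unfolding h_def by (rule isCont_loc) (use that jJ sN vK v_dom in auto)
      show "norm (X (?s i) - h i (X i)) \<le> \<delta>" if "i < N" for i
        using step[OF that] by (simp add: h_def pseudo_step_def norm_minus_commute)
      show "norm (p i - q i) \<le> C * \<beta>"
        if pq: "\<And>i. i < N \<Longrightarrow> norm (p i - X i) \<le> \<eta> \<and> norm (q i - X i) \<le> \<eta> \<and>
          norm ((p (?s i) - h i (p i)) - (q (?s i) - h i (q i))) \<le> \<beta>" and i: "i < N" for p q \<beta> i
      proof -
        have "norm (p (per (int i)) - q (per (int i))) \<le> C * \<beta>"
        proof (rule expansive[OF per_orbit])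
          fix i
          show "norm (p (per i) - X (per i)) \<le> \<eta>1 \<and> norm (q (per i) - X (per i)) \<le> \<eta>1 \<and>
            norm (defect (\<lambda>i. j (per i)) (\<lambda>i. p (per i)) i - defect (\<lambda>i. j (per i)) (\<lambda>i. q (per i)) i) \<le> \<beta>"
            using pq[OF per_lt, of i] \<eta>(2) unfolding defect_def per_Suc h_def by auto
        qed
        then show ?thesis by (simp add: per_id[OF i])
      qed
    qed
    then obtain v where v: "\<And>i. i < N \<Longrightarrow> norm (v i - X i) \<le> \<eta>" "\<And>i. i < N \<Longrightarrow> v (?s i) = h i (v i)"
      by blast
    have "f (pt (j i) (v i)) = pt (j (?s i)) (v (?s i))" if "i < N" for i
      using v_dom(1)[OF that v(1)[OF that]] jJ[OF sN] unfolding v(2)[OF that] h_def loc_def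
      by (simp add: param_coord[OF cc])
    then show ?thesis using v(1) v_dom(2) \<eta>(4) by (intro exI[of _ v]) fastforce
  qed
  moreover have "open (V1 \<inter> V2)" "L \<subseteq> V1 \<inter> V2" using V1 V2 by auto
  ultimately show ?thesis using \<delta>(1) by (intro exI[of _ "V1 \<inter> V2"] exI[of _ \<delta>]) blast
qed

text \<open>
  Two points close to \<open>x\<close> are close in every chart that contains one of them in its compact core,
  because a core that does not contain \<open>x\<close> stays away from it.
\<close>

lemma chart_uniform_neighbourhood:
  assumes "0 < \<delta>"
  shows "\<exists>W. open W \<and> x \<in> W \<and> (\<forall>j X b. j < J \<and> X \<in> K j \<and> pt j X \<in> W \<and> b \<in> W \<longrightarrow>
    b \<in> cdom (cc j) \<and> norm (co j b - X) \<le> \<delta>)"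
proof -
  define W where "W j = (if x \<in> pt j ` K j then cdom (cc j) \<inter> co j -` ball (co j x) (\<delta> / 2) else - (pt j ` K j))" for j
  have cl: "closed (pt j ` K j)" if "j < J" for j
    by (intro compact_imp_closed compact_continuous_image K(1)[OF that]
        continuous_on_subset[OF continuous_param[OF cc[OF that]] K(2)[OF that]])
  have open_W: "open (W j)" if "j < J" for j
    using cl[OF that] cc[OF that] unfolding W_def
    by (auto intro!: continuous_open_preimage continuous_coord open_cdom open_ball)
  have x_W: "x \<in> W j" if "j < J" for j
    using that assms pt_in by (auto simp: W_def)
  have "b \<in> cdom (cc j) \<and> norm (co j b - X) \<le> \<delta>"
    if "j < J" "X \<in> K j" "pt j X \<in> W j" "b \<in> W j" for j X b
  proof -
    have W_eq: "W j = cdom (cc j) \<inter> co j -` ball (co j x) (\<delta> / 2)"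
      using that(2,3) by (auto simp: W_def split: if_splits)
    have "dist (co j x) X < \<delta> / 2" using that(3) co_pt[OF that(1,2)] unfolding W_eq by auto
    moreover have "dist (co j x) (co j b) < \<delta> / 2" using that(4) unfolding W_eq by auto
    ultimately have "dist (co j b) X < \<delta>" using dist_triangle3[of "co j b" X "co j x"] by linarith
    then show ?thesis using that(4) unfolding W_eq by (auto simp: dist_norm)
  qed
  then show ?thesis
    using open_W x_W by (intro exI[of _ "\<Inter>j<J. W j"]) (auto intro!: open_INT)
qed

lemma exact_pseudo_step:
  assumes "admissible j X" "admissible k Y" "f (pt j X) = pt k Y" "0 \<le> \<delta>"
  shows "pseudo_step \<delta> j X k Y"
  using assms pt_in[OF admissibleD(1,3)[OF assms(2)]] co_pt[OF admissibleD(1,3)[OF assms(2)]]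
  by (simp add: pseudo_step_def loc_def)

lemma cyclic_iterate:
  assumes "\<And>i. i < N \<Longrightarrow> f (w i) = w (Suc i mod N)" "i < N"
  shows "(f ^^ m) (w i) = w ((i + m) mod N)"
proof (induction m)
  case (Suc m)
  have "(i + m) mod N < N" using assms(2) by (intro mod_less_divisor) auto
  then show ?case using Suc assms(1)[of "(i + m) mod N"] by (simp add: mod_Suc_eq)
qed (use assms in auto)

text \<open>
  Transitivity may be witnessed by the time \<open>0\<close>, which would give an empty connecting segment.
  Moving the target one step back excludes this.
\<close>

lemma transitive_on_ge1:
  assumes trans: "transitive_on f L" and fL: "f ` L = L"
    and "open U" "open W" "U \<inter> L \<noteq> {}" "W \<inter> L \<noteq> {}"
  shows "\<exists>q l. 1 \<le> l \<and> q \<in> U \<inter> L \<and> (f ^^ l) q \<in> W"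
proof -
  have "open (f -` W)" using assms(4) continuous_f by (simp add: open_vimage)
  moreover have "f -` W \<inter> L \<noteq> {}"
  proof -
    obtain w where w: "w \<in> W" "w \<in> L" using assms(6) by blast
    then have "w \<in> f ` L" using fL by simp
    then obtain x where "x \<in> L" "w = f x" by (rule imageE)
    then show ?thesis using w by auto
  qed
  ultimately obtain n where "(f ^^ n) ` (U \<inter> L) \<inter> f -` W \<noteq> {}"
    using trans assms(3,5) unfolding transitive_on_def by blast
  then obtain q where "q \<in> U \<inter> L" "f ((f ^^ n) q) \<in> W" by auto
  then show ?thesis by (intro exI[of _ q] exI[of _ "Suc n"]) auto
qed

text \<open>
  The segment \<open>a\<^bsub>n+1\<^esub>, \<dots>, a\<^bsub>1\<^esub>\<close> is followed by a segment in \<open>L\<close> that leads from a point near \<open>a\<^bsub>0\<^esub>\<close> to a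
  point near \<open>a\<^bsub>n+1\<^esub>\<close>. The result is cyclic and jumps only at the two junctions. The periodic orbit that
  shadows it lies in \<open>\<Omega>\<close> and in \<open>V0\<close>, hence in \<open>L\<close>.
\<close>

lemma backward_segment_shadowed:
  assumes hyp: "hyperbolic A g f \<Omega>" and L: "closed L" "L \<subseteq> \<Omega>" "f ` L = L" "transitive_on f L"
    and per: "periodic_points f \<subseteq> \<Omega>" and V0: "open V0" "L \<subseteq> V0" "V0 \<inter> \<Omega> \<subseteq> L" and \<epsilon>: "0 < \<epsilon>"
  shows "\<exists>V. open V \<and> L \<subseteq> V \<and> (\<forall>a j Y n. (\<forall>k. a k \<in> V \<and> f (a (Suc k)) = a k) \<and>
     (\<forall>k. admissible (j k) (Y k) \<and> pt (j k) (Y k) = a (Suc k)) \<longrightarrow>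
     (\<exists>v. \<forall>k\<le>n. norm (v k - Y k) \<le> \<epsilon> \<and> pt (j k) (v k) \<in> L \<and>
        (k < n \<longrightarrow> f (pt (j (Suc k)) (v (Suc k))) = pt (j k) (v k))))"
proof -
  obtain V1 \<delta> where V1: "open V1" "L \<subseteq> V1" and \<delta>: "0 < \<delta>"
    and shadow: "\<And>j X N. 0 < N \<Longrightarrow> cyclic_pseudo_orbit V1 \<delta> N j X \<Longrightarrow>
    (\<exists>v. \<forall>i<N. norm (v i - X i) \<le> \<epsilon> \<and> pt (j i) (v i) \<in> V0 \<and>
      f (pt (j i) (v i)) = pt (j (Suc i mod N)) (v (Suc i mod N)))"
    using periodic_shadowing[OF hyp L(1,2) V0(1,2) \<epsilon>] by metis
  obtain W where W: "\<And>x. open (W x)" "\<And>x. x \<in> W x"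
    and W_near: "\<And>x j X b. j < J \<Longrightarrow> X \<in> K j \<Longrightarrow> pt j X \<in> W x \<Longrightarrow> b \<in> W x \<Longrightarrow>
      b \<in> cdom (cc j) \<and> norm (co j b - X) \<le> \<delta>"
    using chart_uniform_neighbourhood[OF \<delta>] by metis
  obtain \<kappa> \<xi> where \<kappa>: "\<And>x. admissible (\<kappa> x) (\<xi> x)" "\<And>x. pt (\<kappa> x) (\<xi> x) = x"
    using ex_admissible by metis
  have W_step: "pseudo_step \<delta> j X k Y"
    if "admissible j X" "admissible k Y" "f (pt j X) \<in> W x" "pt k Y \<in> W x" for j X k Y x
    using W_near[OF admissibleD(1,3)[OF that(2)] that(4,3)] that(1,2) by (simp add: pseudo_step_def loc_def)
  define V where "V = V1 \<inter> (\<Union>x\<in>L. W x)"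
  have open_V: "open V" unfolding V_def using V1(1) W(1) by (intro open_Int open_UN) auto
  have LV: "L \<subseteq> V" using V1(2) W(2) by (auto simp: V_def)
  have main: "\<exists>v. \<forall>k\<le>n. norm (v k - Y k) \<le> \<epsilon> \<and> pt (j k) (v k) \<in> L \<and>
        (k < n \<longrightarrow> f (pt (j (Suc k)) (v (Suc k))) = pt (j k) (v k))"
    if a: "\<And>k. a k \<in> V" "\<And>k. f (a (Suc k)) = a k"
      and Y: "\<And>k. admissible (j k) (Y k)" "\<And>k. pt (j k) (Y k) = a (Suc k)" for a j Y n
  proof -
    obtain x x' where x: "x \<in> L" "a 0 \<in> W x" and x': "x' \<in> L" "a (Suc n) \<in> W x'"
      using a(1)[of 0] a(1)[of "Suc n"] by (auto simp: V_def)
    obtain q l where l: "1 \<le> l" and q: "q \<in> L" "q \<in> W x" "(f ^^ l) q \<in> W x'"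
      using transitive_on_ge1[OF L(4,3) W(1)[of x] W(1)[of x']] x(1) x'(1) W(2) by blast
    have fq: "(f ^^ i) q \<in> L" for i
      using q(1) L(3) by (induction i) auto
    define N where "N = Suc n + l"
    define jj where "jj i = (if i \<le> n then j (n - i) else \<kappa> ((f ^^ (i - Suc n)) q))" for i
    define X where "X i = (if i \<le> n then Y (n - i) else \<xi> ((f ^^ (i - Suc n)) q))" for i
    have adm: "admissible (jj i) (X i)" for i using Y(1) \<kappa>(1) by (auto simp: jj_def X_def)
    have pt1: "pt (jj i) (X i) = a (Suc n - i)" if "i \<le> n" for i
      using that Y(2)[of "n - i"] by (simp add: jj_def X_def Suc_diff_le)
    have pt2: "pt (jj i) (X i) = (f ^^ (i - Suc n)) q" if "n < i" for i
      using that \<kappa>(2) by (simp add: jj_def X_def)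
    have "cyclic_pseudo_orbit V1 \<delta> N jj X"
      unfolding cyclic_pseudo_orbit_def
    proof (intro allI impI conjI)
      fix i assume i: "i < N"
      show "pt (jj i) (X i) \<in> V1"
        using pt1[of i] pt2[of i] a(1)[of "Suc n - i"] fq[of "i - Suc n"] V1(2)
        by (cases "i \<le> n") (auto simp: V_def)
      \<comment> \<open>The two junctions are \<open>i = n\<close> and \<open>Suc i = N\<close>.\<close>
      consider "i < n" | "i = n" | "n < i" "Suc i < N" | "n < i" "Suc i = N" using i by linarith
      then show "pseudo_step \<delta> (jj i) (X i) (jj (Suc i mod N)) (X (Suc i mod N))"
      proof cases
        case 1
        then have s: "Suc i mod N = Suc i" by (simp add: N_def)
        have "f (a (Suc n - i)) = a (Suc n - Suc i)" using a(2)[of "n - i"] 1 by (simp add: Suc_diff_le)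
        then show ?thesis
          unfolding s using 1 \<delta> by (intro exact_pseudo_step adm) (auto simp: pt1)
      next
        case 2
        then have s: "Suc i mod N = Suc i" using l by (simp add: N_def)
        show ?thesis
          unfolding s using 2 q(2) x(2) a(2)[of 0] by (intro W_step[OF adm adm, of _ x]) (auto simp: pt1 pt2)
      next
        case 3
        then have s: "Suc i mod N = Suc i" by simp
        have "(f ^^ (Suc i - Suc n)) q = f ((f ^^ (i - Suc n)) q)"
          using 3 by (simp add: Suc_diff_Suc[symmetric])
        then show ?thesis
          unfolding s using 3 \<delta> by (intro exact_pseudo_step adm) (auto simp: pt2)
      next
        case 4
        then have s: "Suc i mod N = 0" by simp
        have "l = Suc (i - Suc n)" using 4 by (simp add: N_def)
        then have "f (pt (jj i) (X i)) = (f ^^ l) q" using pt2[OF 4(1)] by simp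
        then show ?thesis
          unfolding s using q(3) x'(2) by (intro W_step[OF adm adm, of _ x']) (auto simp: pt1)
      qed
    qed
    then obtain v where v: "\<And>i. i < N \<Longrightarrow> norm (v i - X i) \<le> \<epsilon>" "\<And>i. i < N \<Longrightarrow> pt (jj i) (v i) \<in> V0"
      "\<And>i. i < N \<Longrightarrow> f (pt (jj i) (v i)) = pt (jj (Suc i mod N)) (v (Suc i mod N))"
      using shadow[of N jj X] by (auto simp: N_def)
    have in_L: "pt (jj i) (v i) \<in> L" if "i < N" for i
    proof -
      have "(f ^^ N) (pt (jj i) (v i)) = pt (jj i) (v i)"
        using cyclic_iterate[of N "\<lambda>i. pt (jj i) (v i)" i N] v(3) that by simp
      then have "pt (jj i) (v i) \<in> periodic_points f"
        using that unfolding periodic_points_def by (auto intro!: exI[of _ N])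
      then show ?thesis using v(2)[OF that] per V0(3) by blast
    qed
    show ?thesis
    proof (intro exI[of _ "\<lambda>k. v (n - k)"] allI impI conjI)
      fix k assume k: "k \<le> n"
      then have kN: "n - k < N" by (simp add: N_def)
      have jX: "jj (n - k) = j k" "X (n - k) = Y k" using k by (auto simp: jj_def X_def)
      show "norm (v (n - k) - Y k) \<le> \<epsilon>" using v(1)[OF kN] jX by simp
      show "pt (j k) (v (n - k)) \<in> L" using in_L[OF kN] jX by simp
      show "f (pt (j (Suc k)) (v (n - Suc k))) = pt (j k) (v (n - k))" if "k < n"
      proof -
        have "Suc (n - Suc k) = n - k" "n - Suc k < N" using that by (auto simp: N_def)
        moreover have "jj (n - Suc k) = j (Suc k)" using that by (simp add: jj_def)
        ultimately show ?thesis using v(3)[of "n - Suc k"] kN jX(1) by simp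
      qed
    qed
  qed
  have "\<forall>a j Y n. (\<forall>k. a k \<in> V \<and> f (a (Suc k)) = a k) \<and>
     (\<forall>k. admissible (j k) (Y k) \<and> pt (j k) (Y k) = a (Suc k)) \<longrightarrow>
     (\<exists>v. \<forall>k\<le>n. norm (v k - Y k) \<le> \<epsilon> \<and> pt (j k) (v k) \<in> L \<and>
        (k < n \<longrightarrow> f (pt (j (Suc k)) (v (Suc k))) = pt (j k) (v k)))"
  proof (intro allI impI, elim conjE)
    fix a j Y n
    assume "\<forall>k. a k \<in> V \<and> f (a (Suc k)) = a k" "\<forall>k. admissible (j k) (Y k) \<and> pt (j k) (Y k) = a (Suc k)"
    then show "\<exists>v. \<forall>k\<le>n. norm (v k - Y k) \<le> \<epsilon> \<and> pt (j k) (v k) \<in> L \<and>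
        (k < n \<longrightarrow> f (pt (j (Suc k)) (v (Suc k))) = pt (j k) (v k))"
      by (intro main[of a j Y n]) auto
  qed
  then show ?thesis using open_V LV by (intro exI[of _ V] conjI)
qed

text \<open>
  The sequence \<open>z\<close> lists the past, \<open>z k\<close> being the point at time \<open>-k\<close>; the future is given by \<open>f\<close>.
\<close>

definition orbit_through :: "(nat \<Rightarrow> 'm) \<Rightarrow> int \<Rightarrow> 'm" where
  "orbit_through z i = (if i \<le> 0 then z (nat (- i)) else (f ^^ nat i) (z 0))"

lemma orbit_through_full_orbit:
  assumes "\<And>k. f (z (Suc k)) = z k"
  shows "orbit_through z \<in> orbits_of f (z 0)"
proof -
  have "f (orbit_through z i) = orbit_through z (i + 1)" for i
  proof (cases "i < 0")
    case True
    then have "nat (- i) = Suc (nat (- (i + 1)))" by simp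
    then show ?thesis using True assms by (simp add: orbit_through_def)
  next
    case False
    then have "nat (i + 1) = Suc (nat i)" by simp
    then show ?thesis using False by (cases "i = 0") (auto simp: orbit_through_def)
  qed
  then show ?thesis by (auto simp: orbits_of_def full_orbits_def orbit_through_def)
qed

text \<open>
  The shadowing orbits of longer and longer segments converge, by compactness, to a backward orbit in
  \<open>L\<close> that shadows all of \<open>a\<^bsub>1\<^esub>, a\<^bsub>2\<^esub>, \<dots>\<close>. So \<open>a\<^bsub>1\<^esub>\<close> lies in a local unstable set, hence in \<open>L\<close>, and with it
  \<open>a\<^bsub>0\<^esub> = f(a\<^bsub>1\<^esub>)\<close>. Closeness is measured in coordinates, as these pass to the limit, and only then turned
  into Riemannian distance.
\<close>

lemma backward_orbit_near_basic_set:
  assumes hyp: "hyperbolic A g f \<Omega>" and L: "closed L" "L \<subseteq> \<Omega>" "f ` L = L" "transitive_on f L"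
    and per: "periodic_points f \<subseteq> \<Omega>" and V0: "open V0" "L \<subseteq> V0" "V0 \<inter> \<Omega> \<subseteq> L" and \<epsilon>: "0 < \<epsilon>"
    and unstable: "\<forall>x\<in>L. \<forall>xs \<in> orbits_of f x \<inter> orbits_in f L. local_unstable A g f xs \<epsilon> \<subseteq> L"
  shows "\<exists>V. open V \<and> L \<subseteq> V \<and> (\<forall>a. (\<forall>k. a k \<in> V \<and> f (a (Suc k)) = a k) \<longrightarrow> a 0 \<in> L)"
proof -
  obtain M where M: "0 < M" "\<And>k p u. k < J \<Longrightarrow> p \<in> K k \<Longrightarrow>
      tnorm g (pt k p) (tangent_vec A (cc k) (pt k p) u) \<le> M * norm u"
    using tnorm_uniform_bound by blast
  define \<epsilon>' where "\<epsilon>' = min \<rho> (\<epsilon> / (2 * M))"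
  have \<epsilon>': "0 < \<epsilon>'" "\<epsilon>' \<le> \<rho>" using \<rho> \<epsilon> M(1) by (auto simp: \<epsilon>'_def)
  have "M * \<epsilon>' \<le> M * (\<epsilon> / (2 * M))" using M(1) by (intro mult_left_mono) (auto simp: \<epsilon>'_def)
  also have "\<dots> < \<epsilon>" using M(1) \<epsilon> by (simp add: field_simps)
  finally have M\<epsilon>: "M * \<epsilon>' < \<epsilon>" .
  obtain V where V: "open V" "L \<subseteq> V"
    and shadow: "\<And>a j Y n. (\<And>k. a k \<in> V \<and> f (a (Suc k)) = a k) \<Longrightarrow>
     (\<And>k. admissible (j k) (Y k) \<and> pt (j k) (Y k) = a (Suc k)) \<Longrightarrow>
     (\<exists>v. \<forall>k\<le>n. norm (v k - Y k) \<le> \<epsilon>' \<and> pt (j k) (v k) \<in> L \<and>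
        (k < n \<longrightarrow> f (pt (j (Suc k)) (v (Suc k))) = pt (j k) (v k)))"
    using backward_segment_shadowed[OF hyp L per V0 \<epsilon>'(1)] by metis
  have "a 0 \<in> L" if a: "\<And>k. a k \<in> V \<and> f (a (Suc k)) = a k" for a
  proof -
    have "\<forall>k. \<exists>j Y. admissible j Y \<and> pt j Y = a (Suc k)" using ex_admissible by blast
    then obtain j Y where Y: "\<And>k. admissible (j k) (Y k) \<and> pt (j k) (Y k) = a (Suc k)" by metis
    have "\<forall>n. \<exists>v. \<forall>k\<le>n. norm (v k - Y k) \<le> \<epsilon>' \<and> pt (j k) (v k) \<in> L \<and>
        (k < n \<longrightarrow> f (pt (j (Suc k)) (v (Suc k))) = pt (j k) (v k))"
      using shadow[of a j Y, OF a Y] by blast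
    then obtain v where v: "\<And>n k. k \<le> n \<Longrightarrow> norm (v n k - Y k) \<le> \<epsilon>'" "\<And>n k. k \<le> n \<Longrightarrow> pt (j k) (v n k) \<in> L"
      "\<And>n k. k < n \<Longrightarrow> f (pt (j (Suc k)) (v n (Suc k))) = pt (j k) (v n k)"
      by (metis less_imp_le)
    define u where "u n k = (if k \<le> n then v n k else Y k)" for n k
    have "u n k \<in> cball (Y k) \<epsilon>'" for n k
      using v(1)[of k n] \<epsilon>'(1) by (auto simp: u_def dist_norm norm_minus_commute)
    then obtain w \<sigma> where \<sigma>: "strict_mono \<sigma>" and w: "\<And>k. w k \<in> cball (Y k) \<epsilon>'"
      and lim: "\<And>k. (\<lambda>n. u (\<sigma> n) k) \<longlonglongrightarrow> w k"
      using seq_compact_product[of "\<lambda>k. cball (Y k) \<epsilon>'" u] by (metis compact_cball)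
    have jJ: "j k < J" for k using Y admissibleD(1) by blast
    have wK: "w k \<in> K (j k)" for k
      using admissibleD(2)[of "j k" "Y k" "w k"] Y w[of k] \<epsilon>'(2) by (auto simp: dist_norm norm_minus_commute)
    define z where "z k = pt (j k) (w k)" for k
    have limz: "(\<lambda>n. pt (j k) (u (\<sigma> n) k)) \<longlonglongrightarrow> z k" for k
      unfolding z_def by (rule isCont_tendsto_compose[OF isCont_pt[OF jJ wK] lim])
    have ev: "\<forall>\<^sub>F n in sequentially. k < \<sigma> n" for k
      by (rule eventually_subseq[OF \<sigma> eventually_gt_at_top])
    have zL: "z k \<in> L" for k
    proof (rule Lim_in_closed_set[OF L(1) _ _ limz])
      show "\<forall>\<^sub>F n in sequentially. pt (j k) (u (\<sigma> n) k) \<in> L"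
        using ev[of k] by eventually_elim (use v(2) in \<open>auto simp: u_def\<close>)
    qed simp
    have fz: "f (z (Suc k)) = z k" for k
    proof -
      have "(\<lambda>n. f (pt (j (Suc k)) (u (\<sigma> n) (Suc k)))) \<longlonglongrightarrow> f (z (Suc k))"
        by (rule isCont_tendsto_compose[OF isCont_f limz])
      moreover have "\<forall>\<^sub>F n in sequentially. f (pt (j (Suc k)) (u (\<sigma> n) (Suc k))) = pt (j k) (u (\<sigma> n) k)"
        using ev[of "Suc k"] by eventually_elim (use v(3) in \<open>auto simp: u_def\<close>)
      ultimately have "(\<lambda>n. pt (j k) (u (\<sigma> n) k)) \<longlonglongrightarrow> f (z (Suc k))"
        by (rule Lim_transform_eventually)
      then show ?thesis using limz LIMSEQ_unique by blast
    qed
    have fL: "(f ^^ i) y \<in> L" if "y \<in> L" for i y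
      using that L(3) by (induction i) auto
    have xs: "orbit_through z \<in> orbits_of f (z 0)" by (rule orbit_through_full_orbit[of z, OF fz])
    moreover have "orbit_through z i \<in> L" for i
      using zL fL by (simp add: orbit_through_def)
    ultimately have "orbit_through z \<in> orbits_of f (z 0) \<inter> orbits_in f L"
      by (auto simp: orbits_in_def orbits_of_def)
    then have "local_unstable A g f (orbit_through z) \<epsilon> \<subseteq> L" using unstable zL by blast
    moreover have "a 1 \<in> local_unstable A g f (orbit_through z) \<epsilon>"
    proof -
      let ?b = "\<lambda>k. a (Suc k)"
      have "orbit_through ?b \<in> orbits_of f (?b 0)" by (rule orbit_through_full_orbit[of ?b]) (use a in blast)
      moreover have "riemannian_dist A g (orbit_through z i) (orbit_through ?b i) < ennreal \<epsilon>" if "i \<le> 0" for i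
      proof -
        define k where "k = nat (- i)"
        have seg: "closed_segment (w k) (Y k) \<subseteq> cball (Y k) \<rho>"
          using w[of k] \<epsilon>'(2) \<rho> by (intro closed_segment_subset) auto
        have cb: "cball (Y k) \<rho> \<subseteq> K (j k)" using Y by (auto simp: admissible_def)
        have "riemannian_dist A g (pt (j k) (w k)) (pt (j k) (Y k)) \<le> ennreal (M * norm (Y k - w k))"
          by (rule riemannian_dist_le_chart[OF cc[OF jJ] seg]) (use cb K(2)[OF jJ] M(2)[OF jJ] in blast)+
        also have "\<dots> \<le> ennreal (M * \<epsilon>')"
          using w[of k] M(1) by (intro ennreal_leI mult_left_mono) (auto simp: dist_norm)
        also have "\<dots> < ennreal \<epsilon>" using M\<epsilon> \<epsilon> by (simp add: ennreal_lessI)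
        finally show ?thesis using that Y by (simp add: orbit_through_def k_def z_def)
      qed
      ultimately show ?thesis unfolding local_unstable_def by auto
    qed
    ultimately have "a 1 \<in> L" by blast
    then have "f (a 1) \<in> L" using L(3) by blast
    then show ?thesis using a[of 0] by simp
  qed
  then show ?thesis using V by blast
qed

end

section \<open>Attractors\<close>

text \<open>
  Otherwise arbitrarily long orbit segments in \<open>N\<close> would end outside \<open>W\<close>, and a limit of them would be
  an infinite backward orbit in \<open>N\<close> that starts outside \<open>L\<close>.
\<close>

lemma backward_orbits_enter_neighbourhood:
  fixes f :: "'m::{t2_space,second_countable_topology} \<Rightarrow> 'm"
  assumes M: "compact (UNIV :: 'm set)" and f: "continuous_on UNIV f" and N: "closed N"
    and trap: "\<forall>a. (\<forall>k. a k \<in> N \<and> f (a (Suc k)) = a k) \<longrightarrow> a 0 \<in> L"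
    and W: "open W" "L \<subseteq> W"
  shows "\<exists>n. \<forall>a. (\<forall>k\<le>n. a k \<in> N) \<and> (\<forall>k<n. f (a (Suc k)) = a k) \<longrightarrow> a 0 \<in> W"
proof (rule ccontr)
  assume "\<not> ?thesis"
  then have "\<forall>n. \<exists>a. (\<forall>k\<le>n. a k \<in> N) \<and> (\<forall>k<n. f (a (Suc k)) = a k) \<and> a 0 \<notin> W" by blast
  then obtain a where a: "\<And>n k. k \<le> n \<Longrightarrow> a n k \<in> N" "\<And>n k. k < n \<Longrightarrow> f (a n (Suc k)) = a n k" "\<And>n. a n 0 \<notin> W"
    by metis
  obtain l \<sigma> where \<sigma>: "strict_mono \<sigma>" and lim: "\<And>k. (\<lambda>n. a (\<sigma> n) k) \<longlonglongrightarrow> l k"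
    using seq_compact_product[of "\<lambda>_. UNIV" a] M by blast
  have ev: "\<forall>\<^sub>F n in sequentially. k < \<sigma> n" for k
    by (rule eventually_subseq[OF \<sigma> eventually_gt_at_top])
  have "l k \<in> N" for k
  proof (rule Lim_in_closed_set[OF N _ _ lim])
    show "\<forall>\<^sub>F n in sequentially. a (\<sigma> n) k \<in> N" using ev[of k] by eventually_elim (use a in auto)
  qed simp
  moreover have "f (l (Suc k)) = l k" for k
  proof -
    have "isCont f (l (Suc k))" using f continuous_on_eq_continuous_at open_UNIV by blast
    from isCont_tendsto_compose[OF this lim] have "(\<lambda>n. f (a (\<sigma> n) (Suc k))) \<longlonglongrightarrow> f (l (Suc k))" .
    moreover have "\<forall>\<^sub>F n in sequentially. f (a (\<sigma> n) (Suc k)) = a (\<sigma> n) k"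
      using ev[of k] by eventually_elim (use a in auto)
    ultimately have "(\<lambda>n. a (\<sigma> n) k) \<longlonglongrightarrow> f (l (Suc k))" by (rule Lim_transform_eventually)
    then show ?thesis using lim LIMSEQ_unique by blast
  qed
  ultimately have "l 0 \<in> W" using trap W(2) by blast
  moreover have "l 0 \<in> - W" by (rule Lim_in_closed_set[OF _ _ _ lim[of 0]]) (use W(1) a(3) in auto)
  ultimately show False by simp
qed

text \<open>
  Let \<open>h\<close> be a Urysohn function that vanishes on \<open>L\<close> and is \<open>1\<close> outside \<open>V\<close>, and let \<open>n\<close> be such that every
  orbit \<open>x, f(x), \<dots>, f\<^sup>n(x)\<close> in \<open>{h \<le> 1/2}\<close> satisfies \<open>h(f\<^bsup>n+1\<^esup>(x)) < 1/4\<close>. The attracting neighbourhood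
  consists of the \<open>x\<close> with \<open>h(f\<^sup>i(x)) \<le> t\<^bsub>i\<^esub>\<close> for \<open>i \<le> n\<close>, with levels \<open>t\<^bsub>i\<^esub>\<close> decreasing strictly from \<open>1/2\<close> and
  staying above \<open>1/4\<close>. Under \<open>f\<close> each condition is replaced by the next one, which is strictly stronger,
  and the last one by \<open>h < 1/4\<close>; so \<open>f\<close> maps the neighbourhood into its interior.
\<close>

lemma attractor_if_backward_isolated:
  fixes f :: "'m::{t2_space,second_countable_topology} \<Rightarrow> 'm"
  assumes M: "compact (UNIV :: 'm set)" and f: "continuous_on UNIV f"
    and L: "closed L" "f ` L = L" and V: "open V" "L \<subseteq> V"
    and trap: "\<forall>a. (\<forall>k. a k \<in> V \<and> f (a (Suc k)) = a k) \<longrightarrow> a 0 \<in> L"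
  shows "attractor f L"
proof -
  have "Hausdorff_space (euclidean :: 'm topology)"
    unfolding Hausdorff_space_def disjnt_def using separation_t2 by auto
  moreover have "compact_space (euclidean :: 'm topology)" using M by (simp add: compact_space_def)
  ultimately have "normal_space (euclidean :: 'm topology)"
    using compact_Hausdorff_or_regular_imp_normal_space by blast
  then obtain h where "continuous_map euclidean (top_of_set {0..1::real}) h" "h ` L \<subseteq> {0}" "h ` (- V) \<subseteq> {1}"
    by (rule Urysohn_lemma[of euclidean L "- V" 0 "1::real"]) (use L V in \<open>auto simp: disjnt_def closedin_closed_eq\<close>)
  then have h: "continuous_on UNIV h" "\<And>x. x \<in> L \<Longrightarrow> h x = 0" "\<And>x. x \<notin> V \<Longrightarrow> h x = 1"
    by (auto simp: continuous_map_in_subtopology)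
  define N where "N = {x. h x \<le> 1 / 2}"
  have N: "closed N" unfolding N_def by (intro closed_Collect_le h continuous_intros)
  have "N \<subseteq> V" using h(3) by (force simp: N_def)
  then have trap_N: "\<forall>a. (\<forall>k. a k \<in> N \<and> f (a (Suc k)) = a k) \<longrightarrow> a 0 \<in> L" using trap by blast
  have cont: "continuous_on UNIV (f ^^ i)" for i
    by (induction i) (auto intro: continuous_on_compose2[OF f])
  have hf: "continuous_on UNIV (\<lambda>x. h ((f ^^ i) x))" for i
    by (rule continuous_on_compose2[OF h(1) cont]) simp
  have fL: "(f ^^ i) ` L = L" for i
  proof (induction i)
    case (Suc i)
    have "(f ^^ Suc i) ` L = f ` (f ^^ i) ` L" by (simp add: image_comp)
    then show ?case using Suc L(2) by simp
  qed simp
  define W where "W = {x. h (f x) < 1 / 4}"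
  have "open W" unfolding W_def using hf[of 1] by (intro open_Collect_less) auto
  moreover have "x \<in> W" if "x \<in> L" for x
  proof -
    have "f x \<in> L" using that L(2) by blast
    then show ?thesis using h(2) by (simp add: W_def)
  qed
  then have "L \<subseteq> W" by blast
  ultimately obtain n where n: "\<And>a. (\<forall>k\<le>n. a k \<in> N) \<and> (\<forall>k<n. f (a (Suc k)) = a k) \<Longrightarrow> a 0 \<in> W"
    using backward_orbits_enter_neighbourhood[of f N L W, OF M f N trap_N] by metis
  define t where "t i = 1 / 2 - real i / (4 * real (Suc n))" for i
  have t_Suc: "t (Suc i) < t i" and t0: "t i \<le> 1 / 2" for i by (auto simp: t_def field_simps)
  have tn: "1 / 4 < t n" by (simp add: t_def field_simps)
  have t_pos: "0 < t i" if "i \<le> n" for i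
    using that by (simp add: t_def field_simps)
  define B where "B = {x. \<forall>i\<le>n. h ((f ^^ i) x) \<le> t i}"
  define B' where "B' = {x. \<forall>i\<le>n. h ((f ^^ i) x) < t i}"
  have "B = (\<Inter>i\<le>n. {x. h ((f ^^ i) x) \<le> t i})" by (auto simp: B_def)
  then have closed_B: "closed B" by (auto intro!: closed_Collect_le hf continuous_intros)
  have "B' = (\<Inter>i\<le>n. {x. h ((f ^^ i) x) < t i})" by (auto simp: B'_def)
  then have "open B'" by (auto intro!: open_INT open_Collect_less hf continuous_intros)
  moreover have "B' \<subseteq> B" by (auto simp: B_def B'_def less_imp_le)
  ultimately have int: "B' \<subseteq> interior B" by (rule interior_maximal[rotated])
  have L_B': "L \<subseteq> B'"
  proof
    fix x assume "x \<in> L"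
    then have "(f ^^ i) x \<in> L" for i using fL by blast
    then show "x \<in> B'" using h(2) t_pos by (simp add: B'_def)
  qed
  have BN: "B \<subseteq> N" by (auto simp: B_def N_def t_def)
  have fB: "f ` B \<subseteq> B'"
  proof (rule image_subsetI)
    fix x assume x: "x \<in> B"
    have xi: "(f ^^ i) x \<in> N" if "i \<le> n" for i
      using x that t0[of i] unfolding B_def N_def by (auto intro: order_trans)
    have "(f ^^ (n - 0)) x \<in> W"
    proof (rule n[of "\<lambda>k. (f ^^ (n - k)) x"], intro conjI allI impI)
      fix k assume "k < n"
      then have "n - k = Suc (n - Suc k)" by simp
      then show "f ((f ^^ (n - Suc k)) x) = (f ^^ (n - k)) x" by simp
    qed (use xi in auto)
    then have last: "h ((f ^^ n) (f x)) < 1 / 4" by (simp add: W_def funpow_swap1)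
    have "h ((f ^^ i) (f x)) < t i" if i: "i \<le> n" for i
    proof (cases "i = n")
      case True
      then show ?thesis using last tn by simp
    next
      case False
      then have "h ((f ^^ Suc i) x) \<le> t (Suc i)" using x i by (simp add: B_def del: funpow.simps)
      then show ?thesis using t_Suc[of i] by (simp add: funpow_swap1)
    qed
    then show "f x \<in> B'" by (simp add: B'_def)
  qed
  have fB_n: "(f ^^ i) ` B \<subseteq> B" for i
    by (induction i) (use fB \<open>B' \<subseteq> B\<close> in \<open>auto simp: image_subset_iff subset_iff\<close>)
  have "(\<Inter>n. (f ^^ n) ` B) = L"
  proof
    have "L \<subseteq> B" using L_B' \<open>B' \<subseteq> B\<close> by blast
    then show "L \<subseteq> (\<Inter>n. (f ^^ n) ` B)" using fL by blast
    show "(\<Inter>n. (f ^^ n) ` B) \<subseteq> L"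
    proof (rule subsetI, rule ccontr)
      fix y assume y: "y \<in> (\<Inter>n. (f ^^ n) ` B)" "y \<notin> L"
      obtain m where m: "\<And>a. (\<forall>k\<le>m. a k \<in> N) \<and> (\<forall>k<m. f (a (Suc k)) = a k) \<Longrightarrow> a 0 \<in> - {y}"
        using backward_orbits_enter_neighbourhood[of f N L "- {y}", OF M f N trap_N] y(2) by auto
      obtain x where x: "x \<in> B" "y = (f ^^ m) x" using y(1) by blast
      have "(f ^^ (m - 0)) x \<in> - {y}"
      proof (rule m[of "\<lambda>k. (f ^^ (m - k)) x"], intro conjI allI impI)
        fix k
        show "(f ^^ (m - k)) x \<in> N" using fB_n x(1) BN by blast
        assume "k < m"
        then have "m - k = Suc (m - Suc k)" by simp
        then show "f ((f ^^ (m - Suc k)) x) = (f ^^ (m - k)) x" by simp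
      qed
      then show False using x(2) by simp
    qed
  qed
  then show ?thesis
    unfolding attractor_def using closed_B L_B' int fB by (intro exI[of _ B]) blast
qed

text \<open>
  A point of the local unstable set has its whole past in the attracted neighbourhood \<open>U\<close>, so it belongs to
  all images \<open>f\<^sup>n(U)\<close>.
\<close>

lemma (in riemannian_manifold) attractor_contains_local_unstable:
  assumes L: "closed L" and "attractor f L"
  shows "\<exists>\<epsilon>>0. \<forall>x\<in>L. \<forall>xs \<in> orbits_of f x \<inter> orbits_in f L. local_unstable A g f xs \<epsilon> \<subseteq> L"
proof -
  obtain U where U: "L \<subseteq> interior U" "(\<Inter>n. (f ^^ n) ` U) = L"
    using assms(2) unfolding attractor_def by blast
  have "compact L" using compact_M L by (metis closed_Int_compact inf_top.right_neutral)
  then obtain \<epsilon> where \<epsilon>: "0 < \<epsilon>" "\<And>x y. x \<in> L \<Longrightarrow> riemannian_dist A g x y < ennreal \<epsilon> \<Longrightarrow> y \<in> interior U"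
    using riemannian_dist_nbhd[OF _ U(1) open_interior] by blast
  have "y \<in> L" if xs: "xs \<in> orbits_in f L" and y: "y \<in> local_unstable A g f xs \<epsilon>" for xs y
  proof -
    obtain ys where ys: "ys \<in> full_orbits f" "ys 0 = y"
      "\<And>k. k \<le> 0 \<Longrightarrow> riemannian_dist A g (xs k) (ys k) < ennreal \<epsilon>"
      using y unfolding local_unstable_def orbits_of_def by blast
    have "y \<in> (f ^^ n) ` U" for n
    proof -
      have "xs (- int n) \<in> L" using xs unfolding orbits_in_def by blast
      from \<epsilon>(2)[OF this ys(3)] have "ys (- int n) \<in> U" using interior_subset by auto
      moreover have "(f ^^ n) (ys (- int n)) = y" using full_orbit_iterate[OF ys(1)] ys(2) by simp
      ultimately show ?thesis by blast
    qed
    then show ?thesis using U(2) by blast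
  qed
  then show ?thesis using \<epsilon>(1) by blast
qed

lemma periodic_points_nonwandering: "periodic_points f \<subseteq> nonwandering f"
proof
  fix x assume "x \<in> periodic_points f"
  then obtain p where p: "p \<ge> 1" "(f ^^ p) x = x" unfolding periodic_points_def by blast
  have "(f ^^ p) ` U \<inter> U \<noteq> {}" if "x \<in> U" for U
    using p(2) that by (metis IntI emptyE image_eqI)
  then show "x \<in> nonwandering f" using p(1) unfolding nonwandering_def by blast
qed

text \<open>
  The other basic sets are finite in number, closed, and disjoint from this one.
\<close>

lemma basic_set_isolated:
  assumes "spectral_decomposition f B" "L \<in> B"
  shows "\<exists>V. open V \<and> L \<subseteq> V \<and> V \<inter> nonwandering f \<subseteq> L"
proof (intro exI conjI)
  have B: "finite B" "pairwise disjnt B" "\<Union>B = nonwandering f" "\<And>L. L \<in> B \<Longrightarrow> closed L"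
    using assms(1) unfolding spectral_decomposition_def by auto
  show "open (- \<Union>(B - {L}))" using B by (intro open_Compl closed_Union) auto
  show "L \<subseteq> - \<Union>(B - {L})" using B(2) assms(2) by (auto simp: pairwise_def disjnt_def)
  show "- \<Union>(B - {L}) \<inter> nonwandering f \<subseteq> L" using B(3) by blast
qed

theorem theorem1:
  fixes A :: "('m::{t2_space,second_countable_topology}, 'e::euclidean_space) chart set"
    and g :: "'m \<Rightarrow> 'e \<Rightarrow> 'e \<Rightarrow> real"
    and r :: enat
    and f :: "'m \<Rightarrow> 'm"
    and \<Lambda> :: "'m set"
  assumes "smooth_closed_manifold A"
    and "riemannian_metric A g"
    and "1 \<le> r"
    and "A_endomorphism A g r f"
    and "basic_set f \<Lambda>"
  shows "attractor f \<Lambda> \<longleftrightarrow>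
    (\<exists>\<epsilon>>0. \<forall>x\<in>\<Lambda>. \<forall>xs \<in> orbits_of f x \<inter> orbits_in f \<Lambda>. local_unstable A g f xs \<epsilon> \<subseteq> \<Lambda>)"
proof -
  interpret riemannian_self_map A g f r
    using assms(1-4) by unfold_locales (auto simp: A_endomorphism_def endomorphism_def)
  obtain B where B: "spectral_decomposition f B" "\<Lambda> \<in> B" using assms(5) unfolding basic_set_def by blast
  have \<Lambda>: "closed \<Lambda>" "\<Lambda> \<subseteq> nonwandering f" "f ` \<Lambda> = \<Lambda>" "transitive_on f \<Lambda>"
    using B unfolding spectral_decomposition_def by auto
  have hyp: "hyperbolic A g f (nonwandering f)" using assms(4) unfolding A_endomorphism_def by blast
  obtain V0 where V0: "open V0" "\<Lambda> \<subseteq> V0" "V0 \<inter> nonwandering f \<subseteq> \<Lambda>" using basic_set_isolated[OF B] by blast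
  show ?thesis
  proof
    assume "attractor f \<Lambda>"
    then show "\<exists>\<epsilon>>0. \<forall>x\<in>\<Lambda>. \<forall>xs \<in> orbits_of f x \<inter> orbits_in f \<Lambda>. local_unstable A g f xs \<epsilon> \<subseteq> \<Lambda>"
      by (rule attractor_contains_local_unstable[OF \<Lambda>(1)])
  next
    assume "\<exists>\<epsilon>>0. \<forall>x\<in>\<Lambda>. \<forall>xs \<in> orbits_of f x \<inter> orbits_in f \<Lambda>. local_unstable A g f xs \<epsilon> \<subseteq> \<Lambda>"
    then obtain \<epsilon> where \<epsilon>: "0 < \<epsilon>"
      "\<forall>x\<in>\<Lambda>. \<forall>xs \<in> orbits_of f x \<inter> orbits_in f \<Lambda>. local_unstable A g f xs \<epsilon> \<subseteq> \<Lambda>"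
      by blast
    obtain cc and J :: nat and K \<rho> where "0 < \<rho>" "\<forall>j<J. cc j \<in> A \<and> compact (K j) \<and> K j \<subseteq> cimg (cc j)"
      "\<forall>x. \<exists>j<J. x \<in> cdom (cc j) \<and> cball (coord (cc j) x) \<rho> \<subseteq> K j"
      using finite_atlas_exists by blast
    then interpret finite_atlas_map A g f r cc J K \<rho> by unfold_locales auto
    obtain V where "open V" "\<Lambda> \<subseteq> V" "\<forall>a. (\<forall>k. a k \<in> V \<and> f (a (Suc k)) = a k) \<longrightarrow> a 0 \<in> \<Lambda>"
      using backward_orbit_near_basic_set[OF hyp \<Lambda> periodic_points_nonwandering V0 \<epsilon>] by blast
    then show "attractor f \<Lambda>" by (rule attractor_if_backward_isolated[OF compact_M continuous_f \<Lambda>(1,3)])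
  qed
qed

end
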